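(* Let $\Omega\subseteq\mathbb R^n$ and $\Upsilon\subseteq\mathbb R^m$ be open subsets and let $\bar x\in\Omega$. For $\alpha=1,\dots,m$, let $I_\alpha=\{i_1,i_2,\dots,i_{p_\alpha}\}$ be an ordered set of indices, $1\le i_1<i_2<\cdots<i_{p_\alpha}\le n$ (the elements $i_j$ and the cardinality $p_\alpha$ may depend on $\alpha$). Assume the following: (1) $\mathfrak R=\{\mathbf r_i\}_{i=1}^n$ is a $C^1$ frame on $\Omega$; (2) for each $\alpha$, $\Xi_\alpha$ is an embedded $C^1$ manifold in $\Omega$, and $\bar x\in\bigcap_\alpha\Xi_\alpha$; (3) the manifold $\Xi_\alpha$ is of codimension $p_\alpha$ and is everywhere transverse to the span of $\{\mathbf r_i\}_{i\in I_\alpha}$; (4) the frame $\mathfrak R$ and the set of manifolds $\Xi:=\{\Xi_1,\dots,\Xi_m\}$ form a stable configuration near $\bar x$ (as defined in the context); (5) for each $\alpha$, $g_\alpha:\Xi_\alpha\to\mathbb R$ is $C^1$-smooth and bounded, and $\bar g:=(g_1(\bar x),\dots,g_m(\bar x))\in\Upsilon$; (6) for each $\alpha$ and each $i\in I_\alpha$, $f_i^\alpha:\Omega\times\Upsilon\to\mathbb R$ is uniformly bounded and continuous on $\Omega\times\Upsilon$ and also uniformly Lipschitz in the second argument; (7) the functions $f_i^\alpha$ belong to $C^1(\Omega\times\Upsilon)$; (8) for each $\alpha$, for each $i,j\in I_\alpha$ with $i\ne j$, and for each $\beta\in\{1,\dots,m\}$: if $i\notin I_\beta$, then $\partial_{u_\beta}f_j^\alpha=0$;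 (9) for each $\alpha$, the vector fields $\{\mathbf r_i\}_{i\in I_\alpha}$ are in involution, i.e. $[\mathbf r_j,\mathbf r_k]\in\operatorname{span}\{\mathbf r_i\}_{i\in I_\alpha}$ whenever $j,k\in I_\alpha$; (10) for each $\alpha$, for each $i,j\in I_\alpha$ with $i\neq j$, and for all $(x,u)\in\Omega\times\Upsilon$: $$(\nabla_x f_j^\alpha)|_{(x,u)}\cdot\mathbf r_i|_x+\sum_{\beta:\,i\in I_\beta}\partial_{u_\beta}f_j^\alpha(x,u)\,f_i^\beta(x,u)-(\nabla_x f_i^\alpha)|_{(x,u)}\cdot\mathbf r_j|_x-\sum_{\beta:\,j\in I_\beta}\partial_{u_\beta}f_i^\alpha(x,u)\,f_j^\beta(x,u)=\sum_{k\in I_\alpha}c_{ij}^k(x)\,f_k^\alpha(x,u),$$ where $\nabla_x$ denotes the gradient with respect to the variables $x$ and $c_{ij}^k$ are the structure coefficients of the frame, $[\mathbf r_i,\mathbf r_j]|_x=\sum_{k=1}^n c_{ij}^k(x)\,\mathbf r_k|_x$ for $x\in\Omega$, $1\le i,j\le n$; (11) for each $\alpha$ and each $i,j,k\in I_\alpha$, the structure coefficient $c_{ij}^k(x)$ is uniformly bounded on $\Omega$. Then there is a neighborhood $\widetilde\Omega$ of $\bar x$ on which there is a unique solution $u=(u_1,\dots,u_m)$ to the system $$\mathbf r_i(u_\alpha)|_x=f_i^\alpha(x,u(x))\quad\text{for }1\le\alpha\le m,\ i\in I_\alpha,\ x\in\widetilde\Omega,$$ satisfying the data $$u_\alpha(x)=g_\alpha(x)\quad\text{for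 }x\in\Xi_\alpha\cap\widetilde\Omega,\ 1\le\alpha\le m.$$
   Context: A solution on $\widetilde\Omega$ means a $C^1$-smooth function $u=(u_1,\dots,u_m):\widetilde\Omega\to\Upsilon$ satisfying the equations and the data pointwise. Uniqueness means that any two solutions, both defined on the (fixed) neighborhood $\widetilde\Omega$, agree on all of $\widetilde\Omega$. A $C^1$ frame on $\Omega$ is a collection of $n$ $C^1$ vector fields on $\Omega$ that are linearly independent at each point; $\mathbf r_i(h)|_x=\nabla h(x)\cdot\mathbf r_i|_x$ denotes the derivative of $h$ along $\mathbf r_i$ at $x$. All norms on $\mathbb R^p$ are max norms $\|\cdot\|_\infty$; $B_\epsilon(y)$ is the corresponding open ball. "Uniformly Lipschitz in the second argument" means there is $L$ with $|f(x,u)-f(x,v)|\le L\|u-v\|_\infty$ for all $x\in\Omega$, $u,v\in\Upsilon$. Throughout $1\le\alpha,\beta\le m$ and $p_\alpha=|I_\alpha|\in\{1,\dots,n\}$. Charts. Each $\Xi_\alpha$ is assumed small enough to be covered by a single chart centered at $\bar x$: there is a $C^1$-diffeomorphism $\xi_\alpha:\mathcal U_\alpha\to\Xi_\alpha$ with $\mathcal U_\alpha\subset\mathbb R^{n-p_\alpha}$ an open neighborhood of the origin and $\xi_\alpha(0)=\bar x$. Let $W_i^t$ denote the flow of $\mathbf r_i$: $\frac{d}{dt}W_i^t(x)=\mathbf r_i|_{W_i^t(x)}$, $W_i^0(x)=x$. With $I_\alpha=\{i_1<\cdots<i_{p_\alpha}\}$, define $$\psi_\alpha(t):=W_{i_{p_\alpha}}^{t_{p_\alpha}}\cdots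 W_{i_2}^{t_2}W_{i_1}^{t_1}\,\xi_\alpha(t_{p_\alpha+1},\dots,t_n),\qquad t=(t_1,\dots,t_n)\in\Theta_\alpha,$$ where $\Theta_\alpha\subset\mathbb R^n$ is an open neighborhood of the origin chosen small enough that $\psi_\alpha$ is well defined and is a $C^1$-diffeomorphism of $\Theta_\alpha$ onto its open image $\Omega_\alpha:=\psi_\alpha(\Theta_\alpha)$ (possible by the transversality of $\Xi_\alpha$ to the span of $\{\mathbf r_i\}_{i\in I_\alpha}$). The manifold $\Xi_\alpha$ is then shrunk to $\Xi_\alpha\cap\Omega_\alpha$. Accessibility. Let $p\in\{1,\dots,n\}$. An open neighborhood $\Theta\subset\mathbb R^n$ of the origin is called $p$-accessible if for each $t=(t_1,\dots,t_n)\in\Theta$ the piecewise linear path with successive vertices $(0,\dots,0,t_{p+1},\dots,t_n)$, $(t_1,0,\dots,0,t_{p+1},\dots,t_n)$, $(t_1,t_2,0,\dots,0,t_{p+1},\dots,t_n)$, $\dots$, $(t_1,t_2,\dots,t_n)$ belongs to $\Theta$. Stable configuration. $(\mathfrak R,\Xi)$ is a stable configuration near $\bar x$ if for every $\epsilon>0$ there exist an open neighborhood $\Omega_\epsilon\subset B_\epsilon(\bar x)$ of $\bar x$ and, for each $\alpha=1,\dots,m$, a $p_\alpha$-accessible neighborhood $\Theta_{\alpha,\epsilon}\subset\mathbb R^n$ of the origin (contained in the domain $\Theta_\alpha$ of $\psi_\alpha$) such that for all $\alpha$ the map $\psi_\alpha:\Theta_{\alpha,\epsilon}\to\Omega_\epsilon$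 is a $C^1$-diffeomorphism (onto $\Omega_\epsilon$; the same $\Omega_\epsilon$ for all $\alpha$). *)

theory Defs
  imports "HOL-Analysis.Analysis"
begin

text \<open>
  \<open>\<real>\<^sup>n\<close> is \<open>real ^ 'n\<close> with \<open>'n\<close> finite and linearly ordered: the order identifies \<open>'n\<close> with
  \<open>{1, \<dots>, n}\<close>, which both the ordering of the index sets and the splitting of
  \<open>(t\<^sub>1, \<dots>, t\<^sub>n)\<close> into its first \<open>p\<close> and last \<open>n - p\<close> entries rely on.
\<close>

section \<open>Maps of class \<open>C\<^sup>1\<close>\<close>

text \<open>
  On an arbitrary subset \<open>A\<close> of a normed space, \<open>C\<^sup>1\<close> means that \<open>f\<close> has, near each point of \<open>A\<close>,
  a \<open>C\<^sup>1\<close> extension to an open set of the ambient space. For open \<open>A\<close> this is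
  continuous differentiability (lemma \<open>C1_on_open_iff\<close>); on an embedded submanifold it is
  the intrinsic notion.
\<close>

definition C1_on :: "'a::real_normed_vector set \<Rightarrow> ('a \<Rightarrow> 'b::real_normed_vector) \<Rightarrow> bool" where
  "C1_on A f \<longleftrightarrow>
     (\<forall>x\<in>A. \<exists>V F (F' :: 'a \<Rightarrow> 'a \<Rightarrow>\<^sub>L 'b).
        open V \<and> x \<in> V \<and> (\<forall>y\<in>V. (F has_derivative blinfun_apply (F' y)) (at y)) \<and>
        continuous_on V F' \<and> (\<forall>y\<in>A \<inter> V. F y = f y))"

lemma C1_on_open_iff:
  fixes f :: "'a::real_normed_vector \<Rightarrow> 'b::real_normed_vector"
  assumes "open A"
  shows "C1_on A f \<longleftrightarrow>
     (\<exists>f' :: 'a \<Rightarrow> 'a \<Rightarrow>\<^sub>L 'b. (\<forall>x\<in>A. (f has_derivative blinfun_apply (f' x)) (at x)) \<and> continuous_on A f')"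
proof
  assume C: "C1_on A f"
  define f' :: "'a \<Rightarrow> 'a \<Rightarrow>\<^sub>L 'b" where "f' x = Blinfun (frechet_derivative f (at x))" for x
  have loc: "\<exists>W (F' :: 'a \<Rightarrow> 'a \<Rightarrow>\<^sub>L 'b). open W \<and> x \<in> W \<and> W \<subseteq> A \<and>
      (\<forall>y\<in>W. (f has_derivative blinfun_apply (F' y)) (at y) \<and> f' y = F' y) \<and> continuous_on W F'"
    if "x \<in> A" for x
  proof -
    obtain V F and F' :: "'a \<Rightarrow> 'a \<Rightarrow>\<^sub>L 'b" where V: "open V" "x \<in> V"
      "\<And>y. y \<in> V \<Longrightarrow> (F has_derivative blinfun_apply (F' y)) (at y)"
      "continuous_on V F'" "\<And>y. y \<in> A \<inter> V \<Longrightarrow> F y = f y"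
      using C \<open>x \<in> A\<close> unfolding C1_on_def by metis
    have d: "(f has_derivative blinfun_apply (F' y)) (at y)" if "y \<in> A \<inter> V" for y
      by (rule has_derivative_transform_within_open[OF V(3), of _ "A \<inter> V"])
        (use that V assms in auto)
    moreover have "f' y = F' y" if "y \<in> A \<inter> V" for y
      using frechet_derivative_at[OF d[OF that]] by (metis f'_def blinfun_apply_inverse)
    ultimately show ?thesis
      using V assms \<open>x \<in> A\<close>
      by (intro exI[of _ "A \<inter> V"] exI[of _ F']) (auto intro: continuous_on_subset)
  qed
  have "(f has_derivative blinfun_apply (f' x)) (at x)" if "x \<in> A" for x
    using loc[OF that] by fastforce
  moreover have "continuous_on A f'"
  proof (rule continuous_at_imp_continuous_on, rule ballI)
    fix x assume "x \<in> A"
    then obtain W and F' :: "'a \<Rightarrow> 'a \<Rightarrow>\<^sub>L 'b" where W: "open W" "x \<in> W" "\<And>y. y \<in> W \<Longrightarrow> f' y = F' y"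
      "continuous_on W F'"
      using loc by metis
    then have "continuous_on W f'"
      by (simp cong: continuous_on_cong)
    then show "isCont f' x"
      using W continuous_on_eq_continuous_at by blast
  qed
  ultimately show "\<exists>f' :: 'a \<Rightarrow> 'a \<Rightarrow>\<^sub>L 'b.
      (\<forall>x\<in>A. (f has_derivative blinfun_apply (f' x)) (at x)) \<and> continuous_on A f'"
    by blast
next
  assume "\<exists>f' :: 'a \<Rightarrow> 'a \<Rightarrow>\<^sub>L 'b.
      (\<forall>x\<in>A. (f has_derivative blinfun_apply (f' x)) (at x)) \<and> continuous_on A f'"
  then show "C1_on A f"
    using assms unfolding C1_on_def by blast
qed

definition C1_diffeo ::
    "'a::real_normed_vector set \<Rightarrow> 'b::real_normed_vector set \<Rightarrow> ('a \<Rightarrow> 'b) \<Rightarrow> bool" where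
  "C1_diffeo A B \<phi> \<longleftrightarrow> bij_betw \<phi> A B \<and> C1_on A \<phi> \<and> C1_on B (inv_into A \<phi>)"

definition grad :: "(real ^ 'k::finite \<Rightarrow> real) \<Rightarrow> real ^ 'k \<Rightarrow> real ^ 'k" where
  "grad h x = (\<chi> j. frechet_derivative h (at x) (axis j 1))"

section \<open>Vector fields\<close>

definition lie_bracket ::
    "(real ^ 'n::finite \<Rightarrow> real ^ 'n) \<Rightarrow> (real ^ 'n \<Rightarrow> real ^ 'n) \<Rightarrow> real ^ 'n \<Rightarrow> real ^ 'n" where
  "lie_bracket X Y x =
     frechet_derivative Y (at x) (X x) - frechet_derivative X (at x) (Y x)"

definition C1_frame :: "(real ^ 'n::finite) set \<Rightarrow> ('n \<Rightarrow> real ^ 'n \<Rightarrow> real ^ 'n) \<Rightarrow> bool" where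
  "C1_frame \<Omega> r \<longleftrightarrow>
     (\<forall>i. C1_on \<Omega> (r i)) \<and>
     (\<forall>x\<in>\<Omega>. inj (\<lambda>i. r i x) \<and> independent (range (\<lambda>i. r i x)))"

text \<open>\<open>flows_to \<Omega> X t x y\<close>: the integral curve of \<open>X\<close> in \<open>\<Omega>\<close> starting at \<open>x\<close> exists up to
  time \<open>t\<close>, which may be negative, and is then at \<open>y\<close>. For \<open>X\<close> of class \<open>C\<^sup>1\<close> on an open \<open>\<Omega>\<close>,
  \<open>y\<close> is unique.\<close>

definition flows_to ::
    "(real ^ 'n::finite) set \<Rightarrow> (real ^ 'n \<Rightarrow> real ^ 'n) \<Rightarrow> real \<Rightarrow> real ^ 'n \<Rightarrow> real ^ 'n \<Rightarrow> bool" where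
  "flows_to \<Omega> X t x y \<longleftrightarrow>
     (\<exists>\<gamma>. \<gamma> 0 = x \<and> \<gamma> t = y \<and>
        (\<forall>s\<in>closed_segment 0 t. \<gamma> s \<in> \<Omega> \<and>
           (\<gamma> has_vector_derivative X (\<gamma> s)) (at s within closed_segment 0 t)))"

definition flow ::
    "(real ^ 'n::finite) set \<Rightarrow> (real ^ 'n \<Rightarrow> real ^ 'n) \<Rightarrow> real \<Rightarrow> real ^ 'n \<Rightarrow> real ^ 'n" where
  "flow \<Omega> X t x = (THE y. flows_to \<Omega> X t x y)"

section \<open>Coordinates and submanifolds\<close>

text \<open>\<open>coord k\<close> is the index in \<open>'n\<close> of the coordinate \<open>t\<^bsub>k+1\<^esub>\<close>; counting starts at 0.\<close>

definition coord :: "nat \<Rightarrow> 'n::{finite,linorder}" where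
  "coord k = sorted_list_of_set UNIV ! k"

text \<open>The dimension \<open>n - p\<close> depends on the index \<open>\<alpha>\<close>, so \<open>\<real>\<^bsup>n-p\<^esup>\<close> is represented by the
  coordinate subspace \<open>0 \<times> \<real>\<^bsup>n-p\<^esup>\<close> of \<open>\<real>\<^sup>n\<close>.\<close>

definition last_coords :: "nat \<Rightarrow> (real ^ 'n::{finite,linorder}) set" where
  "last_coords p = {t. \<forall>k<p. t $ coord k = 0}"

text \<open>\<open>vertex p k t\<close> is \<open>(t\<^sub>1, \<dots>, t\<^sub>k, 0, \<dots>, 0, t\<^bsub>p+1\<^esub>, \<dots>, t\<^sub>n)\<close>.\<close>

definition vertex :: "nat \<Rightarrow> nat \<Rightarrow> real ^ 'n::_ \<Rightarrow> real ^ 'n::{finite,linorder}" where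
  "vertex p k t = (\<chi> j. if j \<in> coord ` {k..<p} then 0 else t $ j)"

definition accessible :: "nat \<Rightarrow> (real ^ 'n::{finite,linorder}) set \<Rightarrow> bool" where
  "accessible p \<Theta> \<longleftrightarrow> open \<Theta> \<and> 0 \<in> \<Theta> \<and>
     (\<forall>t\<in>\<Theta>. \<forall>k<p. closed_segment (vertex p k t) (vertex p (Suc k) t) \<subseteq> \<Theta>)"

text \<open>Embedded \<open>C\<^sup>1\<close> submanifold of \<open>\<real>\<^sup>n\<close> of codimension \<open>p\<close>: locally, in the subspace topology,
  \<open>C\<^sup>1\<close>-diffeomorphic to open subsets of \<open>\<real>\<^bsup>n-p\<^esup>\<close>.\<close>

definition C1_submanifold :: "nat \<Rightarrow> (real ^ 'n::{finite,linorder}) set \<Rightarrow> bool" where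
  "C1_submanifold p M \<longleftrightarrow>
     (\<forall>y\<in>M. \<exists>V U \<phi>. openin (top_of_set M) V \<and> y \<in> V \<and>
        openin (top_of_set (last_coords p :: (real ^ 'n::_) set)) U \<and> C1_diffeo U V \<phi>)"

definition tangent_space :: "'a::real_normed_vector set \<Rightarrow> 'a \<Rightarrow> 'a set" where
  "tangent_space M y =
     {v. \<exists>\<gamma> e. e > 0 \<and> C1_on {-e<..<e} \<gamma> \<and> \<gamma> ` {-e<..<e} \<subseteq> M \<and> \<gamma> (0::real) = y \<and>
        (\<gamma> has_vector_derivative v) (at 0)}"

definition transverse_at :: "'a::real_normed_vector set \<Rightarrow> 'a set \<Rightarrow> 'a \<Rightarrow> bool" where
  "transverse_at M S y \<longleftrightarrow> {v + w |v w. v \<in> tangent_space M y \<and> w \<in> S} = UNIV"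

definition chart_centered_at ::
    "nat \<Rightarrow> real ^ 'n::{finite,linorder} \<Rightarrow> (real ^ 'n::_) set \<Rightarrow> (real ^ 'n::_) set \<Rightarrow>
     (real ^ 'n::_ \<Rightarrow> real ^ 'n::_) \<Rightarrow> bool" where
  "chart_centered_at p xb M U \<xi> \<longleftrightarrow>
     openin (top_of_set (last_coords p)) U \<and> 0 \<in> U \<and> C1_diffeo U M \<xi> \<and> \<xi> 0 = xb"

section \<open>Stable configurations\<close>

text \<open>\<open>flow_chain \<Omega> r J t x k\<close> is \<open>W\<^bsub>i\<^sub>k\<^esub> \<dots> W\<^bsub>i\<^sub>1\<^esub> x\<close>, where \<open>i\<^sub>1 < i\<^sub>2 < \<dots>\<close> are the elements of \<open>J\<close>
  and \<open>t\<^sub>1, \<dots>, t\<^sub>k\<close> are the flow times.\<close>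

primrec flow_chain ::
    "(real ^ 'n::_) set \<Rightarrow> ('n \<Rightarrow> real ^ 'n::_ \<Rightarrow> real ^ 'n::_) \<Rightarrow> 'n set \<Rightarrow> real ^ 'n::_ \<Rightarrow> real ^ 'n::_ \<Rightarrow> nat \<Rightarrow>
     real ^ 'n::{finite,linorder}" where
  "flow_chain \<Omega> r J t x 0 = x"
| "flow_chain \<Omega> r J t x (Suc k) =
     flow \<Omega> (r (sorted_list_of_set J ! k)) (t $ coord k) (flow_chain \<Omega> r J t x k)"

definition psi ::
    "(real ^ 'n::_) set \<Rightarrow> ('n \<Rightarrow> real ^ 'n::_ \<Rightarrow> real ^ 'n::_) \<Rightarrow> 'n set \<Rightarrow> (real ^ 'n::_ \<Rightarrow> real ^ 'n::_) \<Rightarrow>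
     real ^ 'n::_ \<Rightarrow> real ^ 'n::{finite,linorder}" where
  "psi \<Omega> r J \<xi> t = flow_chain \<Omega> r J t (\<xi> (vertex (card J) 0 t)) (card J)"

definition psi_defined ::
    "(real ^ 'n::_) set \<Rightarrow> ('n \<Rightarrow> real ^ 'n::_ \<Rightarrow> real ^ 'n::_) \<Rightarrow> 'n set \<Rightarrow> (real ^ 'n::_) set \<Rightarrow>
     (real ^ 'n::_ \<Rightarrow> real ^ 'n::_) \<Rightarrow> real ^ 'n::{finite,linorder} \<Rightarrow> bool" where
  "psi_defined \<Omega> r J U \<xi> t \<longleftrightarrow>
     vertex (card J) 0 t \<in> U \<and>
     (\<forall>k<card J. \<exists>y. flows_to \<Omega> (r (sorted_list_of_set J ! k)) (t $ coord k)
        (flow_chain \<Omega> r J t (\<xi> (vertex (card J) 0 t)) k) y)"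

definition psi_domain ::
    "(real ^ 'n::_) set \<Rightarrow> ('n \<Rightarrow> real ^ 'n::_ \<Rightarrow> real ^ 'n::_) \<Rightarrow> 'n set \<Rightarrow> (real ^ 'n::_) set \<Rightarrow>
     (real ^ 'n::_ \<Rightarrow> real ^ 'n::_) \<Rightarrow> (real ^ 'n::{finite,linorder}) set \<Rightarrow> bool" where
  "psi_domain \<Omega> r J U \<xi> \<Theta> \<longleftrightarrow>
     open \<Theta> \<and> 0 \<in> \<Theta> \<and> (\<forall>t\<in>\<Theta>. psi_defined \<Omega> r J U \<xi> t) \<and>
     open (psi \<Omega> r J \<xi> ` \<Theta>) \<and> C1_diffeo \<Theta> (psi \<Omega> r J \<xi> ` \<Theta>) (psi \<Omega> r J \<xi>)"

text \<open>Balls are taken in the max norm \<open>infnorm\<close>.\<close>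

definition stable_configuration ::
    "(real ^ 'n::{finite,linorder}) set \<Rightarrow> ('n \<Rightarrow> real ^ 'n::_ \<Rightarrow> real ^ 'n::_) \<Rightarrow> ('m \<Rightarrow> 'n set) \<Rightarrow>
     ('m \<Rightarrow> real ^ 'n::_ \<Rightarrow> real ^ 'n::_) \<Rightarrow> ('m \<Rightarrow> (real ^ 'n::_) set) \<Rightarrow> real ^ 'n::_ \<Rightarrow> bool" where
  "stable_configuration \<Omega> r I \<xi> \<Theta> xb \<longleftrightarrow>
     (\<forall>e>0. \<exists>\<Omega>e. open \<Omega>e \<and> xb \<in> \<Omega>e \<and> \<Omega>e \<subseteq> {x. infnorm (x - xb) < e} \<and>
        (\<forall>\<alpha>. \<exists>\<Theta>e. accessible (card (I \<alpha>)) \<Theta>e \<and> \<Theta>e \<subseteq> \<Theta> \<alpha> \<and>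
           C1_diffeo \<Theta>e \<Omega>e (psi \<Omega> r (I \<alpha>) (\<xi> \<alpha>))))"

section \<open>The initial value problem\<close>

definition is_solution ::
    "(real ^ 'm::finite) set \<Rightarrow> ('n::finite \<Rightarrow> real ^ 'n \<Rightarrow> real ^ 'n) \<Rightarrow> ('m \<Rightarrow> 'n set) \<Rightarrow>
     ('m \<Rightarrow> 'n \<Rightarrow> real ^ 'n \<Rightarrow> real ^ 'm \<Rightarrow> real) \<Rightarrow> ('m \<Rightarrow> (real ^ 'n) set) \<Rightarrow>
     ('m \<Rightarrow> real ^ 'n \<Rightarrow> real) \<Rightarrow> (real ^ 'n) set \<Rightarrow> (real ^ 'n \<Rightarrow> real ^ 'm) \<Rightarrow> bool" where
  "is_solution \<Upsilon> r I f \<Xi> g N u \<longleftrightarrow>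
     C1_on N u \<and> u ` N \<subseteq> \<Upsilon> \<and>
     (\<forall>\<alpha>. \<forall>i\<in>I \<alpha>. \<forall>x\<in>N. grad (\<lambda>y. u y $ \<alpha>) x \<bullet> r i x = f \<alpha> i x (u x)) \<and>
     (\<forall>\<alpha>. \<forall>x\<in>\<Xi> \<alpha> \<inter> N. u x $ \<alpha> = g \<alpha> x)"

end

theory Submission
  imports Defs
begin

text \<open>
  In the coordinates \<open>t = \<psi>\<^sub>\<alpha>\<^sup>-\<^sup>1(x)\<close> the equations for \<open>u\<^sub>\<alpha>\<close> are integrated along the broken path from
  \<open>\<Xi>\<^sub>\<alpha>\<close> to \<open>x\<close>, which stays in \<open>\<Omega>\<^sub>\<epsilon>\<close> by accessibility and has length \<open>O(\<delta>)\<close>. The resulting Picard map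
  is a contraction for small \<open>\<delta>\<close>; this gives uniqueness at once. The derivatives of the Picard iterates
  satisfy a recursion that is a contraction up to a perturbation tending to 0, so they converge
  uniformly as well and the fixed point \<open>u\<close> is \<open>C\<^sup>1\<close>.

  A priori the equation for \<open>r\<^sub>i\<close> holds only along the legs in direction \<open>r\<^sub>i\<close>. Let
  \<open>D\<^sub>i\<^sup>\<alpha> = r\<^sub>i(u\<^sub>\<alpha>) - f\<^sub>i\<^sup>\<alpha>\<close>. By involutivity \<open>\<partial>\<psi>\<^sub>\<alpha>/\<partial>t\<^sub>l = \<Sum>\<^sub>i\<^sub>\<in>\<^sub>I a\<^sub>l\<^sup>i r\<^sub>i\<close>, and by the integrability conditions the
  quantity \<open>E\<^sub>l = \<Sum>\<^sub>i a\<^sub>l\<^sup>i D\<^sub>i\<^sup>\<alpha>\<close>, which vanishes at the start of the legs after the \<open>l\<close>-th, has along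
  these legs a derivative that is linear in the defects \<open>D\<close>. Hence \<open>E = O(\<delta> sup \<bar>D\<bar>)\<close>; as \<open>a\<close> is close to the
  identity, \<open>sup \<bar>D\<bar> \<le> 3/4 sup \<bar>D\<bar>\<close>, and all defects vanish.
\<close>

section \<open>Broken coordinate paths\<close>

text \<open>The obstacle is regularity. The fixed point \<open>u\<close> and the parametrizations
  are only C^1, so the defects are merely continuous and cannot be differentiated along a leg. What
  can be differentiated along leg \<open>k\<close> is the partial derivative in an earlier time
  \<open>t_l\<close> of a function that satisfies an integral equation on that leg: the leg
  parameter then sits only in the upper limit of an integral with continuous integrand. This covers
  \<open>u_\<alpha>\<close> in the coordinates \<open>t\<close> as well as the parametrization
  itself, and \<open>E_l\<close> is put together from these two and from the C^1 functions
  \<open>f(x, u(x))\<close>. Likewise the derivatives of \<open>f\<close> have only a modulus of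
  continuity; this is the origin of the perturbation in the recursion for the derivatives. Stability
  is what makes the coupled system accessible: the integrand for one component involves all
  components of \<open>u\<close>, so the broken paths of all \<alpha> have to stay in one common
  domain. The constants are fixed in this order: the radius \<rho> of the balls on which
  \<open>f\<close> is estimated, the bound \<delta> on the flow times, and last the radius of the
  neighbourhood, small enough that all flow times in it are below \<delta>.\<close>

lemma inj_on_coord: "inj_on (coord :: nat \<Rightarrow> 'n::{finite,linorder}) {..<CARD('n)}"
  unfolding coord_def by (rule inj_on_nth) auto

lemma coord_eq_iff:
  assumes "j < CARD('n)" "k < CARD('n)"
  shows "(coord j :: 'n::{finite,linorder}) = coord k \<longleftrightarrow> j = k"
  using inj_on_coord assms by (auto simp: inj_on_def)

lemma coord_in_image_iff:
  assumes "j < CARD('n)" "p \<le> CARD('n)"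
  shows "(coord j :: 'n::{finite,linorder}) \<in> coord ` {k..<p} \<longleftrightarrow> k \<le> j \<and> j < p"
  using assms by (auto simp: coord_eq_iff)

lemma linear_vertex: "linear (vertex p k :: (real^'n::_) \<Rightarrow> (real^'n::{finite,linorder}))"
  by (rule linearI) (auto simp: vertex_def vec_eq_iff)

text \<open>As \<tau> runs from 0 to 1 the point runs through leg \<open>k\<close>, from vertex
  \<open>k\<close> to vertex \<open>k + 1\<close>. For fixed \<tau> it is linear in
  \<open>t\<close>.\<close>

definition path_pt :: "nat \<Rightarrow> nat \<Rightarrow> real \<Rightarrow> (real^'n::_) \<Rightarrow> (real^'n::{finite,linorder})" where
  "path_pt p k \<tau> t = (1 - \<tau>) *\<^sub>R vertex p k t + \<tau> *\<^sub>R vertex p (Suc k) t"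

lemma vertex_nth [simp]: "vertex p k t $ j = (if j \<in> coord ` {k..<p} then 0 else t $ j)"
  by (simp add: vertex_def)

lemma path_pt_0 [simp]: "path_pt p k 0 t = vertex p k t"
  and path_pt_1 [simp]: "path_pt p k 1 t = vertex p (Suc k) t"
  by (simp_all add: path_pt_def)

lemma vertex_last [simp]: "vertex p p t = t"
  by (simp add: vec_eq_iff)

lemma vertex_zero [simp]: "vertex p k 0 = 0"
  by (simp add: vec_eq_iff)

context
  fixes p k :: nat
  assumes kp: "k < p" "p \<le> CARD('n::{finite,linorder})"
begin

lemma coord_notin: "(coord k :: 'n) \<notin> coord ` {Suc k..<p}"
  using kp by (subst coord_in_image_iff) auto

lemma coord_image_Suc: "(coord ` {k..<p} :: 'n set) = insert (coord k) (coord ` {Suc k..<p})"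
proof -
  have "{k..<p} = insert k {Suc k..<p}" using kp by auto
  then show ?thesis by simp
qed

lemma path_pt_nth:
  "(path_pt p k \<tau> t :: (real^'n::_)) $ j =
    (if j = coord k then \<tau> * t $ j else if j \<in> coord ` {Suc k..<p} then 0 else t $ j)"
  using coord_notin by (auto simp: path_pt_def coord_image_Suc algebra_simps)

lemma path_pt_coord [simp]: "(path_pt p k \<tau> t :: (real^'n::_)) $ coord k = \<tau> * t $ coord k"
  by (simp add: path_pt_nth)

lemma vertex_path_pt [simp]:
  "vertex p (Suc k) (path_pt p k \<tau> t) = (path_pt p k \<tau> t :: (real^'n::_))"
  "vertex p k (path_pt p k \<tau> t) = (vertex p k t :: (real^'n::_))"
  using coord_notin by (auto simp: vec_eq_iff path_pt_nth coord_image_Suc)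

text \<open>The leg that belongs to an intermediate point of leg \<open>k\<close> is an initial
  piece of the same leg. An identity for complete legs can therefore be read off at every
  intermediate point.\<close>

lemma path_pt_path_pt [simp]:
  "path_pt p k \<tau> (path_pt p k \<sigma> t) = (path_pt p k (\<tau> * \<sigma>) t :: (real^'n::_))"
  by (auto simp: vec_eq_iff path_pt_nth)

lemma vertex_axis_same [simp]: "vertex p k (axis (coord k) 1) = (0 :: (real^'n::_))"
  "vertex p (Suc k) (axis (coord k) 1) = (axis (coord k) 1 :: (real^'n::_))"
  using kp by (auto simp: vec_eq_iff axis_def coord_image_Suc coord_in_image_iff)

lemma vertex_axis_less [simp]:
  "l < j \<Longrightarrow> j \<le> p \<Longrightarrow> l < p \<Longrightarrow> vertex p j (axis (coord l) 1) = (axis (coord l) 1 :: (real^'n::_))"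
  using kp by (auto simp: vec_eq_iff axis_def coord_in_image_iff)

lemma path_pt_axis_less [simp]:
  "l < k \<Longrightarrow> path_pt p k \<tau> (axis (coord l) 1) = (axis (coord l) 1 :: (real^'n::_))"
  using kp vertex_axis_less[of l k] vertex_axis_less[of l "Suc k"]
  by (simp add: path_pt_def algebra_simps flip: scaleR_left.add)

lemma path_pt_axis_same [simp]: "path_pt p k \<tau> (axis (coord k) 1) = (\<tau> *\<^sub>R axis (coord k) 1 :: (real^'n::_))"
  by (simp add: path_pt_def)

lemma path_pt_eq: "path_pt p k \<tau> t = vertex p k t + \<tau> *\<^sub>R (t $ coord k) *\<^sub>R (axis (coord k) 1 :: (real^'n::_))"
  by (auto simp: vec_eq_iff path_pt_nth axis_def coord_image_Suc coord_notin)

lemma norm_path_pt_le: "\<tau> \<in> {0..1} \<Longrightarrow> norm (path_pt p k \<tau> t :: (real^'n::_)) \<le> norm t"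
  by (rule norm_le_componentwise_cart)
    (auto simp: path_pt_nth abs_mult intro!: mult_left_le_one_le)

end

text \<open>\<open>path_pt\<close> as an operator on \<open>t\<close>, written as a combination of
  two fixed operators so that continuity in \<tau> holds in the operator norm.\<close>

definition path_blinfun :: "nat \<Rightarrow> nat \<Rightarrow> real \<Rightarrow> (real^'n::_) \<Rightarrow>\<^sub>L (real^'n::{finite,linorder})" where
  "path_blinfun p k \<tau> = (1 - \<tau>) *\<^sub>R Blinfun (vertex p k) + \<tau> *\<^sub>R Blinfun (vertex p (Suc k))"

lemma Blinfun_vertex [simp]: "blinfun_apply (Blinfun (vertex p k)) = vertex p k"
  by (intro bounded_linear_Blinfun_apply linear_conv_bounded_linear[THEN iffD1] linear_vertex)

lemma path_blinfun_apply [simp]: "blinfun_apply (path_blinfun p k \<tau>) = path_pt p k \<tau>"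
  by (auto simp: path_blinfun_def path_pt_def blinfun.add_left blinfun.scaleR_left)

lemma norm_path_blinfun_le:
  "k < p \<Longrightarrow> p \<le> CARD('n) \<Longrightarrow> \<tau> \<in> {0..1} \<Longrightarrow> norm (path_blinfun p k \<tau> :: (real^'n::_) \<Rightarrow>\<^sub>L (real^'n::{finite,linorder})) \<le> 1"
  by (rule norm_blinfun_bound) (auto simp: norm_path_pt_le)

lemma continuous_on_path_blinfun [continuous_intros]:
  "continuous_on S g \<Longrightarrow> continuous_on S (\<lambda>x. path_blinfun p k (g x))"
  unfolding path_blinfun_def by (intro continuous_intros)

lemma continuous_on_path_pt [continuous_intros]:
  "continuous_on S g \<Longrightarrow> continuous_on S h \<Longrightarrow> continuous_on S (\<lambda>x. path_pt p k (g x) (h x))"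
  unfolding path_blinfun_apply[symmetric] by (intro continuous_intros)

lemma path_pt_deriv [derivative_intros]:
  "(path_pt p k \<tau> has_derivative path_pt p k \<tau>) (at t within S)"
  unfolding path_blinfun_apply[symmetric] by (intro bounded_linear_imp_has_derivative blinfun.bounded_linear_right)

lemma vertex_deriv [derivative_intros]: "(vertex p k has_derivative vertex p k) (at t within S)"
  by (intro bounded_linear_imp_has_derivative linear_conv_bounded_linear[THEN iffD1] linear_vertex)

lemma path_pt_vector_deriv:
  fixes t :: "(real^'n::{finite,linorder})"
  assumes "k < p" "p \<le> CARD('n)"
  shows "((\<lambda>\<tau>. path_pt p k \<tau> t) has_vector_derivative (t $ coord k) *\<^sub>R axis (coord k) 1) (at \<tau> within S)"
  unfolding path_pt_eq[OF assms] has_vector_derivative_def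
  by (rule derivative_eq_intros refl | simp)+

text \<open>With the factor \<sigma> outside, the substitution also holds for \<sigma> = 0, and on
  the right \<sigma> is only the upper limit, where the fundamental theorem of calculus
  applies.\<close>

lemma integral_rescale:
  fixes \<phi> :: "real \<Rightarrow> 'b::banach"
  assumes "continuous_on {0..1} \<phi>" "\<sigma> \<in> {0..1}"
  shows "\<sigma> *\<^sub>R integral {0..1} (\<lambda>\<tau>. \<phi> (\<tau> * \<sigma>)) = integral {0..\<sigma>} \<phi>"
proof (cases "\<sigma> = 0")
  case False
  with assms(2) have s: "\<sigma> > 0" "\<sigma> \<le> 1" by auto
  have "(\<phi> has_integral integral {0..\<sigma>} \<phi>) {0..\<sigma>}"
    using assms(1) s by (intro integrable_integral integrable_continuous_real)
      (auto intro: continuous_on_subset)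
  from has_integral_affinity[OF this[folded cbox_interval], of \<sigma> 0] s
  have "((\<lambda>x. \<phi> (\<sigma> * x)) has_integral (1 / \<sigma>) *\<^sub>R integral {0..\<sigma>} \<phi>) ((\<lambda>x. x / \<sigma>) ` {0..\<sigma>})"
    by (simp add: divide_inverse mult.commute)
  moreover have "(\<lambda>x. x / \<sigma>) ` {0..\<sigma>} = {0..1}"
    using s by (auto simp: image_iff field_simps intro!: bexI[of _ "\<sigma> * _"])
  ultimately show ?thesis
    using s by (simp add: integral_unique mult.commute)
qed auto

text \<open>\<open>P\<close> stands for psi, \<open>Q\<close> for its inverse and \<open>X k\<close>
  for the field followed on leg \<open>k\<close>. \<open>P'_axis\<close> records the order of the
  flows: where the times after the \<open>k\<close>-th vanish, the \<open>k\<close>-th flow is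
  applied last and \<open>P\<close> moves along \<open>X k\<close>. At other points this partial
  derivative need not be a frame field.\<close>

locale broken_path =
  fixes p :: nat
    and X :: "nat \<Rightarrow> (real^'n::_) \<Rightarrow> (real^'n::{finite,linorder})"

    and \<Theta> N :: "((real^'n::_)) set"
    and P Q :: "(real^'n::_) \<Rightarrow> (real^'n::_)"
    and P' Q' :: "(real^'n::_) \<Rightarrow> (real^'n::_) \<Rightarrow>\<^sub>L (real^'n::_)"
  assumes p_le: "p \<le> CARD('n)"
    and acc: "accessible p \<Theta>"
    and open_N: "open N"
    and P_in: "t \<in> \<Theta> \<Longrightarrow> P t \<in> N"
    and Q_in: "x \<in> N \<Longrightarrow> Q x \<in> \<Theta>"
    and QP: "t \<in> \<Theta> \<Longrightarrow> Q (P t) = t"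
    and PQ: "x \<in> N \<Longrightarrow> P (Q x) = x"
    and P_deriv: "t \<in> \<Theta> \<Longrightarrow> (P has_derivative P' t) (at t)"
    and P'_cont: "continuous_on \<Theta> P'"
    and Q_deriv: "x \<in> N \<Longrightarrow> (Q has_derivative Q' x) (at x)"
    and Q'_cont: "continuous_on N Q'"

    and P'_axis: "k < p \<Longrightarrow> t \<in> \<Theta> \<Longrightarrow>
      P' (vertex p (Suc k) t) (axis (coord k) 1) = X k (P (vertex p (Suc k) t))"
begin

section \<open>Integrals along the legs and their derivatives\<close>

lemma open_\<Theta>: "open \<Theta>"
  using acc by (simp add: accessible_def)

lemma path_in: "t \<in> \<Theta> \<Longrightarrow> k < p \<Longrightarrow> \<tau> \<in> {0..1} \<Longrightarrow> path_pt p k \<tau> t \<in> \<Theta>"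
  using acc unfolding accessible_def path_pt_def closed_segment_def by force

lemma vertex_in: "t \<in> \<Theta> \<Longrightarrow> k \<le> p \<Longrightarrow> vertex p k t \<in> \<Theta>"
  using path_in[of t k 0] by (cases "k = p") auto

lemma P_cont: "continuous_on \<Theta> P"
  using P_deriv by (meson continuous_at_imp_continuous_on has_derivative_continuous)

lemma Q_cont: "continuous_on N Q"
  using Q_deriv by (meson continuous_at_imp_continuous_on has_derivative_continuous)

text \<open>Integrating over the fixed interval \<open>[0, 1]\<close> keeps the path linear in \<open>t\<close> and needs no case
  distinction on the sign of \<open>t\<^bsub>k+1\<^esub>\<close>.\<close>

definition step :: "nat \<Rightarrow> ((real^'n::_) \<Rightarrow> 'b::banach) \<Rightarrow> (real^'n::_) \<Rightarrow> 'b" where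
  "step k h t = t $ coord k *\<^sub>R integral {0..1} (\<lambda>\<tau>. h (P (path_pt p k \<tau> t)))"

text \<open>The derivative of \<open>step\<close>: the first summand comes from the factor
  \<open>t $ coord k\<close>, the second from differentiation under the integral sign.\<close>

definition step' :: "nat \<Rightarrow> ((real^'n::_) \<Rightarrow> 'b::banach) \<Rightarrow> ((real^'n::_) \<Rightarrow> (real^'n::_) \<Rightarrow>\<^sub>L 'b) \<Rightarrow> (real^'n::_) \<Rightarrow> (real^'n::_) \<Rightarrow>\<^sub>L 'b" where
  "step' k h h' t =
    (blinfun_scaleR_left (integral {0..1} (\<lambda>\<tau>. h (P (path_pt p k \<tau> t)))) o\<^sub>L blinfun_inner_left (axis (coord k) 1))
    + t $ coord k *\<^sub>R integral {0..1}
        (\<lambda>\<tau>. h' (P (path_pt p k \<tau> t)) o\<^sub>L (P' (path_pt p k \<tau> t) o\<^sub>L path_blinfun p k \<tau>))"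

context
  fixes k :: nat
  assumes k: "k < p"
begin

lemma cont_h:
  fixes h :: "(real^'n::_) \<Rightarrow> 'b::real_normed_vector"
  assumes "continuous_on N h"
  shows "continuous_on (\<Theta> \<times> {0..1}) (\<lambda>(t, \<tau>). h (P (path_pt p k \<tau> t)))"
    and "t \<in> \<Theta> \<Longrightarrow> continuous_on {0..1} (\<lambda>\<tau>. h (P (path_pt p k \<tau> t)))"
proof -
  show *: "continuous_on (\<Theta> \<times> {0..1}) (\<lambda>(t, \<tau>). h (P (path_pt p k \<tau> t)))"
    unfolding split_beta
    by (intro continuous_on_compose2[OF assms] continuous_on_compose2[OF P_cont] continuous_intros)
      (use k in \<open>auto simp: path_in P_in\<close>)
  show "continuous_on {0..1} (\<lambda>\<tau>. h (P (path_pt p k \<tau> t)))" if "t \<in> \<Theta>"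
    using continuous_on_compose2[OF * continuous_on_Pair[OF continuous_on_const[of _ t] continuous_on_id]] that
    by auto
qed

lemma cont_h':
  fixes h' :: "(real^'n::_) \<Rightarrow> (real^'n::_) \<Rightarrow>\<^sub>L 'b::real_normed_vector"
  assumes "continuous_on N h'"
  shows "continuous_on (\<Theta> \<times> {0..1})
      (\<lambda>(t, \<tau>). h' (P (path_pt p k \<tau> t)) o\<^sub>L (P' (path_pt p k \<tau> t) o\<^sub>L path_blinfun p k \<tau>))"
    and "t \<in> \<Theta> \<Longrightarrow> continuous_on {0..1}
      (\<lambda>\<tau>. h' (P (path_pt p k \<tau> t)) o\<^sub>L (P' (path_pt p k \<tau> t) o\<^sub>L path_blinfun p k \<tau>))"
proof -
  show *: "continuous_on (\<Theta> \<times> {0..1})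
      (\<lambda>(t, \<tau>). h' (P (path_pt p k \<tau> t)) o\<^sub>L (P' (path_pt p k \<tau> t) o\<^sub>L path_blinfun p k \<tau>))"
    unfolding split_beta
    by (intro continuous_intros continuous_on_compose2[OF assms] continuous_on_compose2[OF P_cont]
        continuous_on_compose2[OF P'_cont])
      (use k in \<open>auto simp: path_in P_in\<close>)
  show "continuous_on {0..1}
      (\<lambda>\<tau>. h' (P (path_pt p k \<tau> t)) o\<^sub>L (P' (path_pt p k \<tau> t) o\<^sub>L path_blinfun p k \<tau>))" if "t \<in> \<Theta>"
    using continuous_on_compose2[OF * continuous_on_Pair[OF continuous_on_const[of _ t] continuous_on_id]] that
    by auto
qed

lemma norm_step_le:
  assumes "continuous_on N h" "t \<in> \<Theta>" "\<And>x. x \<in> N \<Longrightarrow> norm (h x) \<le> B" "\<bar>t $ coord k\<bar> \<le> \<delta>" "0 \<le> B"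
  shows "norm (step k h t) \<le> \<delta> * B"
proof -
  have "norm (integral {0..1} (\<lambda>\<tau>. h (P (path_pt p k \<tau> t)))) \<le> B * (1 - 0)"
    using assms k by (intro integral_bound cont_h) (auto simp: path_in P_in)
  then show ?thesis
    using assms by (auto simp: step_def intro!: mult_mono)
qed

lemma step_diff:
  assumes "continuous_on N h1" "continuous_on N h2" "t \<in> \<Theta>"
  shows "step k h1 t - step k h2 t = step k (\<lambda>x. h1 x - h2 x) t"
  using assms by (simp add: step_def Henstock_Kurzweil_Integration.integral_diff
      cont_h integrable_continuous_real scaleR_diff_right)

lemma step'_diff:
  assumes "continuous_on N h1" "continuous_on N h2" "continuous_on N h1'" "continuous_on N h2'" "t \<in> \<Theta>"
  shows "step' k h1 h1' t - step' k h2 h2' t = step' k (\<lambda>x. h1 x - h2 x) (\<lambda>x. h1' x - h2' x) t"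
  using assms by (simp add: step'_def Henstock_Kurzweil_Integration.integral_diff
      cont_h cont_h' integrable_continuous_real
      bounded_bilinear.diff_left[OF bounded_bilinear_blinfun_compose]
      linear_diff[OF bounded_linear.linear[OF bounded_linear_blinfun_scaleR_left]]
      scaleR_diff_right)

text \<open>Only the second summand of \<open>step'\<close> carries the factor
  \<open>t $ coord k\<close>, so \<delta> multiplies the bound on \<open>h'\<close> but not the one
  on \<open>h\<close>. In the Picard iteration the recursion therefore contracts in the derivatives,
  while differences of the values enter as a perturbation.\<close>

lemma norm_step'_le:
  assumes "continuous_on N h" "continuous_on N h'" "t \<in> \<Theta>"
    and "\<And>x. x \<in> N \<Longrightarrow> norm (h x) \<le> B" "\<And>x. x \<in> N \<Longrightarrow> norm (h' x) \<le> B'" "\<And>s. s \<in> \<Theta> \<Longrightarrow> norm (P' s) \<le> C"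
    and "\<bar>t $ coord k\<bar> \<le> \<delta>" "0 \<le> B'" "0 \<le> C"
  shows "norm (step' k h h' t) \<le> B + \<delta> * (B' * C)"
proof -
  have "norm (integral {0..1} (\<lambda>\<tau>. h (P (path_pt p k \<tau> t)))) \<le> B * (1 - 0)"
    using assms k by (intro integral_bound cont_h) (auto simp: path_in P_in)
  note B = this
  have 1: "norm (blinfun_scaleR_left (integral {0..1} (\<lambda>\<tau>. h (P (path_pt p k \<tau> t))))
      o\<^sub>L blinfun_inner_left (axis (coord k) 1 :: (real^'n::_))) \<le> B"
  proof (rule norm_blinfun_bound)
    fix v :: "(real^'n::_)"

    have "\<bar>v $ coord k\<bar> * norm (integral {0..1} (\<lambda>\<tau>. h (P (path_pt p k \<tau> t)))) \<le> norm v * B"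
      using B component_le_norm_cart[of v] by (intro mult_mono) auto
    then show "norm ((blinfun_scaleR_left (integral {0..1} (\<lambda>\<tau>. h (P (path_pt p k \<tau> t))))
      o\<^sub>L blinfun_inner_left (axis (coord k) 1)) v) \<le> B * norm v"
      by (simp add: inner_axis mult.commute)
  qed (use B in \<open>simp, meson norm_ge_zero order_trans\<close>)
  have "norm (integral {0..1} (\<lambda>\<tau>. h' (P (path_pt p k \<tau> t)) o\<^sub>L (P' (path_pt p k \<tau> t) o\<^sub>L path_blinfun p k \<tau>)))
    \<le> (B' * (C * 1)) * (1 - 0)"
  proof (intro integral_bound cont_h')
    fix \<tau> :: real assume "\<tau> \<in> {0..1}"
    then show "norm (h' (P (path_pt p k \<tau> t)) o\<^sub>L (P' (path_pt p k \<tau> t) o\<^sub>L path_blinfun p k \<tau>)) \<le> B' * (C * 1)"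
      using assms k p_le
      by (intro order_trans[OF norm_blinfun_compose] mult_mono norm_path_blinfun_le)
        (auto simp: path_in P_in)
  qed (use assms in auto)
  then have "norm (t $ coord k *\<^sub>R integral {0..1}
        (\<lambda>\<tau>. h' (P (path_pt p k \<tau> t)) o\<^sub>L (P' (path_pt p k \<tau> t) o\<^sub>L path_blinfun p k \<tau>))) \<le> \<delta> * (B' * C)"
    using assms by (auto intro!: mult_mono)
  with 1 show ?thesis
    unfolding step'_def by (rule norm_triangle_mono)
qed

lemma step_deriv:
  fixes h :: "(real^'n::_) \<Rightarrow> 'b::banach" and h' :: "(real^'n::_) \<Rightarrow> (real^'n::_) \<Rightarrow>\<^sub>L 'b"
  assumes h: "\<And>x. x \<in> N \<Longrightarrow> (h has_derivative h' x) (at x)" and h': "continuous_on N h'" and t: "t \<in> \<Theta>"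
  shows "(step k h has_derivative step' k h h' t) (at t)"
proof -
  have hc: "continuous_on N h"
    using h by (meson continuous_at_imp_continuous_on has_derivative_continuous)
  obtain e where e: "e > 0" "ball t e \<subseteq> \<Theta>"
    using open_\<Theta> t open_contains_ball by blast
  let ?D = "\<lambda>s \<tau>. h' (P (path_pt p k \<tau> s)) o\<^sub>L (P' (path_pt p k \<tau> s) o\<^sub>L path_blinfun p k \<tau>)"
  \<comment> \<open>The Leibniz rule asks for a convex parameter set, hence the ball inside
    \<Theta>.\<close>
  have "((\<lambda>s. integral (cbox 0 1) (\<lambda>\<tau>. h (P (path_pt p k \<tau> s)))) has_derivative
      integral (cbox 0 1) (?D t)) (at t within ball t e)"
  proof (rule leibniz_rule)
    fix s and \<tau> :: real assume s: "s \<in> ball t e" "\<tau> \<in> cbox 0 1"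
    then have in': "path_pt p k \<tau> s \<in> \<Theta>" using e k by (auto intro!: path_in)
    have "((\<lambda>s. h (P (path_pt p k \<tau> s))) has_derivative
      (\<lambda>v. h' (P (path_pt p k \<tau> s)) (P' (path_pt p k \<tau> s) (path_pt p k \<tau> v)))) (at s)"
      by (rule has_derivative_compose[OF has_derivative_compose[OF path_pt_deriv P_deriv[OF in']] h[OF P_in[OF in']]])
    then show "((\<lambda>s. h (P (path_pt p k \<tau> s))) has_derivative ?D s \<tau>) (at s within ball t e)"
      by (rule has_derivative_at_withinI[THEN has_derivative_eq_rhs]) auto
  next
    show "(\<lambda>\<tau>. h (P (path_pt p k \<tau> s))) integrable_on cbox 0 1" if "s \<in> ball t e" for s
      using cont_h(2)[OF hc, of s] that e by (auto intro!: integrable_continuous_real)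
    show "continuous_on (ball t e \<times> cbox 0 1) (\<lambda>(s, \<tau>). ?D s \<tau>)"
      using cont_h'(1)[OF h'] e by (auto intro: continuous_on_subset)
  qed (use e in auto)
  then have D: "((\<lambda>s. integral {0..1} (\<lambda>\<tau>. h (P (path_pt p k \<tau> s)))) has_derivative
      integral {0..1} (?D t)) (at t)"
    using e by (simp add: at_within_open[of t "ball t e"])
  show ?thesis
    unfolding step_def step'_def
    by (rule has_derivative_eq_rhs[OF has_derivative_scaleR[OF _ D]])
      (auto intro!: derivative_eq_intros bounded_linear_imp_has_derivative bounded_linear_vec_nth
        simp: fun_eq_iff blinfun.add_left blinfun.scaleR_left inner_axis algebra_simps)
qed

lemma step'_cont:
  fixes h :: "(real^'n::_) \<Rightarrow> 'b::banach"
  assumes "continuous_on N h" "continuous_on N h'"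
  shows "continuous_on \<Theta> (step' k h h')"
  unfolding step'_def
  using integral_continuous_on_param[OF cont_h(1)[OF assms(1), folded cbox_interval]]
    integral_continuous_on_param[OF cont_h'(1)[OF assms(2), folded cbox_interval]]
  by (auto intro!: continuous_intros bounded_linear.continuous_on[OF bounded_linear_blinfun_scaleR_left])

lemma step_cont:
  fixes h :: "(real^'n::_) \<Rightarrow> 'b::banach"
  assumes "continuous_on N h"
  shows "continuous_on \<Theta> (step k h)"
  unfolding step_def
  using integral_continuous_on_param[OF cont_h(1)[OF assms(1), folded cbox_interval]]
  by (auto intro!: continuous_intros)

text \<open>An intermediate point of leg \<open>k\<close> is its own vertex \<open>k + 1\<close>, so
  \<open>P'_axis\<close> applies along the whole leg. The speed is \<open>t $ coord k\<close>,
  whatever its sign.\<close>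

lemma path_velocity:
  assumes t: "t \<in> \<Theta>" and \<tau>: "\<tau> \<in> {0..1}" and h: "(h has_derivative blinfun_apply h') (at (P (path_pt p k \<tau> t)))"
  shows "((\<lambda>\<tau>. h (P (path_pt p k \<tau> t))) has_vector_derivative
     t $ coord k *\<^sub>R h' (X k (P (path_pt p k \<tau> t)))) (at \<tau> within S)"
proof -
  let ?s = "path_pt p k \<tau> t"
  have s: "?s \<in> \<Theta>" using path_in t k \<tau> by auto
  have 1: "((\<lambda>\<tau>. path_pt p k \<tau> t) has_derivative (\<lambda>v. v *\<^sub>R t $ coord k *\<^sub>R axis (coord k) 1)) (at \<tau> within S)"
    using path_pt_vector_deriv[OF k p_le] by (simp add: has_vector_derivative_def)
  have "P' ?s (axis (coord k) 1) = X k (P ?s)"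
    using P'_axis[OF k s] k p_le by simp
  with has_derivative_compose[OF has_derivative_compose[OF 1 P_deriv[OF s]] h]
  show ?thesis
    by (simp add: has_vector_derivative_def blinfun.scaleR_right)
qed

text \<open>Of the derivative of \<open>h\<close> only its value on \<open>X k\<close> matters.
  Applied to a component of a solution it gives the integral equation, applied to the identity the
  integral form of the flow.\<close>

lemma step_FTC:
  fixes h :: "(real^'n::_) \<Rightarrow> 'b::banach"
  assumes t: "t \<in> \<Theta>" and "\<And>\<tau>. \<tau> \<in> {0..1} \<Longrightarrow> (h has_derivative blinfun_apply (h' (P (path_pt p k \<tau> t)))) (at (P (path_pt p k \<tau> t)))"
    and "\<And>\<tau>. \<tau> \<in> {0..1} \<Longrightarrow> h' (P (path_pt p k \<tau> t)) (X k (P (path_pt p k \<tau> t))) = q (P (path_pt p k \<tau> t))"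
  shows "h (P (vertex p (Suc k) t)) = h (P (vertex p k t)) + step k q t"
proof -
  have "((\<lambda>\<tau>. t $ coord k *\<^sub>R q (P (path_pt p k \<tau> t))) has_integral
     h (P (path_pt p k 1 t)) - h (P (path_pt p k 0 t))) {0..1}"
    by (rule fundamental_theorem_of_calculus) (use path_velocity[OF t _ assms(2)] assms(3) in auto)
  then show ?thesis
    by (simp add: step_def has_integral_integrable_integral)
qed

text \<open>In direction \<open>coord k\<close> the two summands of \<open>step'\<close> combine to
  the integral of the derivative of \<tau> times \<open>h\<close> along the leg, which is the end
  value of \<open>h\<close>. Nothing is divided by \<open>t $ coord k\<close>, which may be
  0.\<close>

lemma step'_axis_same:
  fixes h :: "(real^'n::_) \<Rightarrow> 'b::banach" and h' :: "(real^'n::_) \<Rightarrow> (real^'n::_) \<Rightarrow>\<^sub>L 'b"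
  assumes h: "\<And>x. x \<in> N \<Longrightarrow> (h has_derivative h' x) (at x)" and h': "continuous_on N h'" and t: "t \<in> \<Theta>"
  shows "step' k h h' t (axis (coord k) 1) = h (P (vertex p (Suc k) t))"
proof -
  have hc: "continuous_on N h"
    using h by (meson continuous_at_imp_continuous_on has_derivative_continuous)
  let ?\<phi> = "\<lambda>\<tau>. h (P (path_pt p k \<tau> t))"
  let ?D = "\<lambda>\<tau>. h' (P (path_pt p k \<tau> t)) o\<^sub>L (P' (path_pt p k \<tau> t) o\<^sub>L path_blinfun p k \<tau>)"
  have "((\<lambda>\<tau>. ?\<phi> \<tau> + \<tau> *\<^sub>R t $ coord k *\<^sub>R h' (P (path_pt p k \<tau> t)) (X k (P (path_pt p k \<tau> t)))) has_integral
     1 *\<^sub>R ?\<phi> 1 - 0 *\<^sub>R ?\<phi> 0) {0..1}"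
  proof (rule fundamental_theorem_of_calculus)
    fix \<tau> :: real assume \<tau>: "\<tau> \<in> {0..1}"
    then have "P (path_pt p k \<tau> t) \<in> N" using path_in t k P_in by auto
    from path_velocity[OF t \<tau> h[OF this], of "{0..1}"]
    show "((\<lambda>\<tau>. \<tau> *\<^sub>R ?\<phi> \<tau>) has_vector_derivative ?\<phi> \<tau> + \<tau> *\<^sub>R t $ coord k *\<^sub>R
      h' (P (path_pt p k \<tau> t)) (X k (P (path_pt p k \<tau> t)))) (at \<tau> within {0..1})"
      by (auto intro!: derivative_eq_intros simp: add.commute)
  qed auto
  moreover have "?D \<tau> (axis (coord k) 1) = \<tau> *\<^sub>R h' (P (path_pt p k \<tau> t)) (X k (P (path_pt p k \<tau> t)))"
    if "\<tau> \<in> {0..1}" for \<tau>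
    using P'_axis[OF k path_in[OF t k that]] k p_le by (simp add: blinfun.scaleR_right)
  ultimately have I: "((\<lambda>\<tau>. ?\<phi> \<tau> + t $ coord k *\<^sub>R ?D \<tau> (axis (coord k) 1)) has_integral ?\<phi> 1) {0..1}"
    by (auto elim!: has_integral_eq[rotated] simp: mult.commute simp del: blinfun_apply_blinfun_compose)
  have J: "(?\<phi> has_integral integral {0..1} ?\<phi>) {0..1}" "(?D has_integral integral {0..1} ?D) {0..1}"
    using cont_h(2)[OF hc t] cont_h'(2)[OF h' t] integrable_continuous_real by blast+
  have "((\<lambda>\<tau>. ?D \<tau> (axis (coord k) 1)) has_integral integral {0..1} ?D (axis (coord k) 1)) {0..1}"
    using has_integral_linear[OF J(2) blinfun.bounded_linear_left[of "axis (coord k) 1"]] by (simp add: o_def)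
  from has_integral_add[OF J(1) has_integral_cmul[OF this]]
  have "((\<lambda>\<tau>. ?\<phi> \<tau> + t $ coord k *\<^sub>R ?D \<tau> (axis (coord k) 1)) has_integral
    integral {0..1} ?\<phi> + t $ coord k *\<^sub>R integral {0..1} ?D (axis (coord k) 1)) {0..1}" .
  from has_integral_unique[OF this I]
  show ?thesis
    by (simp add: step'_def blinfun.add_left blinfun.scaleR_left inner_axis)
qed

end
end

section \<open>Differentiating integral equations along a leg\<close>

context broken_path begin

text \<open>The hypothesis \<open>eq\<close> is an identity on the open set \<open>\<Theta>\<close>, since \<open>vertex\<close> is a linear projection;
  so it can be differentiated in every direction, although it only concerns values on slices.\<close>

lemma
  fixes H :: "(real^'n::_) \<Rightarrow> 'b::banach" and h' :: "(real^'n::_) \<Rightarrow> (real^'n::_) \<Rightarrow>\<^sub>L 'b"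
  assumes k: "k < p"
    and H: "\<And>t. t \<in> \<Theta> \<Longrightarrow> (H has_derivative blinfun_apply (H' t)) (at t)"
    and eq: "\<And>t. t \<in> \<Theta> \<Longrightarrow> H (vertex p (Suc k) t) = H (vertex p k t) + step k h t"
    and h: "\<And>x. x \<in> N \<Longrightarrow> (h has_derivative h' x) (at x)" and h': "continuous_on N h'"
    and t: "t \<in> \<Theta>"
  shows transport_same: "H' (vertex p (Suc k) t) (axis (coord k) 1) = h (P (vertex p (Suc k) t))"
    and transport_less: "l < k \<Longrightarrow> \<sigma> \<in> {0..1} \<Longrightarrow>
      ((\<lambda>\<sigma>. H' (path_pt p k \<sigma> t) (axis (coord l) 1)) has_vector_derivative
        t $ coord k *\<^sub>R h' (P (path_pt p k \<sigma> t)) (P' (path_pt p k \<sigma> t) (axis (coord l) 1)))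
      (at \<sigma> within {0..1})"
proof -
  have D: "H' (vertex p (Suc k) t) (vertex p (Suc k) v) = H' (vertex p k t) (vertex p k v) + step' k h h' t v"
    if t: "t \<in> \<Theta>" for t v
  proof -
    have "((\<lambda>t. H (vertex p k t) + step k h t) has_derivative
        (\<lambda>v. H' (vertex p k t) (vertex p k v) + step' k h h' t v)) (at t)"
      using k t by (intro has_derivative_add step_deriv h h'
          has_derivative_compose[OF vertex_deriv H]) (auto simp: vertex_in)
    then have "((\<lambda>t. H (vertex p (Suc k) t)) has_derivative
        (\<lambda>v. H' (vertex p k t) (vertex p k v) + step' k h h' t v)) (at t)"
      by (rule has_derivative_transform_within_open[OF _ open_\<Theta> t]) (simp add: eq)
    moreover have "((\<lambda>t. H (vertex p (Suc k) t)) has_derivative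
        (\<lambda>v. H' (vertex p (Suc k) t) (vertex p (Suc k) v))) (at t)"
      using k t by (intro has_derivative_compose[OF vertex_deriv H]) (auto simp: vertex_in)
    ultimately show ?thesis
      using has_derivative_unique by (metis (mono_tags))
  qed
  show "H' (vertex p (Suc k) t) (axis (coord k) 1) = h (P (vertex p (Suc k) t))"
    using D[OF t, of "axis (coord k) 1"] step'_axis_same[OF k h h' t] k p_le
    by (simp add: blinfun.zero_right)
  assume l: "l < k" and \<sigma>: "\<sigma> \<in> {0..1}"
  let ?D = "\<lambda>\<tau>. h' (P (path_pt p k \<tau> t)) o\<^sub>L (P' (path_pt p k \<tau> t) o\<^sub>L path_blinfun p k \<tau>)"
  let ?\<phi> = "\<lambda>\<tau>. h' (P (path_pt p k \<tau> t)) (P' (path_pt p k \<tau> t) (axis (coord l) 1))"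
  have \<phi>: "continuous_on {0..1} ?\<phi>"
    using k p_le l continuous_on_compose2[OF blinfun.continuous_on[OF cont_h'(2)[OF k h' t] continuous_on_const[of _ "axis (coord l) 1"]]
        continuous_on_id] by simp
  \<comment> \<open>\<open>D\<close> is evaluated at the intermediate point itself. In direction
    \<open>l < k\<close> the first summand of \<open>step'\<close> vanishes and
    \<open>path_pt\<close> fixes the axis, so after rescaling \<open>s\<close> appears only as upper
    limit. The derivative in \<open>s\<close> then exists although \<open>H'\<close> is not assumed
    to be differentiable.\<close>
  have *: "H' (path_pt p k s t) (axis (coord l) 1) =
      H' (vertex p k t) (axis (coord l) 1) + t $ coord k *\<^sub>R integral {0..s} ?\<phi>" if s: "s \<in> {0..1}" for s
  proof -
    have in': "path_pt p k s t \<in> \<Theta>" using path_in t k s by auto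
    let ?Ds = "\<lambda>\<tau>. h' (P (path_pt p k (\<tau> * s) t)) o\<^sub>L (P' (path_pt p k (\<tau> * s) t) o\<^sub>L path_blinfun p k \<tau>)"
    have "(?Ds has_integral integral {0..1} ?Ds) {0..1}"
      using cont_h'(2)[OF k h' in'] k p_le by (intro integrable_integral integrable_continuous_real) simp
    from has_integral_linear[OF this blinfun.bounded_linear_left[of "axis (coord l) 1"]]
    have "integral {0..1} ?Ds (axis (coord l) 1) = integral {0..1} (\<lambda>\<tau>. ?\<phi> (\<tau> * s))"
      using k p_le l by (auto simp: o_def intro!: integral_unique[symmetric])
    then show ?thesis
      using D[OF in', of "axis (coord l) 1"] k l p_le integral_rescale[OF \<phi> s]
      by (simp add: step'_def blinfun.add_left blinfun.scaleR_left inner_axis axis_nth coord_eq_iff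
          mult.commute[of s] flip: scaleR_scaleR) (simp add: axis_def coord_eq_iff)
  qed
  show "((\<lambda>\<sigma>. H' (path_pt p k \<sigma> t) (axis (coord l) 1)) has_vector_derivative t $ coord k *\<^sub>R ?\<phi> \<sigma>)
      (at \<sigma> within {0..1})"
    by (rule has_vector_derivative_transform[OF \<sigma>])
      (use * integral_has_vector_derivative[OF \<phi> \<sigma>] in \<open>auto intro!: derivative_eq_intros\<close>)
qed

text \<open>The flow equation in integral form. It allows \<open>transport_less\<close> with
  \<open>H = P\<close> and so yields the variational equation of the flow for a map \<open>P\<close>
  that is only C^1.\<close>

lemma P_step: "k < p \<Longrightarrow> t \<in> \<Theta> \<Longrightarrow> P (vertex p (Suc k) t) = P (vertex p k t) + step k (X k) t"
  using step_FTC[of k t "\<lambda>x. x" "\<lambda>_. id_blinfun"] by (simp add: has_derivative_ident)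

lemma telescope:
  assumes "\<And>k. k < p \<Longrightarrow> h (P (vertex p (Suc k) t)) = h (P (vertex p k t)) + step k (q k) t"
  shows "h (P t) = h (P (vertex p 0 t)) + (\<Sum>k<p. step k (q k) t)"
proof -
  have "(\<Sum>k<p. step k (q k) t) = (\<Sum>k<p. h (P (vertex p (Suc k) t)) - h (P (vertex p k t)))"
    using assms by simp
  also have "\<dots> = h (P (vertex p p t)) - h (P (vertex p 0 t))"
    by (rule sum_lessThan_telescope)
  finally show ?thesis by simp
qed

end

section \<open>Picard iteration with derivatives\<close>

text \<open>The term \<eta> absorbs quantities outside the sequence that become small for large
  indices. For the derivatives of the iterates it is the influence of the values; for the iterates
  themselves it is not present.\<close>

lemma uniformly_Cauchy_on_perturbed_contraction:
  fixes w :: "nat \<Rightarrow> 'a \<Rightarrow> 'b::real_normed_vector"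
  assumes bound: "\<And>n x. x \<in> S \<Longrightarrow> norm (w n x) \<le> B"
    and contr: "\<And>\<eta>. \<eta> > 0 \<Longrightarrow> \<exists>K. \<forall>n\<ge>K. \<forall>m\<ge>K. \<forall>D. (\<forall>x\<in>S. norm (w n x - w m x) \<le> D) \<longrightarrow>
      (\<forall>x\<in>S. norm (w (Suc n) x - w (Suc m) x) \<le> \<eta> + D / 2)"
  shows "uniformly_Cauchy_on S w"
  unfolding uniformly_Cauchy_on_def
proof (intro allI impI)
  fix e :: real assume e: "e > 0"
  have "\<exists>K. \<forall>n m D x. n \<ge> K \<longrightarrow> m \<ge> K \<longrightarrow> (\<forall>x\<in>S. norm (w n x - w m x) \<le> D) \<longrightarrow> x \<in> S \<longrightarrow>
    norm (w (Suc n) x - w (Suc m) x) \<le> e / 8 + D / 2"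
    using contr[of "e / 8"] e by (simp, meson)
  then obtain K where K: "\<And>n m D x. n \<ge> K \<Longrightarrow> m \<ge> K \<Longrightarrow> (\<forall>x\<in>S. norm (w n x - w m x) \<le> D) \<Longrightarrow> x \<in> S \<Longrightarrow>
    norm (w (Suc n) x - w (Suc m) x) \<le> e / 8 + D / 2"
    by blast
  \<comment> \<open>The fixed point of \<open>D \<mapsto> e / 8 + D / 2\<close> is
    \<open>e / 4\<close>; each step halves the excess over it, starting from the trivial bound
    \<open>2 * \<bar>B\<bar>\<close>.\<close>
  have *: "\<forall>x\<in>S. norm (w n x - w m x) \<le> e / 4 + (1/2) ^ j * (2 * \<bar>B\<bar>)" if "n \<ge> K + j" "m \<ge> K + j" for n m j
    using that
  proof (induction j arbitrary: n m)
    case 0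
    show ?case
    proof
      fix x assume "x \<in> S"
      with bound[of x n] bound[of x m] norm_triangle_ineq4[of "w n x" "w m x"] e
      show "norm (w n x - w m x) \<le> e / 4 + (1/2) ^ 0 * (2 * \<bar>B\<bar>)" by simp
    qed
  next
    case (Suc j)
    then obtain n' m' where nm: "n = Suc n'" "m = Suc m'" "n' \<ge> K + j" "m' \<ge> K + j"
      by (metis Suc_le_D add_Suc_right Suc_le_mono)
    show ?case
    proof
      fix x assume "x \<in> S"
      with K[OF _ _ Suc.IH[OF nm(3,4)]] nm
      have "norm (w n x - w m x) \<le> e / 8 + (e / 4 + (1/2) ^ j * (2 * \<bar>B\<bar>)) / 2" by auto
      also have "\<dots> = e / 4 + (1/2) ^ Suc j * (2 * \<bar>B\<bar>)"
        by (simp add: add_divide_distrib)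
      finally show "norm (w n x - w m x) \<le> e / 4 + (1/2) ^ Suc j * (2 * \<bar>B\<bar>)" .
    qed
  qed
  have "(\<lambda>j. (1/2) ^ j * (2 * \<bar>B\<bar>)) \<longlonglongrightarrow> 0"
    by (rule tendsto_mult_left_zero) (rule LIMSEQ_realpow_zero; simp)
  from order_tendstoD(2)[OF this, of "e / 2"] e
  obtain j where j: "(1/2) ^ j * (2 * \<bar>B\<bar>) < e / 2"
    unfolding eventually_sequentially by fastforce
  have "dist (w m x) (w n x) < e" if "x \<in> S" "m \<ge> K + j" "n \<ge> K + j" for m n x
  proof -
    have "norm (w m x - w n x) \<le> e / 4 + (1/2) ^ j * (2 * \<bar>B\<bar>)"
      using *[OF that(2,3)] that(1) by blast
    with j e show ?thesis by (simp add: dist_norm)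
  qed
  then show "\<exists>M. \<forall>x\<in>S. \<forall>m\<ge>M. \<forall>n\<ge>M. dist (w m x) (w n x) < e"
    by blast
qed

text \<open>If \<open>w\<close> is the derivative of \<open>u\<close>, this is the derivative of
  \<open>x \<mapsto> (x, u x)\<close>.\<close>

definition graph_blinfun :: "('a \<Rightarrow>\<^sub>L 'b) \<Rightarrow> 'a::real_normed_vector \<Rightarrow>\<^sub>L ('a \<times> 'b::real_normed_vector)" where
  "graph_blinfun w = Blinfun (\<lambda>v. (v, 0)) + (Blinfun (\<lambda>v. (0, v)) o\<^sub>L w)"

lemma bounded_linear_inl: "bounded_linear (\<lambda>v. (v, 0))"
  and bounded_linear_inr: "bounded_linear (\<lambda>v. (0, v))"
  by (auto intro!: bounded_linear_Pair bounded_linear_ident bounded_linear_zero)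

lemma graph_blinfun_apply [simp]: "graph_blinfun w v = (v, w v)"
  by (simp add: graph_blinfun_def blinfun.add_left bounded_linear_Blinfun_apply bounded_linear_inl bounded_linear_inr)

lemma continuous_on_graph_blinfun [continuous_intros]:
  "continuous_on S w \<Longrightarrow> continuous_on S (\<lambda>x. graph_blinfun (w x))"
  unfolding graph_blinfun_def by (intro continuous_intros)

lemma norm_graph_blinfun_le: "norm (graph_blinfun w) \<le> 1 + norm w"
proof (rule norm_blinfun_bound)
  fix v
  have "norm (v, w v) \<le> norm v + norm (w v)" by (rule norm_Pair_le)
  also have "norm (w v) \<le> norm w * norm v" by (rule norm_blinfun)
  finally show "norm (graph_blinfun w v) \<le> (1 + norm w) * norm v" by (simp add: algebra_simps)
qed simp

text \<open>The splitting separates the two causes of change: \<open>A - B\<close> is small by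
  uniform continuity only, whereas \<open>w - w'\<close> enters linearly and is the quantity to be
  contracted.\<close>

lemma graph_blinfun_diff_compose:
  "norm ((A o\<^sub>L graph_blinfun w) - (B o\<^sub>L graph_blinfun w')) \<le> norm (A - B) * (1 + norm w') + norm A * norm (w - w')"
proof (rule norm_blinfun_bound)
  fix v
  have "((A o\<^sub>L graph_blinfun w) - (B o\<^sub>L graph_blinfun w')) v = (A - B) (graph_blinfun w' v) + A (0, (w - w') v)"
    by (simp add: blinfun.diff_left algebra_simps flip: blinfun.add_right)
  also have "norm \<dots> \<le> norm (A - B) * norm (graph_blinfun w' v) + norm A * norm ((0 :: 'a, (w - w') v))"
    by (intro order_trans[OF norm_triangle_ineq] add_mono norm_blinfun)
  also have "\<dots> \<le> norm (A - B) * ((1 + norm w') * norm v) + norm A * (norm (w - w') * norm v)"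
    by (intro add_mono mult_left_mono order_trans[OF norm_blinfun] mult_right_mono norm_graph_blinfun_le)
      (auto simp: norm_Pair norm_blinfun)
  finally show "norm (((A o\<^sub>L graph_blinfun w) - (B o\<^sub>L graph_blinfun w')) v)
      \<le> (norm (A - B) * (1 + norm w') + norm A * norm (w - w')) * norm v"
    by (simp add: algebra_simps)
qed simp

definition vec_blinfun :: "('m::finite \<Rightarrow> 'a::real_normed_vector \<Rightarrow>\<^sub>L real) \<Rightarrow> 'a \<Rightarrow>\<^sub>L (real^'m)" where
  "vec_blinfun w = (\<Sum>\<alpha>\<in>UNIV. blinfun_scaleR_left (axis \<alpha> 1) o\<^sub>L w \<alpha>)"

lemma vec_blinfun_apply: "vec_blinfun w v = (\<chi> \<alpha>. w \<alpha> v)"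
  by (simp add: vec_blinfun_def blinfun.sum_left vec_eq_iff axis_def if_distrib cong: if_cong)

lemma vec_blinfun_nth [simp]: "vec_blinfun w v $ \<alpha> = w \<alpha> v"
  by (simp add: vec_blinfun_apply)

lemma norm_vec_blinfun_le: 
  fixes w :: "'m::finite \<Rightarrow> 'a::real_normed_vector \<Rightarrow>\<^sub>L real"
  assumes "\<And>\<alpha>. norm (w \<alpha>) \<le> B"
  shows "norm (vec_blinfun w) \<le> real CARD('m) * B"
proof -
  have "norm (blinfun_scaleR_left (axis \<alpha> 1 :: real^'m) o\<^sub>L w \<alpha>) \<le> B" for \<alpha>
  proof (rule norm_blinfun_bound[OF order_trans[OF norm_ge_zero assms[of \<alpha>]]])
    fix v :: 'a
    have "\<bar>w \<alpha> v\<bar> \<le> norm (w \<alpha>) * norm v" using norm_blinfun[of "w \<alpha>" v] by simp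
    also have "\<dots> \<le> B * norm v" by (intro mult_right_mono assms) simp
    finally show "norm (blinfun_apply (blinfun_scaleR_left (axis \<alpha> 1 :: real^'m) o\<^sub>L w \<alpha>) v) \<le> B * norm v" by simp
  qed
  then show ?thesis
    unfolding vec_blinfun_def by (intro order_trans[OF norm_sum] sum_bounded_above) simp
qed

lemma vec_blinfun_diff: "vec_blinfun w - vec_blinfun w' = vec_blinfun (\<lambda>\<alpha>. w \<alpha> - w' \<alpha>)"
  by (rule blinfun_eqI) (simp add: blinfun.diff_left vec_eq_iff)

lemma continuous_on_vec_blinfun [continuous_intros]:
  "(\<And>\<alpha>. continuous_on S (\<lambda>x. w x \<alpha>)) \<Longrightarrow> continuous_on S (\<lambda>x. vec_blinfun (w x))"
  unfolding vec_blinfun_def by (intro continuous_intros)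

lemma norm_vec_le:
  fixes v :: "real^'m::finite"
  assumes "\<And>\<alpha>. \<bar>v $ \<alpha>\<bar> \<le> B" shows "norm v \<le> real CARD('m) * B"
  using norm_le_l1_cart[of v] sum_bounded_above[of UNIV "\<lambda>\<alpha>. \<bar>v $ \<alpha>\<bar>" B] assms by simp

lemma has_derivative_vec_lambda:
  assumes "\<And>\<alpha>. (h \<alpha> has_derivative blinfun_apply (w \<alpha>)) (at x within S)"
  shows "((\<lambda>x. \<chi> \<alpha>. h \<alpha> x) has_derivative vec_blinfun w) (at x within S)"
  using assms by (intro has_derivative_componentwise_within[THEN iffD2])
    (auto simp: Basis_vec_def inner_axis vec_blinfun_apply)

text \<open>\<open>G\<close> is the data as a function of the coordinates \<open>t\<close>.
  \<open>G_near\<close> and \<open>small_value\<close> each use up half of \<rho>, shared among the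
  components, so that the Picard map preserves the ball around \<open>gb\<close>.
  \<open>small_contr\<close> and \<open>small_deriv\<close> give the factor 1/2 for the values and
  for the derivatives; the latter also pays for the change of coordinates, \<open>CP\<close> for
  \<open>P\<close> and \<open>CQ\<close> for \<open>Q\<close>.\<close>

locale picard =
  fixes p :: "'m::finite \<Rightarrow> nat"
    and X :: "'m \<Rightarrow> nat \<Rightarrow> (real^'n::_) \<Rightarrow> (real^'n::{finite,linorder})"

    and \<Theta> :: "'m \<Rightarrow> (real^'n::_) set" and N :: "(real^'n::_) set"
    and P Q :: "'m \<Rightarrow> (real^'n::_) \<Rightarrow> (real^'n::_)"
    and P' Q' :: "'m \<Rightarrow> (real^'n::_) \<Rightarrow> (real^'n::_) \<Rightarrow>\<^sub>L (real^'n::_)"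
    and F :: "'m \<Rightarrow> nat \<Rightarrow> (real^'n::_) \<times> (real^'m) \<Rightarrow> real"
    and F' :: "'m \<Rightarrow> nat \<Rightarrow> (real^'n::_) \<times> (real^'m) \<Rightarrow> ((real^'n::_) \<times> (real^'m)) \<Rightarrow>\<^sub>L real"
    and G :: "'m \<Rightarrow> (real^'n::_) \<Rightarrow> real" and G' :: "'m \<Rightarrow> (real^'n::_) \<Rightarrow> (real^'n::_) \<Rightarrow>\<^sub>L real"
    and xb :: "(real^'n::_)" and gb :: "real^'m"
    and \<rho> \<delta> CP CQ F0 F1 G1 :: real
  assumes path: "broken_path (p \<alpha>) (X \<alpha>) (\<Theta> \<alpha>) N (P \<alpha>) (Q \<alpha>) (P' \<alpha>) (Q' \<alpha>)"
    and N_sub: "N \<subseteq> cball xb \<rho>"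
    and F_deriv: "k < p \<alpha> \<Longrightarrow> z \<in> cball xb \<rho> \<times> cball gb \<rho> \<Longrightarrow> (F \<alpha> k has_derivative F' \<alpha> k z) (at z)"
    and F'_cont: "k < p \<alpha> \<Longrightarrow> continuous_on (cball xb \<rho> \<times> cball gb \<rho>) (F' \<alpha> k)"
    and F_bound: "k < p \<alpha> \<Longrightarrow> z \<in> cball xb \<rho> \<times> cball gb \<rho> \<Longrightarrow> \<bar>F \<alpha> k z\<bar> \<le> F0"
    and F'_bound: "k < p \<alpha> \<Longrightarrow> z \<in> cball xb \<rho> \<times> cball gb \<rho> \<Longrightarrow> norm (F' \<alpha> k z) \<le> F1"
    and G_deriv: "t \<in> \<Theta> \<alpha> \<Longrightarrow> (G \<alpha> has_derivative G' \<alpha> t) (at t)"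
    and G'_cont: "continuous_on (\<Theta> \<alpha>) (G' \<alpha>)"
    and G'_bound: "t \<in> \<Theta> \<alpha> \<Longrightarrow> norm (G' \<alpha> t) \<le> G1"
    and G_near: "t \<in> \<Theta> \<alpha> \<Longrightarrow> \<bar>G \<alpha> t - gb $ \<alpha>\<bar> \<le> \<rho> / (2 * real CARD('m))"
    and P'_bound: "t \<in> \<Theta> \<alpha> \<Longrightarrow> norm (P' \<alpha> t) \<le> CP"
    and Q'_bound: "x \<in> N \<Longrightarrow> norm (Q' \<alpha> x) \<le> CQ"
    and \<delta>_bound: "t \<in> \<Theta> \<alpha> \<Longrightarrow> k < p \<alpha> \<Longrightarrow> \<bar>t $ coord k\<bar> \<le> \<delta>"
    and nonneg: "0 < \<rho>" "0 \<le> \<delta>" "0 \<le> CP" "0 \<le> CQ" "0 \<le> F0" "0 \<le> F1" "0 \<le> G1"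
    and small_value: "real CARD('n) * (\<delta> * F0) \<le> \<rho> / (2 * real CARD('m))"
    and small_contr: "real CARD('m) * (real CARD('n) * (\<delta> * F1)) \<le> 1 / 2"
    and small_deriv: "real CARD('m) * (real CARD('n) * (\<delta> * (F1 * CP)) * CQ) \<le> 1 / 2"
begin

sublocale path: broken_path "p \<alpha>" "X \<alpha>" "\<Theta> \<alpha>" N "P \<alpha>" "Q \<alpha>" "P' \<alpha>" "Q' \<alpha>" for \<alpha>
  by (rule path)

section \<open>The Picard map and its formal derivative\<close>

abbreviation "K \<equiv> cball gb \<rho>"

definition good :: "((real^'n::_) \<Rightarrow> (real^'m)) \<Rightarrow> bool" where
  "good u \<longleftrightarrow> continuous_on N u \<and> u ` N \<subseteq> K"

definition phi :: "((real^'n::_) \<Rightarrow> (real^'m)) \<Rightarrow> (real^'n::_) \<Rightarrow> (real^'m)" where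
  "phi u x = (\<chi> \<alpha>. G \<alpha> (Q \<alpha> x) + (\<Sum>k<p \<alpha>. path.step \<alpha> k (\<lambda>y. F \<alpha> k (y, u y)) (Q \<alpha> x)))"

text \<open>The derivative of \<open>phi u\<close> with \<open>w\<close> in place of the derivative
  of \<open>u\<close>. Keeping \<open>w\<close> independent makes sense of the recursion, and of
  limits in it, before \<open>w\<close> is known to be a derivative.\<close>

definition phi' :: "((real^'n::_) \<Rightarrow> (real^'m)) \<Rightarrow> ((real^'n::_) \<Rightarrow> (real^'n::_) \<Rightarrow>\<^sub>L (real^'m)) \<Rightarrow>
    (real^'n::_) \<Rightarrow> (real^'n::_) \<Rightarrow>\<^sub>L (real^'m)" where
  "phi' u w x = vec_blinfun (\<lambda>\<alpha>. (G' \<alpha> (Q \<alpha> x) +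
     (\<Sum>k<p \<alpha>. path.step' \<alpha> k (\<lambda>y. F \<alpha> k (y, u y)) (\<lambda>y. F' \<alpha> k (y, u y) o\<^sub>L graph_blinfun (w y)) (Q \<alpha> x)))
     o\<^sub>L Q' \<alpha> x)"

lemma F_cont: "k < p \<alpha> \<Longrightarrow> continuous_on (cball xb \<rho> \<times> K) (F \<alpha> k)"
  using F_deriv by (meson continuous_at_imp_continuous_on has_derivative_continuous)

lemma goodD: "good u \<Longrightarrow> x \<in> N \<Longrightarrow> (x, u x) \<in> cball xb \<rho> \<times> K"
  using N_sub by (auto simp: good_def)

lemma cont_comp: "good u \<Longrightarrow> k < p \<alpha> \<Longrightarrow> continuous_on N (\<lambda>y. F \<alpha> k (y, u y))"
  by (rule continuous_on_compose2[OF F_cont])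
    (use goodD in \<open>auto simp: good_def intro!: continuous_intros\<close>)

lemma cont_comp': "good u \<Longrightarrow> continuous_on N w \<Longrightarrow> k < p \<alpha> \<Longrightarrow>
    continuous_on N (\<lambda>y. F' \<alpha> k (y, u y) o\<^sub>L graph_blinfun (w y))"
  by (intro continuous_intros continuous_on_compose2[OF F'_cont[of k \<alpha>]])
    (use goodD in \<open>auto simp: good_def\<close>)

lemma comp_deriv:
  assumes "good u" "(u has_derivative blinfun_apply (w x)) (at x)" "x \<in> N" "k < p \<alpha>"
  shows "((\<lambda>y. F \<alpha> k (y, u y)) has_derivative (F' \<alpha> k (x, u x) o\<^sub>L graph_blinfun (w x))) (at x)"
  by (rule has_derivative_eq_rhs[OF has_derivative_compose[OF
      has_derivative_Pair[OF has_derivative_ident assms(2)] F_deriv[OF assms(4) goodD[OF assms(1,3)]]]])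
    (simp add: fun_eq_iff)

lemma F_lip:
  assumes "k < p \<alpha>" "x \<in> cball xb \<rho>" "u \<in> K" "v \<in> K"
  shows "\<bar>F \<alpha> k (x, u) - F \<alpha> k (x, v)\<bar> \<le> F1 * norm (u - v)"
proof -
  have "norm (F \<alpha> k (x, u) - F \<alpha> k (x, v)) \<le> F1 * norm (u - v)"
  proof (rule differentiable_bound[OF convex_cball])
    fix z assume z: "z \<in> K"
    have "((\<lambda>u. F \<alpha> k (x, u)) has_derivative (\<lambda>v. F' \<alpha> k (x, z) (0, v))) (at z)"
      using has_derivative_compose[OF has_derivative_Pair[OF has_derivative_const has_derivative_ident] F_deriv[OF assms(1)], of x z]
        z assms by simp
    then show "((\<lambda>u. F \<alpha> k (x, u)) has_derivative (\<lambda>v. F' \<alpha> k (x, z) (0, v))) (at z within K)"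
      by (rule has_derivative_at_withinI)
    show "onorm (\<lambda>v. F' \<alpha> k (x, z) (0, v)) \<le> F1"
    proof (rule onorm_bound)
      fix v :: "real^'m"
      show "norm (F' \<alpha> k (x, z) (0, v)) \<le> F1 * norm v"
        using norm_blinfun[of "F' \<alpha> k (x, z)" "(0, v)"] F'_bound[OF assms(1), of "(x, z)"] z assms
          mult_right_mono[of "norm (F' \<alpha> k (x, z))" F1 "norm v"]
        by (auto simp: norm_Pair)
    qed (use nonneg in simp)
  qed (use assms in auto)
  then show ?thesis by simp
qed

lemma sum_p_bound:
  fixes a :: "nat \<Rightarrow> 'b::real_normed_vector"
  assumes "\<And>k. k < p \<alpha> \<Longrightarrow> norm (a k) \<le> B" "0 \<le> B"
  shows "norm (\<Sum>k<p \<alpha>. a k) \<le> real CARD('n) * B"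
proof -
  have "norm (\<Sum>k<p \<alpha>. a k) \<le> of_nat (card {..<p \<alpha>}) * B"
    using assms by (intro order_trans[OF norm_sum] sum_bounded_above) auto
  also have "\<dots> \<le> real CARD('n) * B"
    using assms(2) path.p_le[of \<alpha>] by (intro mult_right_mono) auto
  finally show ?thesis .
qed

text \<open>Continuity and the bound along \<open>u\<close> are assumed instead of
  \<open>good u\<close>, so that the lemma also applies to a solution whose values are not yet known
  to lie in \<open>K\<close>.\<close>

lemma phi_in_K:
  assumes u: "\<And>\<alpha> k. k < p \<alpha> \<Longrightarrow> continuous_on N (\<lambda>y. F \<alpha> k (y, u y))"
      "\<And>\<alpha> k y. k < p \<alpha> \<Longrightarrow> y \<in> N \<Longrightarrow> \<bar>F \<alpha> k (y, u y)\<bar> \<le> F0"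
    and x: "x \<in> N"
  shows "phi u x \<in> K"
proof -
  have "\<bar>(phi u x - gb) $ \<alpha>\<bar> \<le> \<rho> / real CARD('m)" for \<alpha>
  proof -
    have t: "Q \<alpha> x \<in> \<Theta> \<alpha>" using x path.Q_in by auto
    have "norm (\<Sum>k<p \<alpha>. path.step \<alpha> k (\<lambda>y. F \<alpha> k (y, u y)) (Q \<alpha> x)) \<le> real CARD('n) * (\<delta> * F0)"
      using nonneg by (intro sum_p_bound path.norm_step_le[OF _ u(1) t])
        (use u(2) \<delta>_bound t in auto)
    with G_near[OF t] small_value
    have "\<bar>(phi u x - gb) $ \<alpha>\<bar> \<le> 2 * (\<rho> / (2 * real CARD('m)))"
      by (simp add: phi_def)
    then show ?thesis by simp
  qed
  then have "norm (phi u x - gb) \<le> real CARD('m) * (\<rho> / real CARD('m))"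
    by (rule norm_vec_le)
  then show ?thesis by (simp add: dist_norm norm_minus_commute)
qed

lemma phi_good:
  assumes u: "good u" shows "good (phi u)"
proof -
  have "continuous_on N (\<lambda>x. G \<alpha> (Q \<alpha> x) + (\<Sum>k<p \<alpha>. path.step \<alpha> k (\<lambda>y. F \<alpha> k (y, u y)) (Q \<alpha> x)))" for \<alpha>
  proof (intro continuous_on_add continuous_on_sum)
    have "continuous_on (\<Theta> \<alpha>) (G \<alpha>)"
      using G_deriv by (meson continuous_at_imp_continuous_on has_derivative_continuous)
    then show "continuous_on N (\<lambda>x. G \<alpha> (Q \<alpha> x))"
      by (rule continuous_on_compose2) (auto simp: path.Q_cont path.Q_in)
    fix k assume "k \<in> {..<p \<alpha>}"
    then have "continuous_on (\<Theta> \<alpha>) (path.step \<alpha> k (\<lambda>y. F \<alpha> k (y, u y)))"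
      by (intro path.step_cont cont_comp u) auto
    then show "continuous_on N (\<lambda>x. path.step \<alpha> k (\<lambda>y. F \<alpha> k (y, u y)) (Q \<alpha> x))"
      by (rule continuous_on_compose2) (auto simp: path.Q_cont path.Q_in)
  qed
  moreover have "phi u x \<in> K" if "x \<in> N" for x
    using cont_comp[OF u] F_bound goodD[OF u] that by (intro phi_in_K) auto
  ultimately show ?thesis
    unfolding good_def phi_def by (auto intro!: continuous_on_vec_lambda)
qed

lemma phi_deriv:
  assumes u: "good u" and d: "\<And>x. x \<in> N \<Longrightarrow> (u has_derivative blinfun_apply (w x)) (at x)"
    and w: "continuous_on N w"
  shows "x \<in> N \<Longrightarrow> (phi u has_derivative phi' u w x) (at x)" "continuous_on N (phi' u w)"
proof -
  have [intro!]: "k < p \<alpha> \<Longrightarrow> t \<in> \<Theta> \<alpha> \<Longrightarrow>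
    (path.step \<alpha> k (\<lambda>y. F \<alpha> k (y, u y)) has_derivative
      path.step' \<alpha> k (\<lambda>y. F \<alpha> k (y, u y)) (\<lambda>y. F' \<alpha> k (y, u y) o\<^sub>L graph_blinfun (w y)) t) (at t)" for k \<alpha> t
    by (rule path.step_deriv) (use comp_deriv[where w = w, OF u d] cont_comp'[OF u w] in auto)
  show "(phi u has_derivative phi' u w x) (at x)" if x: "x \<in> N"
    unfolding phi_def[abs_def] phi'_def
  proof (rule has_derivative_vec_lambda)
    fix \<alpha>
    have t: "Q \<alpha> x \<in> \<Theta> \<alpha>" using x path.Q_in by auto
    have "((\<lambda>t. G \<alpha> t + (\<Sum>k<p \<alpha>. path.step \<alpha> k (\<lambda>y. F \<alpha> k (y, u y)) t)) has_derivative
      (\<lambda>v. G' \<alpha> (Q \<alpha> x) v + (\<Sum>k<p \<alpha>. path.step' \<alpha> k (\<lambda>y. F \<alpha> k (y, u y)) (\<lambda>y. F' \<alpha> k (y, u y) o\<^sub>L graph_blinfun (w y)) (Q \<alpha> x) v))) (at (Q \<alpha> x))"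
      using t by (intro has_derivative_add has_derivative_sum G_deriv) auto
    from has_derivative_compose[OF path.Q_deriv[OF x] this]
    show "((\<lambda>x. G \<alpha> (Q \<alpha> x) + (\<Sum>k<p \<alpha>. path.step \<alpha> k (\<lambda>y. F \<alpha> k (y, u y)) (Q \<alpha> x))) has_derivative
      ((G' \<alpha> (Q \<alpha> x) +
     (\<Sum>k<p \<alpha>. path.step' \<alpha> k (\<lambda>y. F \<alpha> k (y, u y)) (\<lambda>y. F' \<alpha> k (y, u y) o\<^sub>L graph_blinfun (w y)) (Q \<alpha> x)))
     o\<^sub>L Q' \<alpha> x)) (at x)"
      by (rule has_derivative_eq_rhs) (simp add: fun_eq_iff blinfun.add_left blinfun.sum_left)
  qed
  show "continuous_on N (phi' u w)"
    unfolding phi'_def[abs_def]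
  proof (intro continuous_intros)
    fix \<alpha>
    show "continuous_on N (\<lambda>x. G' \<alpha> (Q \<alpha> x))"
      by (rule continuous_on_compose2[OF G'_cont]) (auto simp: path.Q_cont path.Q_in)
    show "continuous_on N (Q' \<alpha>)" by (rule path.Q'_cont)
    fix k assume "k \<in> {..<p \<alpha>}"
    then have "continuous_on (\<Theta> \<alpha>) (path.step' \<alpha> k (\<lambda>y. F \<alpha> k (y, u y)) (\<lambda>y. F' \<alpha> k (y, u y) o\<^sub>L graph_blinfun (w y)))"
      by (intro path.step'_cont cont_comp cont_comp' u w) auto
    then show "continuous_on N (\<lambda>x. path.step' \<alpha> k (\<lambda>y. F \<alpha> k (y, u y)) (\<lambda>y. F' \<alpha> k (y, u y) o\<^sub>L graph_blinfun (w y)) (Q \<alpha> x))"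
      by (rule continuous_on_compose2) (auto simp: path.Q_cont path.Q_in)
  qed
qed

lemma phi_diff:
  assumes u: "good u" "good v" and D: "\<And>y. y \<in> N \<Longrightarrow> norm (u y - v y) \<le> D" and x: "x \<in> N"
  shows "norm (phi u x - phi v x) \<le> D / 2"
proof -
  have D0: "0 \<le> D" using D[OF x] norm_ge_zero order_trans by blast
  have "\<bar>(phi u x - phi v x) $ \<alpha>\<bar> \<le> real CARD('n) * (\<delta> * (F1 * D))" for \<alpha>
  proof -
    have t: "Q \<alpha> x \<in> \<Theta> \<alpha>" using x path.Q_in by auto
    have "(phi u x - phi v x) $ \<alpha> = (\<Sum>k<p \<alpha>. path.step \<alpha> k (\<lambda>y. F \<alpha> k (y, u y)) (Q \<alpha> x)
      - path.step \<alpha> k (\<lambda>y. F \<alpha> k (y, v y)) (Q \<alpha> x))"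
      by (simp add: phi_def sum_subtractf)
    also have "norm \<dots> \<le> real CARD('n) * (\<delta> * (F1 * D))"
    proof (rule sum_p_bound)
      fix k assume k: "k < p \<alpha>"
      have "norm (path.step \<alpha> k (\<lambda>y. F \<alpha> k (y, u y) - F \<alpha> k (y, v y)) (Q \<alpha> x)) \<le> \<delta> * (F1 * D)"
      proof (rule path.norm_step_le[OF k _ t])
        fix y assume y: "y \<in> N"
        have "\<bar>F \<alpha> k (y, u y) - F \<alpha> k (y, v y)\<bar> \<le> F1 * norm (u y - v y)"
          using F_lip[OF k] goodD[OF u(1) y] goodD[OF u(2) y] by auto
        also have "\<dots> \<le> F1 * D"
          using D[OF y] nonneg by (intro mult_left_mono) auto
        finally show "norm (F \<alpha> k (y, u y) - F \<alpha> k (y, v y)) \<le> F1 * D" by simp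
      qed (use k t nonneg D0 \<delta>_bound u in \<open>auto intro!: continuous_intros cont_comp\<close>)
      then show "norm (path.step \<alpha> k (\<lambda>y. F \<alpha> k (y, u y)) (Q \<alpha> x) - path.step \<alpha> k (\<lambda>y. F \<alpha> k (y, v y)) (Q \<alpha> x)) \<le> \<delta> * (F1 * D)"
        by (subst path.step_diff[OF k]) (use k t u in \<open>auto intro: cont_comp\<close>)
    qed (use nonneg D0 in auto)
    finally show ?thesis by simp
  qed
  then have "norm (phi u x - phi v x) \<le> real CARD('m) * (real CARD('n) * (\<delta> * (F1 * D)))"
    by (rule norm_vec_le)
  also have "\<dots> = (real CARD('m) * (real CARD('n) * (\<delta> * F1))) * D" by simp
  also have "\<dots> \<le> 1/2 * D" using small_contr D0 by (rule mult_right_mono)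
  finally show ?thesis by simp
qed

text \<open>Values in \<open>K\<close> differ by at most \<open>2 * \<rho>\<close>, and each
  application of \<open>phi\<close> halves this bound.\<close>

lemma fixed_point_unique:
  assumes u: "good u" "\<And>x. x \<in> N \<Longrightarrow> phi u x = u x" and v: "good v" "\<And>x. x \<in> N \<Longrightarrow> phi v x = v x"
    and x: "x \<in> N"
  shows "u x = v x"
proof -
  have *: "norm (u x - v x) \<le> (1 / 2) ^ j * (2 * \<rho>)" if "x \<in> N" for j x
    using that
  proof (induction j arbitrary: x)
    case 0
    then have "u x \<in> K" "v x \<in> K" using goodD[OF u(1)] goodD[OF v(1)] by auto
    then have "dist (u x) (v x) \<le> 2 * \<rho>" by (simp add: dist_triangle_half_r dist_triangle_le dist_commute
          order_trans[OF dist_triangle[of _ _ gb]])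
    then show ?case by (simp add: dist_norm)
  next
    case (Suc j)
    from phi_diff[OF u(1) v(1) Suc.IH Suc.prems] Suc.prems show ?case by (simp add: u(2) v(2))
  qed
  have "(\<lambda>j. (1 / 2) ^ j * (2 * \<rho>)) \<longlonglongrightarrow> 0"
    by (intro tendsto_mult_left_zero LIMSEQ_realpow_zero) auto
  then have "norm (u x - v x) \<le> 0"
    by (rule tendsto_lowerbound) (use * x in auto)
  then show ?thesis by simp
qed

text \<open>Integrating the equations along the legs shows that \<open>u\<close> is fixed by
  \<open>phi\<close>, and only this shows that its values lie in \<open>K\<close>. Uniqueness
  thereby extends from functions near \<open>gb\<close> to all solutions.\<close>

lemma solution_fixed_point:
  assumes d: "\<And>x. x \<in> N \<Longrightarrow> (u has_derivative blinfun_apply (w x)) (at x)"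
    and F: "\<And>\<alpha> k. k < p \<alpha> \<Longrightarrow> continuous_on N (\<lambda>y. F \<alpha> k (y, u y))"
      "\<And>\<alpha> k y. k < p \<alpha> \<Longrightarrow> y \<in> N \<Longrightarrow> \<bar>F \<alpha> k (y, u y)\<bar> \<le> F0"
    and eq: "\<And>\<alpha> k x. k < p \<alpha> \<Longrightarrow> x \<in> N \<Longrightarrow> w x (X \<alpha> k x) $ \<alpha> = F \<alpha> k (x, u x)"
    and data: "\<And>\<alpha> t. t \<in> \<Theta> \<alpha> \<Longrightarrow> u (P \<alpha> (vertex (p \<alpha>) 0 t)) $ \<alpha> = G \<alpha> t"
  shows "good u" and "x \<in> N \<Longrightarrow> phi u x = u x"
proof -
  have phi: "phi u x = u x" if x: "x \<in> N" for x
  proof -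
    have "u x $ \<alpha> = G \<alpha> (Q \<alpha> x) + (\<Sum>k<p \<alpha>. path.step \<alpha> k (\<lambda>y. F \<alpha> k (y, u y)) (Q \<alpha> x))" for \<alpha>
    proof -
      have t: "Q \<alpha> x \<in> \<Theta> \<alpha>" using x path.Q_in by auto
      have "u (P \<alpha> (Q \<alpha> x)) $ \<alpha> = u (P \<alpha> (vertex (p \<alpha>) 0 (Q \<alpha> x))) $ \<alpha> + (\<Sum>k<p \<alpha>. path.step \<alpha> k (\<lambda>y. F \<alpha> k (y, u y)) (Q \<alpha> x))"
      proof (rule path.telescope[where h = "\<lambda>x. u x $ \<alpha>"])
        fix k assume k: "k < p \<alpha>"
        let ?w = "\<lambda>x. blinfun_inner_left (axis \<alpha> 1) o\<^sub>L w x"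
        have in': "P \<alpha> (path_pt (p \<alpha>) k \<tau> (Q \<alpha> x)) \<in> N" if "\<tau> \<in> {0..1}" for \<tau>
          using path.path_in[OF t k that] path.P_in by auto
        show "u (P \<alpha> (vertex (p \<alpha>) (Suc k) (Q \<alpha> x))) $ \<alpha> = u (P \<alpha> (vertex (p \<alpha>) k (Q \<alpha> x))) $ \<alpha> + path.step \<alpha> k (\<lambda>y. F \<alpha> k (y, u y)) (Q \<alpha> x)"
        proof (rule path.step_FTC[OF k t, where h = "\<lambda>x. u x $ \<alpha>" and h' = ?w])
          fix \<tau> :: real assume \<tau>: "\<tau> \<in> {0..1}"
          let ?x = "P \<alpha> (path_pt (p \<alpha>) k \<tau> (Q \<alpha> x))"
          show "((\<lambda>x. u x $ \<alpha>) has_derivative ?w ?x) (at ?x)"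
            by (rule has_derivative_eq_rhs[OF bounded_linear.has_derivative[OF bounded_linear_vec_nth d[OF in'[OF \<tau>]]]])
              (simp add: fun_eq_iff inner_axis)
          show "?w ?x (X \<alpha> k ?x) = F \<alpha> k (?x, u ?x)"
            using eq[OF k in'[OF \<tau>]] by (simp add: inner_axis)
        qed
      qed
      then show ?thesis using data[OF t] x by (simp add: path.PQ)
    qed
    then show ?thesis by (simp add: phi_def vec_eq_iff)
  qed
  then show "x \<in> N \<Longrightarrow> phi u x = u x" .
  show "good u"
    unfolding good_def
  proof (intro conjI subsetI)
    show "continuous_on N u"
      using d by (meson continuous_at_imp_continuous_on has_derivative_continuous)
    show "y \<in> K" if "y \<in> u ` N" for y
      using that phi_in_K[of u, OF F] phi by auto
  qed
qed

text \<open>The part of the bound on \<open>phi'\<close> that does not involve \<open>w\<close> is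
  \<open>c = CARD('m) * ((G1 + CARD('n) * F0) * CQ)\<close>, the rest is at most
  \<open>(1 + W) / 2\<close>. The least \<open>W\<close> with \<open>c + (1 + W) / 2 \<le> W\<close>
  is \<open>2 * c + 1\<close>.\<close>

definition "W0 = 2 * (real CARD('m) * ((G1 + real CARD('n) * F0) * CQ)) + 1"

lemma norm_comp'_le:
  assumes "good u" "norm (w x) \<le> W" "x \<in> N" "k < p \<alpha>"
  shows "norm (F' \<alpha> k (x, u x) o\<^sub>L graph_blinfun (w x)) \<le> F1 * (1 + W)"
  using F'_bound[OF assms(4) goodD[OF assms(1,3)]] nonneg assms(2) norm_graph_blinfun_le[of "w x"]
  by (intro order_trans[OF norm_blinfun_compose] mult_mono) auto

lemma W0_ge: "0 \<le> W0"
  using nonneg by (auto simp: W0_def)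

lemma phi'_bound:
  assumes u: "good u" and w: "continuous_on N w" "\<And>y. y \<in> N \<Longrightarrow> norm (w y) \<le> W0" and x: "x \<in> N"
  shows "norm (phi' u w x) \<le> W0"
proof -
  let ?B = "G1 + real CARD('n) * (F0 + \<delta> * ((F1 * (1 + W0)) * CP))"
  have "norm ((G' \<alpha> (Q \<alpha> x) +
     (\<Sum>k<p \<alpha>. path.step' \<alpha> k (\<lambda>y. F \<alpha> k (y, u y)) (\<lambda>y. F' \<alpha> k (y, u y) o\<^sub>L graph_blinfun (w y)) (Q \<alpha> x)))
     o\<^sub>L Q' \<alpha> x) \<le> ?B * CQ" for \<alpha>
  proof -
    have t: "Q \<alpha> x \<in> \<Theta> \<alpha>" using x path.Q_in by auto
    have "norm (\<Sum>k<p \<alpha>. path.step' \<alpha> k (\<lambda>y. F \<alpha> k (y, u y)) (\<lambda>y. F' \<alpha> k (y, u y) o\<^sub>L graph_blinfun (w y)) (Q \<alpha> x))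
      \<le> real CARD('n) * (F0 + \<delta> * ((F1 * (1 + W0)) * CP))"
    proof (rule sum_p_bound)
      fix k assume k: "k < p \<alpha>"
      show "norm (path.step' \<alpha> k (\<lambda>y. F \<alpha> k (y, u y)) (\<lambda>y. F' \<alpha> k (y, u y) o\<^sub>L graph_blinfun (w y)) (Q \<alpha> x))
        \<le> F0 + \<delta> * ((F1 * (1 + W0)) * CP)"
        by (rule path.norm_step'_le[OF k cont_comp[OF u k] cont_comp'[OF u w(1) k] t])
          (use F_bound[OF k goodD[OF u]] norm_comp'_le[OF u w(2)] k P'_bound \<delta>_bound[OF t k] nonneg W0_ge in auto)
    qed (use nonneg W0_ge in auto)
    with G'_bound[OF t] have "norm (G' \<alpha> (Q \<alpha> x) +
     (\<Sum>k<p \<alpha>. path.step' \<alpha> k (\<lambda>y. F \<alpha> k (y, u y)) (\<lambda>y. F' \<alpha> k (y, u y) o\<^sub>L graph_blinfun (w y)) (Q \<alpha> x))) \<le> ?B"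
      by (intro norm_triangle_mono) auto
    then show ?thesis
      using Q'_bound[OF x] nonneg W0_ge by (intro order_trans[OF norm_blinfun_compose] mult_mono) auto
  qed
  then have "norm (phi' u w x) \<le> real CARD('m) * (?B * CQ)"
    unfolding phi'_def by (rule norm_vec_blinfun_le)
  also have "\<dots> = (W0 - 1) / 2 + (real CARD('m) * (real CARD('n) * (\<delta> * (F1 * CP)) * CQ)) * (1 + W0)"
    by (simp add: W0_def algebra_simps)
  also have "\<dots> \<le> (W0 - 1) / 2 + 1 / 2 * (1 + W0)"
    using small_deriv W0_ge by (intro add_left_mono mult_right_mono) auto
  finally show ?thesis by (simp add: field_simps)
qed

text \<open>The first summand tends to 0 with \<open>D\<close> and \<eta>, the second contracts. As
  \<open>F'\<close> is only continuous, \<eta> cannot be replaced by a multiple of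
  \<open>D\<close>.\<close>

lemma phi'_diff:
  assumes u: "good u" "good v" and w: "continuous_on N w" "continuous_on N z" "\<And>y. y \<in> N \<Longrightarrow> norm (z y) \<le> W0"
    and D: "\<And>y. y \<in> N \<Longrightarrow> norm (u y - v y) \<le> D" and E: "\<And>y. y \<in> N \<Longrightarrow> norm (w y - z y) \<le> E"
    and \<eta>: "\<And>y \<alpha> k. y \<in> N \<Longrightarrow> k < p \<alpha> \<Longrightarrow> norm (F' \<alpha> k (y, u y) - F' \<alpha> k (y, v y)) \<le> \<eta>" "0 \<le> \<eta>"
    and x: "x \<in> N"
  shows "norm (phi' u w x - phi' v z x) \<le>
    real CARD('m) * (real CARD('n) * (F1 * D + \<delta> * (\<eta> * (1 + W0) * CP)) * CQ) + E / 2"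
proof -
  let ?h = "\<lambda>u \<alpha> k y. F \<alpha> k (y, u y)"
  let ?h' = "\<lambda>u w \<alpha> k y. F' \<alpha> k (y, u y) o\<^sub>L graph_blinfun (w y)"
  have D0: "0 \<le> D" "0 \<le> E" using D[OF x] E[OF x] norm_ge_zero order_trans by blast+
  let ?B = "F1 * D + \<delta> * ((\<eta> * (1 + W0) + F1 * E) * CP)"
  have B0: "0 \<le> ?B" using D0 \<eta>(2) W0_ge nonneg by simp
  have "norm (((G' \<alpha> (Q \<alpha> x) + (\<Sum>k<p \<alpha>. path.step' \<alpha> k (?h u \<alpha> k) (?h' u w \<alpha> k) (Q \<alpha> x))) o\<^sub>L Q' \<alpha> x)
      - ((G' \<alpha> (Q \<alpha> x) + (\<Sum>k<p \<alpha>. path.step' \<alpha> k (?h v \<alpha> k) (?h' v z \<alpha> k) (Q \<alpha> x))) o\<^sub>L Q' \<alpha> x))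
    \<le> (real CARD('n) * ?B) * CQ" for \<alpha>
  proof -
    have t: "Q \<alpha> x \<in> \<Theta> \<alpha>" using x path.Q_in by auto
    have "norm (\<Sum>k<p \<alpha>. path.step' \<alpha> k (?h u \<alpha> k) (?h' u w \<alpha> k) (Q \<alpha> x) - path.step' \<alpha> k (?h v \<alpha> k) (?h' v z \<alpha> k) (Q \<alpha> x))
        \<le> real CARD('n) * ?B"
    proof (rule sum_p_bound)
      fix k assume k: "k < p \<alpha>"
      have "norm (path.step' \<alpha> k (\<lambda>y. ?h u \<alpha> k y - ?h v \<alpha> k y) (\<lambda>y. ?h' u w \<alpha> k y - ?h' v z \<alpha> k y) (Q \<alpha> x)) \<le> ?B"
      proof (rule path.norm_step'_le[OF k _ _ t])
        fix y assume y: "y \<in> N"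
        have "\<bar>?h u \<alpha> k y - ?h v \<alpha> k y\<bar> \<le> F1 * norm (u y - v y)"
          using F_lip[OF k] goodD[OF u(1) y] goodD[OF u(2) y] by auto
        also have "\<dots> \<le> F1 * D"
          using D[OF y] nonneg by (intro mult_left_mono) auto
        finally show "norm (?h u \<alpha> k y - ?h v \<alpha> k y) \<le> F1 * D" by simp
        have "norm (?h' u w \<alpha> k y - ?h' v z \<alpha> k y) \<le>
            norm (F' \<alpha> k (y, u y) - F' \<alpha> k (y, v y)) * (1 + norm (z y)) + norm (F' \<alpha> k (y, u y)) * norm (w y - z y)"
          by (rule graph_blinfun_diff_compose)
        also have "\<dots> \<le> \<eta> * (1 + W0) + F1 * E"
          using \<eta> w(3)[OF y] E[OF y] F'_bound[OF k goodD[OF u(1) y]] y k nonneg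
          by (intro add_mono mult_mono) auto
        finally show "norm (?h' u w \<alpha> k y - ?h' v z \<alpha> k y) \<le> \<eta> * (1 + W0) + F1 * E" .
      qed (use k t nonneg D0 W0_ge \<eta>(2) \<delta>_bound P'_bound u w in \<open>auto intro!: continuous_on_diff cont_comp cont_comp'\<close>)
      then show "norm (path.step' \<alpha> k (?h u \<alpha> k) (?h' u w \<alpha> k) (Q \<alpha> x) - path.step' \<alpha> k (?h v \<alpha> k) (?h' v z \<alpha> k) (Q \<alpha> x)) \<le> ?B"
        by (subst path.step'_diff[OF k]) (use k t u w in \<open>auto intro: cont_comp cont_comp'\<close>)
    qed (rule B0)
    then show ?thesis
      using Q'_bound[OF x, of \<alpha>] B0
      unfolding bounded_bilinear.diff_left[OF bounded_bilinear_blinfun_compose, symmetric]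
      by (intro order_trans[OF norm_blinfun_compose] mult_mono) (auto simp: sum_subtractf)
  qed
  then have "norm (phi' u w x - phi' v z x) \<le> real CARD('m) * ((real CARD('n) * ?B) * CQ)"
    unfolding phi'_def vec_blinfun_diff by (rule norm_vec_blinfun_le)
  also have "\<dots> = real CARD('m) * (real CARD('n) * (F1 * D + \<delta> * (\<eta> * (1 + W0) * CP)) * CQ)
    + (real CARD('m) * (real CARD('n) * (\<delta> * (F1 * CP)) * CQ)) * E"
    by (simp add: algebra_simps)
  also have "\<dots> \<le> real CARD('m) * (real CARD('n) * (F1 * D + \<delta> * (\<eta> * (1 + W0) * CP)) * CQ) + 1 / 2 * E"
    using small_deriv D0 by (intro add_left_mono mult_right_mono) auto
  finally show ?thesis by simp
qed

section \<open>Convergence of the iterates together with their derivatives\<close>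

primrec iter :: "nat \<Rightarrow> (real^'n::_) \<Rightarrow> (real^'m)" where
  "iter 0 = (\<lambda>_. gb)"
| "iter (Suc j) = phi (iter j)"

primrec iter' :: "nat \<Rightarrow> (real^'n::_) \<Rightarrow> (real^'n::_) \<Rightarrow>\<^sub>L (real^'m)" where
  "iter' 0 = (\<lambda>_. 0)"
| "iter' (Suc j) = phi' (iter j) (iter' j)"

lemma iter_good: "good (iter j)"
  by (induction j) (use nonneg phi_good in \<open>auto simp: good_def\<close>)

lemma iter'_cont: "continuous_on N (iter' j)"
  and iter_deriv: "\<forall>x\<in>N. (iter j has_derivative iter' j x) (at x)"
  by (induction j) (auto simp: phi_deriv iter_good zero_blinfun.rep_eq)

lemma iter'_bound: "x \<in> N \<Longrightarrow> norm (iter' j x) \<le> W0"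
  by (induction j arbitrary: x) (auto simp: W0_ge intro!: phi'_bound iter_good iter'_cont)

lemma iter_Cauchy: "uniformly_Cauchy_on N iter"
proof (rule uniformly_Cauchy_on_perturbed_contraction)
  show "norm (iter j x) \<le> norm gb + \<rho>" if "x \<in> N" for j x
    using iter_good[of j] that norm_triangle_ineq2[of "iter j x" gb]
    by (auto simp: good_def dist_norm norm_minus_commute image_subset_iff)
  fix \<eta> :: real assume "\<eta> > 0"
  then show "\<exists>K. \<forall>n\<ge>K. \<forall>m\<ge>K. \<forall>D. (\<forall>x\<in>N. norm (iter n x - iter m x) \<le> D) \<longrightarrow>
      (\<forall>x\<in>N. norm (iter (Suc n) x - iter (Suc m) x) \<le> \<eta> + D / 2)"
  proof (intro exI[of _ 0] allI impI ballI)
    fix n m D x assume D: "\<forall>x\<in>N. norm (iter n x - iter m x) \<le> D" and x: "x \<in> N"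
    have "norm (iter (Suc n) x - iter (Suc m) x) \<le> D / 2"
      using phi_diff[OF iter_good iter_good _ x, of n m D] D by simp
    with \<open>\<eta> > 0\<close> show "norm (iter (Suc n) x - iter (Suc m) x) \<le> \<eta> + D / 2" by linarith
  qed
qed

lemma F'_uniform:
  assumes "\<eta> > 0"
  obtains d where "d > 0" "\<And>\<alpha> k y u v. k < p \<alpha> \<Longrightarrow> y \<in> cball xb \<rho> \<Longrightarrow> u \<in> K \<Longrightarrow> v \<in> K \<Longrightarrow> norm (u - v) < d \<Longrightarrow>
    norm (F' \<alpha> k (y, u) - F' \<alpha> k (y, v)) \<le> \<eta>"
proof -
  have "\<exists>d>0. \<forall>y u v. y \<in> cball xb \<rho> \<longrightarrow> u \<in> K \<longrightarrow> v \<in> K \<longrightarrow> norm (u - v) < d \<longrightarrow>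
    norm (F' \<alpha> k (y, u) - F' \<alpha> k (y, v)) \<le> \<eta>" if "k < p \<alpha>" for \<alpha> k
  proof -
    have "uniformly_continuous_on (cball xb \<rho> \<times> K) (F' \<alpha> k)"
      by (intro compact_uniformly_continuous F'_cont that compact_Times compact_cball)
    with assms obtain d where "d > 0" "\<And>z z'. z \<in> cball xb \<rho> \<times> K \<Longrightarrow> z' \<in> cball xb \<rho> \<times> K \<Longrightarrow> dist z' z < d \<Longrightarrow>
      dist (F' \<alpha> k z') (F' \<alpha> k z) < \<eta>"
      unfolding uniformly_continuous_on_def by metis
    then show ?thesis
      by (intro exI[of _ d]) (force simp: dist_norm norm_Pair intro: less_imp_le)
  qed
  then have "\<forall>\<alpha> k. \<exists>d. k < p \<alpha> \<longrightarrow> d > 0 \<and> (\<forall>y u v. y \<in> cball xb \<rho> \<longrightarrow> u \<in> K \<longrightarrow> v \<in> K \<longrightarrow> norm (u - v) < d \<longrightarrow>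
    norm (F' \<alpha> k (y, u) - F' \<alpha> k (y, v)) \<le> \<eta>)"
    by blast
  then have "\<exists>d. \<forall>\<alpha> k. k < p \<alpha> \<longrightarrow> d \<alpha> k > 0 \<and> (\<forall>y u v. y \<in> cball xb \<rho> \<longrightarrow> u \<in> K \<longrightarrow> v \<in> K \<longrightarrow> norm (u - v) < d \<alpha> k \<longrightarrow>
    norm (F' \<alpha> k (y, u) - F' \<alpha> k (y, v)) \<le> \<eta>)"
    by (simp only: choice_iff)
  then obtain d where d: "\<And>\<alpha> k. k < p \<alpha> \<Longrightarrow> d \<alpha> k > 0" "\<And>\<alpha> k y u v. k < p \<alpha> \<Longrightarrow> y \<in> cball xb \<rho> \<Longrightarrow> u \<in> K \<Longrightarrow> v \<in> K \<Longrightarrow>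
    norm (u - v) < d \<alpha> k \<Longrightarrow> norm (F' \<alpha> k (y, u) - F' \<alpha> k (y, v)) \<le> \<eta>"
    by blast
  \<comment> \<open>The element 1 keeps the set nonempty, so that \<open>Min\<close> is meaningful
    in every case.\<close>
  let ?S = "insert 1 ((\<lambda>(\<alpha>, k). d \<alpha> k) ` (SIGMA \<alpha>:UNIV. {..<p \<alpha>}))"
  have "finite ?S" by auto
  then have "Min ?S > 0" "\<And>\<alpha> k. k < p \<alpha> \<Longrightarrow> Min ?S \<le> d \<alpha> k"
    using d(1) by (auto simp: image_iff intro!: Min_le)
  with d(2) show thesis by (intro that[of "Min ?S"]) (auto intro: less_le_trans)
qed

lemma iter'_Cauchy: "uniformly_Cauchy_on N iter'"
proof (rule uniformly_Cauchy_on_perturbed_contraction[OF iter'_bound])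
  fix \<eta> :: real assume \<eta>: "\<eta> > 0"
  \<comment> \<open>The coefficient of the perturbation in \<open>phi'_diff\<close> when the same
    \<open>e\<close> bounds both the distance of the iterates and the oscillation of
    \<open>F'\<close>.\<close>
  let ?c = "real CARD('m) * (real CARD('n) * (F1 + \<delta> * ((1 + W0) * CP)) * CQ)"
  define e where "e = \<eta> / (?c + 1)"
  have c: "?c \<ge> 0" using nonneg W0_ge by simp
  then have e: "e > 0" "?c * e \<le> \<eta>" using \<eta> by (auto simp: e_def field_simps)
  obtain d where d: "d > 0" "\<And>\<alpha> k y u v. k < p \<alpha> \<Longrightarrow> y \<in> cball xb \<rho> \<Longrightarrow> u \<in> K \<Longrightarrow> v \<in> K \<Longrightarrow> norm (u - v) < d \<Longrightarrow>
    norm (F' \<alpha> k (y, u) - F' \<alpha> k (y, v)) \<le> e"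
    using F'_uniform[OF e(1)] by metis
  obtain J where J: "\<And>x n m. x \<in> N \<Longrightarrow> n \<ge> J \<Longrightarrow> m \<ge> J \<Longrightarrow> dist (iter n x) (iter m x) < min d e"
    using iter_Cauchy d(1) e(1) unfolding uniformly_Cauchy_on_def by (metis min_less_iff_conj)
  have "norm (iter' (Suc n) x - iter' (Suc m) x) \<le> \<eta> + D / 2"
    if nm: "n \<ge> J" "m \<ge> J" and D: "\<forall>x\<in>N. norm (iter' n x - iter' m x) \<le> D" and x: "x \<in> N" for n m D x
  proof -
    have "norm (F' \<alpha> k (y, iter n y) - F' \<alpha> k (y, iter m y)) \<le> e" if "y \<in> N" "k < p \<alpha>" for y \<alpha> k
      using d(2)[OF that(2)] goodD[OF iter_good that(1)] J[OF that(1) nm] by (auto simp: dist_norm)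
    then have "norm (phi' (iter n) (iter' n) x - phi' (iter m) (iter' m) x) \<le>
      real CARD('m) * (real CARD('n) * (F1 * e + \<delta> * (e * (1 + W0) * CP)) * CQ) + D / 2"
      using D J[OF _ nm] e(1) iter'_bound
      by (intro phi'_diff iter_good iter'_cont x) (auto simp: dist_norm intro: less_imp_le)
    also have "real CARD('m) * (real CARD('n) * (F1 * e + \<delta> * (e * (1 + W0) * CP)) * CQ) = ?c * e"
      by (simp add: algebra_simps)
    finally show ?thesis using e(2) by simp
  qed
  then show "\<exists>K. \<forall>n\<ge>K. \<forall>m\<ge>K. \<forall>D. (\<forall>x\<in>N. norm (iter' n x - iter' m x) \<le> D) \<longrightarrow>
      (\<forall>x\<in>N. norm (iter' (Suc n) x - iter' (Suc m) x) \<le> \<eta> + D / 2)"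
    by blast
qed

text \<open>The bound on \<open>w\<close> is part of the conclusion because the defects of
  \<open>u\<close> need an a priori bound on \<open>N\<close>, which is not compact.\<close>

theorem fixed_point:
  obtains u w where "good u" "\<And>x. x \<in> N \<Longrightarrow> (u has_derivative blinfun_apply (w x)) (at x)"
    "continuous_on N w" "\<And>x. x \<in> N \<Longrightarrow> norm (w x) \<le> W0" "\<And>x. x \<in> N \<Longrightarrow> phi u x = u x"
proof -
  obtain u w where u: "uniform_limit N iter u sequentially" and w: "uniform_limit N iter' w sequentially"
    using Cauchy_uniformly_convergent[OF iter_Cauchy] Cauchy_uniformly_convergent[OF iter'_Cauchy]
    by (auto simp: uniformly_convergent_on_def)
  have lim: "(\<lambda>j. iter j x) \<longlonglongrightarrow> u x" "(\<lambda>j. iter' j x) \<longlonglongrightarrow> w x" if "x \<in> N" for x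
    using tendsto_uniform_limitI[OF u that] tendsto_uniform_limitI[OF w that] .
  have "continuous_on N u" "continuous_on N w"
    using iter_good iter'_cont
    by (auto intro!: uniform_limit_theorem[OF _ u] uniform_limit_theorem[OF _ w] simp: good_def)
  moreover have "u x \<in> K" if "x \<in> N" for x
    by (rule closed_sequentially[OF closed_cball _ lim(1)[OF that]])
      (use iter_good that in \<open>force simp: good_def image_subset_iff\<close>)
  ultimately have good: "good u" and wc: "continuous_on N w" by (auto simp: good_def)
  have bound: "norm (w x) \<le> W0" if "x \<in> N" for x
    by (rule Lim_bounded[OF tendsto_norm[OF lim(2)[OF that]], of 0]) (simp add: iter'_bound that)
  have "(u has_derivative w x) (at x)" if x: "x \<in> N" for x
  proof -
    obtain r where r: "r > 0" "ball x r \<subseteq> N"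
      using path.open_N x open_contains_ball by blast
    \<comment> \<open>Termwise differentiation is available on convex sets, hence on a ball; the
      limit \<open>g\<close> it produces is identified with \<open>u\<close> afterwards.\<close>
    have "\<exists>g. \<forall>y\<in>ball x r. (\<lambda>j. iter j y) \<longlonglongrightarrow> g y \<and> (g has_derivative w y) (at y within ball x r)"
    proof (rule has_derivative_sequence[where f = iter and f' = "\<lambda>j y. blinfun_apply (iter' j y)"
          and g' = "\<lambda>y. blinfun_apply (w y)" and S = "ball x r", OF convex_ball _ _ _ lim(1)[OF x]])
      show "(iter j has_derivative iter' j y) (at y within ball x r)" if "y \<in> ball x r" for j y
        by (rule has_derivative_at_withinI, rule iter_deriv[rule_format]) (use that r in auto)
      show "\<forall>\<^sub>F j in sequentially. \<forall>y\<in>ball x r. \<forall>h. norm (iter' j y h - w y h) \<le> e * norm h" if "e > 0" for e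
      proof -
        have "\<forall>\<^sub>F j in sequentially. \<forall>y\<in>N. dist (iter' j y) (w y) < e"
          using w that by (auto simp: uniform_limit_iff)
        then show ?thesis
        proof (rule eventually_mono, intro ballI allI)
          fix j y h assume j: "\<forall>y\<in>N. dist (iter' j y) (w y) < e" and y: "y \<in> ball x r"
          have "norm (iter' j y h - w y h) = norm ((iter' j y - w y) h)" by (simp add: blinfun.diff_left)
          also have "\<dots> \<le> norm (iter' j y - w y) * norm h" by (rule norm_blinfun)
          also have "norm (iter' j y - w y) \<le> e"
            using j y r by (metis dist_norm less_imp_le subsetD)
          finally show "norm (iter' j y h - w y h) \<le> e * norm h" by (simp add: mult_right_mono)
        qed
      qed
    qed (use r in auto)
    then obtain g where g: "\<And>y. y \<in> ball x r \<Longrightarrow> (\<lambda>j. iter j y) \<longlonglongrightarrow> g y"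
      "\<And>y. y \<in> ball x r \<Longrightarrow> (g has_derivative w y) (at y within ball x r)" by blast
    have D: "(g has_derivative w x) (at x)"
      using g(2)[of x] r by (simp add: at_within_open[of x "ball x r"])
    have E: "g y = u y" if "y \<in> ball x r" for y
      using LIMSEQ_unique[OF g(1)[OF that] lim(1)] r that by blast
    show ?thesis
      by (rule has_derivative_transform_within_open[OF D open_ball[of x r]]) (use r E in auto)
  qed
  moreover have "phi u x = u x" if x: "x \<in> N" for x
  proof (rule LIMSEQ_unique)
    show "(\<lambda>j. iter (Suc j) x) \<longlonglongrightarrow> u x" using lim(1)[OF x] by (rule LIMSEQ_Suc)
    \<comment> \<open>\<open>phi\<close> is continuous for uniform convergence on \<open>N\<close>
      by \<open>phi_diff\<close>; convergence at \<open>x\<close> alone would not do, since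
      \<open>phi u x\<close> depends on \<open>u\<close> along whole paths.\<close>
    show "(\<lambda>j. iter (Suc j) x) \<longlonglongrightarrow> phi u x"
      unfolding LIMSEQ_iff
    proof (intro allI impI)
      fix e :: real assume e: "e > 0"
      have "\<exists>J. \<forall>j\<ge>J. \<forall>y\<in>N. dist (iter j y) (u y) < e"
        using u e by (auto simp: uniform_limit_iff eventually_sequentially)
      then obtain J where "\<And>j y. j \<ge> J \<Longrightarrow> y \<in> N \<Longrightarrow> dist (iter j y) (u y) < e"
        by blast
      then have "norm (phi (iter j) x - phi u x) \<le> e / 2" if "j \<ge> J" for j
        using that by (intro phi_diff iter_good good x) (auto simp: dist_norm intro: less_imp_le)
      with e show "\<exists>no. \<forall>n\<ge>no. norm (iter (Suc n) x - phi u x) < e"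
        by (intro exI[of _ J]) fastforce
    qed
  qed
  ultimately show thesis
    using that good wc bound by blast
qed

end

section \<open>Vanishing of the defects\<close>

lemma vector_deriv_bound:
  fixes \<phi> :: "real \<Rightarrow> 'a::real_normed_vector"
  assumes "\<And>s. s \<in> closed_segment a b \<Longrightarrow> (\<phi> has_vector_derivative \<phi>' s) (at s within closed_segment a b)"
    and "\<And>s. s \<in> closed_segment a b \<Longrightarrow> norm (\<phi>' s) \<le> B" and "s \<in> closed_segment a b"
  shows "norm (\<phi> s - \<phi> a) \<le> B * \<bar>s - a\<bar>"
proof -
  have "norm (\<phi> s - \<phi> a) \<le> B * norm (s - a)"
  proof (rule differentiable_bound[OF convex_closed_segment])
    fix s assume s: "s \<in> closed_segment a b"
    show "(\<phi> has_derivative (\<lambda>h. h *\<^sub>R \<phi>' s)) (at s within closed_segment a b)"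
      using assms(1)[OF s] by (simp add: has_vector_derivative_def)
    have "onorm (\<lambda>h. h *\<^sub>R \<phi>' s) \<le> norm (\<phi>' s)"
      by (rule onorm_bound) auto
    with assms(2)[OF s] show "onorm (\<lambda>h. h *\<^sub>R \<phi>' s) \<le> B" by linarith
  qed (use assms in auto)
  then show ?thesis by simp
qed

text \<open>Gronwall's inequality on a short interval: at the maximum of the norm the mean value
  bound gives \<open>m \<le> \<kappa> * \<bar>b - a\<bar> * m\<close>, hence \<open>m = 0\<close>.
  The segment may run in either direction.\<close>

lemma vanishing:
  fixes \<phi> :: "real \<Rightarrow> 'a::real_normed_vector"
  assumes \<phi>: "\<And>s. s \<in> closed_segment a b \<Longrightarrow> (\<phi> has_vector_derivative \<phi>' s) (at s within closed_segment a b)"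
    and le: "\<And>s. s \<in> closed_segment a b \<Longrightarrow> norm (\<phi>' s) \<le> \<kappa> * norm (\<phi> s)"
    and \<kappa>: "0 \<le> \<kappa>" "\<kappa> * \<bar>b - a\<bar> < 1" and 0: "\<phi> a = 0" and s: "s \<in> closed_segment a b"
  shows "\<phi> s = 0"
proof -
  have "continuous_on (closed_segment a b) (\<lambda>s. norm (\<phi> s))"
    using \<phi> by (intro continuous_on_norm) (meson continuous_on_eq_continuous_within has_vector_derivative_continuous)
  then obtain z where z: "z \<in> closed_segment a b" "\<And>s. s \<in> closed_segment a b \<Longrightarrow> norm (\<phi> s) \<le> norm (\<phi> z)"
    using continuous_attains_sup[of "closed_segment a b" "\<lambda>s. norm (\<phi> s)"] by auto
  have "norm (\<phi> z - \<phi> a) \<le> (\<kappa> * norm (\<phi> z)) * \<bar>z - a\<bar>"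
  proof (rule vector_deriv_bound[OF \<phi> _ z(1)])
    fix s assume "s \<in> closed_segment a b"
    with le[of s] z(2)[of s] \<kappa> show "norm (\<phi>' s) \<le> \<kappa> * norm (\<phi> z)"
      by (meson mult_left_mono order_trans)
  qed
  also have "\<dots> \<le> (\<kappa> * norm (\<phi> z)) * \<bar>b - a\<bar>"
    using z(1) \<kappa> by (intro mult_left_mono) (auto simp: closed_segment_eq_real_ivl split: if_splits)
  finally have "norm (\<phi> z) \<le> (\<kappa> * \<bar>b - a\<bar>) * norm (\<phi> z)"
    using 0 by (simp add: algebra_simps)
  with \<kappa>(2) have "norm (\<phi> z) \<le> 0"
    by (metis mult_le_cancel_right1 not_le)
  with z(2)[OF s] show ?thesis by (metis norm_le_zero_iff order_trans)
qed

text \<open>\<open>small_frame\<close> brings the transport of the coefficients \<open>a\<close>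
  over one leg under the threshold of \<open>vanishing\<close>. The
  \<open>1 / (2 * CARD('n))\<close> in \<open>near_identity\<close>, summed over at most
  \<open>CARD('n)\<close> directions, costs one half of the bound on the defects, and
  \<open>small_defect\<close> one quarter. In the latter, one \<open>CARD('n)\<close> counts legs,
  the other the terms of a sum over \<open>I \<alpha>\<close>, the outer 2 bounds \<open>a\<close>,
  and \<open>2 * CARD('m) * F1\<close> is the constant of \<open>commutator_bound\<close>.\<close>

locale stable_frame =
  picard p "\<lambda>\<alpha> k. r (idx \<alpha> k)" \<Theta> N P Q P' Q' "\<lambda>\<alpha> k. f \<alpha> (idx \<alpha> k)" "\<lambda>\<alpha> k. f' \<alpha> (idx \<alpha> k)"
    G G' xb gb \<rho> \<delta> CP CQ F0 F1 G1
  for p :: "'m::finite \<Rightarrow> nat"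
    and idx :: "'m \<Rightarrow> nat \<Rightarrow> 'n::{finite,linorder}"
    and r :: "'n \<Rightarrow> (real^'n::_) \<Rightarrow> (real^'n::_)"
    and r' :: "'n \<Rightarrow> (real^'n::_) \<Rightarrow> (real^'n::_) \<Rightarrow>\<^sub>L (real^'n::_)"
    and \<Theta> N P Q P' Q'
    and f :: "'m \<Rightarrow> 'n \<Rightarrow> (real^'n::_) \<times> (real^'m) \<Rightarrow> real"
    and f' G G' xb gb \<rho> \<delta> CP CQ F0 F1 G1 +
  fixes I :: "'m \<Rightarrow> 'n set"
    and \<theta> :: "'n \<Rightarrow> (real^'n::_) \<Rightarrow> (real^'n::_)"
    and \<theta>' :: "'n \<Rightarrow> (real^'n::_) \<Rightarrow> (real^'n::_) \<Rightarrow> (real^'n::_)"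
    and c :: "'n \<Rightarrow> 'n \<Rightarrow> 'n \<Rightarrow> (real^'n::_) \<Rightarrow> real"
    and CR CC :: real
  assumes idx: "bij_betw (idx \<alpha>) {..<p \<alpha>} (I \<alpha>)"
    and r_deriv: "x \<in> N \<Longrightarrow> (r i has_derivative r' i x) (at x)"
    and r'_cont: "continuous_on N (r' i)"
    and r_bound: "x \<in> N \<Longrightarrow> norm (r i x) \<le> CR"
    and dual: "x \<in> N \<Longrightarrow> \<theta> i x \<bullet> r j x = (if i = j then 1 else 0)"
    and expand: "x \<in> N \<Longrightarrow> (\<Sum>i\<in>UNIV. (\<theta> i x \<bullet> v) *\<^sub>R r i x) = v"
    and \<theta>_deriv: "x \<in> N \<Longrightarrow> (\<theta> i has_derivative \<theta>' i x) (at x)"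
    and bracket: "x \<in> N \<Longrightarrow> r' j x (r i x) - r' i x (r j x) = (\<Sum>k\<in>UNIV. c i j k x *\<^sub>R r k x)"
    and involutive: "i \<in> I \<alpha> \<Longrightarrow> j \<in> I \<alpha> \<Longrightarrow> k \<notin> I \<alpha> \<Longrightarrow> x \<in> N \<Longrightarrow> c i j k x = 0"
    and c_bound: "x \<in> N \<Longrightarrow> \<bar>c i j k x\<bar> \<le> CC"
    and near_identity: "t \<in> \<Theta> \<alpha> \<Longrightarrow> l < p \<alpha> \<Longrightarrow>
      \<bar>\<theta> i (P \<alpha> t) \<bullet> P' \<alpha> t (axis (coord l) 1) - (if i = idx \<alpha> l then 1 else 0)\<bar> \<le> 1 / (2 * real CARD('n))"
    and f_indep: "i \<in> I \<alpha> \<Longrightarrow> j \<in> I \<alpha> \<Longrightarrow> i \<noteq> j \<Longrightarrow> i \<notin> I \<beta> \<Longrightarrow> z \<in> N \<times> cball gb \<rho> \<Longrightarrow> f' \<alpha> j z (0, axis \<beta> 1) = 0"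
    and integrability: "i \<in> I \<alpha> \<Longrightarrow> j \<in> I \<alpha> \<Longrightarrow> i \<noteq> j \<Longrightarrow> (x, u) \<in> N \<times> cball gb \<rho> \<Longrightarrow>
      f' \<alpha> j (x, u) (r i x, 0) + (\<Sum>\<beta> | i \<in> I \<beta>. f' \<alpha> j (x, u) (0, axis \<beta> 1) * f \<beta> i (x, u))
      - f' \<alpha> i (x, u) (r j x, 0) - (\<Sum>\<beta> | j \<in> I \<beta>. f' \<alpha> i (x, u) (0, axis \<beta> 1) * f \<beta> j (x, u))
      = (\<Sum>k\<in>I \<alpha>. c i j k x * f \<alpha> k (x, u))"
    and G_vertex: "t \<in> \<Theta> \<alpha> \<Longrightarrow> l \<le> p \<alpha> \<Longrightarrow> G \<alpha> (vertex (p \<alpha>) l t) = G \<alpha> t"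
    and small_frame: "0 \<le> CC" "real CARD('n) * (real CARD('n) * (\<delta> * CC)) < 1"
    and small_defect: "real CARD('n) * (\<delta> * (real CARD('n) * (2 * (2 * real CARD('m) * F1)))) \<le> 1 / 4"
begin

section \<open>Transport of the dual coframe\<close>

lemma idx_in: "k < p \<alpha> \<Longrightarrow> idx \<alpha> k \<in> I \<alpha>"
  using idx by (auto simp: bij_betw_def)

lemma idx_surj: "i \<in> I \<alpha> \<Longrightarrow> \<exists>k<p \<alpha>. idx \<alpha> k = i"
  using idx by (force simp: bij_betw_def)

lemma dual_deriv:
  assumes x: "x \<in> N"
  shows "\<theta>' i x v \<bullet> r q x + \<theta> i x \<bullet> r' q x v = 0"
proof -
  have "((\<lambda>x. \<theta> i x \<bullet> r q x) has_derivative (\<lambda>v. \<theta> i x \<bullet> r' q x v + \<theta>' i x v \<bullet> r q x)) (at x)"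
    by (rule has_derivative_inner[OF \<theta>_deriv[OF x] r_deriv[OF x]])
  moreover have "((\<lambda>x. \<theta> i x \<bullet> r q x) has_derivative (\<lambda>v. 0)) (at x)"
    by (rule has_derivative_transform_within_open[OF has_derivative_const path.open_N x]) (simp add: dual)
  ultimately have "(\<lambda>v. \<theta> i x \<bullet> r' q x v + \<theta>' i x v \<bullet> r q x) = (\<lambda>v. 0)"
    by (rule has_derivative_unique)
  then show ?thesis by (metis add.commute)
qed

text \<open>The left-hand side is the Lie derivative of the form \<theta>_i along
  \<open>r j\<close>, evaluated at \<open>v\<close>. On \<open>r q\<close> it equals \<theta>_i of
  the bracket of \<open>r q\<close> and \<open>r j\<close>, because \<theta>_i is constant on the
  frame; linearity does the rest.\<close>

lemma coframe_transport:
  assumes x: "x \<in> N"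
  shows "\<theta>' i x (r j x) \<bullet> v + \<theta> i x \<bullet> r' j x v = (\<Sum>q\<in>UNIV. (\<theta> q x \<bullet> v) * c q j i x)"
proof -
  have *: "\<theta>' i x (r j x) \<bullet> r q x + \<theta> i x \<bullet> r' j x (r q x) = c q j i x" for q
  proof -
    have "\<theta>' i x (r j x) \<bullet> r q x + \<theta> i x \<bullet> r' j x (r q x) = \<theta> i x \<bullet> (r' j x (r q x) - r' q x (r j x))"
      using dual_deriv[OF x, of i "r j x" q] by (simp add: inner_diff_right)
    also have "\<dots> = c q j i x"
      using x by (simp add: bracket inner_sum_right dual if_distrib cong: if_cong)
    finally show ?thesis .
  qed
  have "\<theta>' i x (r j x) \<bullet> v + \<theta> i x \<bullet> r' j x v =
    \<theta>' i x (r j x) \<bullet> (\<Sum>q\<in>UNIV. (\<theta> q x \<bullet> v) *\<^sub>R r q x) + \<theta> i x \<bullet> r' j x (\<Sum>q\<in>UNIV. (\<theta> q x \<bullet> v) *\<^sub>R r q x)"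
    by (simp only: expand[OF x])
  also have "\<dots> = (\<Sum>q\<in>UNIV. (\<theta> q x \<bullet> v) * (\<theta>' i x (r j x) \<bullet> r q x + \<theta> i x \<bullet> r' j x (r q x)))"
    by (simp add: inner_sum_right blinfun.sum_right blinfun.scaleR_right sum.distrib algebra_simps)
  finally show ?thesis by (simp add: *)
qed

lemma c_refl: "x \<in> N \<Longrightarrow> c j j q x = 0"
  using arg_cong[OF bracket[of x j j], of "\<lambda>v. \<theta> q x \<bullet> v"]
  by (simp add: inner_sum_right dual if_distrib cong: if_cong)

text \<open>Leg \<open>k\<close> does not see the times after the \<open>k\<close>-th, and a leg
  whose own time is set to 0 contributes nothing.\<close>

lemma step_vertex:
  assumes "k < p \<alpha>" "j \<le> p \<alpha>"
  shows "path.step \<alpha> k q (vertex (p \<alpha>) j t) = (if k < j then path.step \<alpha> k q t else 0)"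
proof (cases "k < j")
  case True
  have "path_pt (p \<alpha>) k \<tau> (vertex (p \<alpha>) j t) = path_pt (p \<alpha>) k \<tau> t" for \<tau>
    using True assms path.p_le[of \<alpha>]
    by (auto simp: vec_eq_iff path_pt_nth coord_in_image_iff)
  then show ?thesis
    using True assms path.p_le[of \<alpha>] by (simp add: path.step_def coord_in_image_iff)
next
  case False
  then show ?thesis
    using assms path.p_le[of \<alpha>] by (simp add: path.step_def coord_in_image_iff)
qed

section \<open>The defects of a fixed point\<close>

context
  fixes u :: "(real^'n::_) \<Rightarrow> (real^'m)" and w
  assumes u: "good u" and ud: "\<And>x. x \<in> N \<Longrightarrow> (u has_derivative blinfun_apply (w x)) (at x)"
    and wc: "continuous_on N w" and wb: "\<And>x. x \<in> N \<Longrightarrow> norm (w x) \<le> W0"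
    and fixpt: "\<And>x. x \<in> N \<Longrightarrow> phi u x = u x"
begin

definition "h \<alpha> i y = f \<alpha> i (y, u y)"
definition "h' \<alpha> i y = f' \<alpha> i (y, u y) o\<^sub>L graph_blinfun (w y)"
definition "defect \<alpha> i x = w x (r i x) $ \<alpha> - h \<alpha> i x"
definition "a \<alpha> l i t = \<theta> i (P \<alpha> t) \<bullet> P' \<alpha> t (axis (coord l) 1)"
text \<open>Once \<open>a\<close> vanishes outside \<open>I \<alpha>\<close>, this is the sum of
  \<open>a\<close> times the defects. It is written with the partial derivative of \<open>U\<close>
  instead, since that and \<open>a\<close> are differentiable along later legs, while the defects
  are only continuous.\<close>

definition "E \<alpha> l t = w (P \<alpha> t) (P' \<alpha> t (axis (coord l) 1)) $ \<alpha> - (\<Sum>i\<in>I \<alpha>. h \<alpha> i (P \<alpha> t) * a \<alpha> l i t)"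
definition "U \<alpha> t = u (P \<alpha> t) $ \<alpha>"
definition "U' \<alpha> t = blinfun_inner_left (axis \<alpha> 1) o\<^sub>L (w (P \<alpha> t) o\<^sub>L P' \<alpha> t)"

lemma U'_apply: "U' \<alpha> t v = w (P \<alpha> t) (P' \<alpha> t v) $ \<alpha>"
  by (simp add: U'_def inner_axis)

lemma h_deriv: "x \<in> N \<Longrightarrow> i \<in> I \<alpha> \<Longrightarrow> (h \<alpha> i has_derivative h' \<alpha> i x) (at x)"
  using comp_deriv[where w = w, OF u ud] idx_surj[of i \<alpha>] unfolding h_def[abs_def] h'_def by blast

lemma h'_cont: "i \<in> I \<alpha> \<Longrightarrow> continuous_on N (h' \<alpha> i)"
  using cont_comp'[OF u wc] idx_surj[of i \<alpha>] unfolding h'_def[abs_def] by blast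

lemma U_deriv: "t \<in> \<Theta> \<alpha> \<Longrightarrow> (U \<alpha> has_derivative U' \<alpha> t) (at t)"
  unfolding U_def[abs_def]
  by (rule has_derivative_eq_rhs[OF bounded_linear.has_derivative[OF bounded_linear_vec_nth
        has_derivative_compose[OF path.P_deriv ud[OF path.P_in]]]])
    (auto simp: U'_apply fun_eq_iff)

lemma U_eq: "t \<in> \<Theta> \<alpha> \<Longrightarrow> U \<alpha> t = G \<alpha> t + (\<Sum>k<p \<alpha>. path.step \<alpha> k (h \<alpha> (idx \<alpha> k)) t)"
  using fixpt[OF path.P_in[of t \<alpha>], symmetric] by (simp add: U_def phi_def path.QP h_def[abs_def])

text \<open>The fixed point equation sums over all legs. At vertex \<open>j\<close> only the first
  \<open>j\<close> legs remain, so two consecutive vertices isolate a single leg.\<close>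

lemma U_step:
  assumes "k < p \<alpha>" "t \<in> \<Theta> \<alpha>"
  shows "U \<alpha> (vertex (p \<alpha>) (Suc k) t) = U \<alpha> (vertex (p \<alpha>) k t) + path.step \<alpha> k (h \<alpha> (idx \<alpha> k)) t"
proof -
  have *: "U \<alpha> (vertex (p \<alpha>) j t) = G \<alpha> t + (\<Sum>k<j. path.step \<alpha> k (h \<alpha> (idx \<alpha> k)) t)" if "j \<le> p \<alpha>" for j
  proof -
    have "(\<Sum>k<p \<alpha>. path.step \<alpha> k (h \<alpha> (idx \<alpha> k)) (vertex (p \<alpha>) j t)) = (\<Sum>k<p \<alpha>. if k < j then path.step \<alpha> k (h \<alpha> (idx \<alpha> k)) t else 0)"
      using that by (intro sum.cong) (auto simp: step_vertex)
    also have "\<dots> = (\<Sum>k<j. path.step \<alpha> k (h \<alpha> (idx \<alpha> k)) t)"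
      using that by (intro sum.mono_neutral_cong_right) auto
    finally show ?thesis
      using that assms by (simp add: U_eq path.vertex_in G_vertex)
  qed
  show ?thesis using assms(1) by (simp add: *)
qed

text \<open>At the end of leg \<open>l\<close>, with all later times 0, \<open>P\<close> moves
  exactly along the frame field of that leg, and \<open>transport_same\<close> reduces the
  derivative of the integral to the end value of its integrand. These are the initial values for the
  transport along the later legs.\<close>

lemma defect_start:
  assumes "l < p \<alpha>" "t \<in> \<Theta> \<alpha>"
  shows "defect \<alpha> (idx \<alpha> l) (P \<alpha> (vertex (p \<alpha>) (Suc l) t)) = 0"
    and "a \<alpha> l i (vertex (p \<alpha>) (Suc l) t) = (if i = idx \<alpha> l then 1 else 0)"
    and "E \<alpha> l (vertex (p \<alpha>) (Suc l) t) = 0"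
proof -
  let ?s = "vertex (p \<alpha>) (Suc l) t"
  have s: "?s \<in> \<Theta> \<alpha>" using assms by (simp add: path.vertex_in)
  note ax = path.P'_axis[OF assms]
  have "U' \<alpha> ?s (axis (coord l) 1) = h \<alpha> (idx \<alpha> l) (P \<alpha> ?s)"
    by (rule path.transport_same[OF assms(1) U_deriv U_step[OF assms(1)] h_deriv h'_cont assms(2)])
      (use idx_in assms in auto)
  then show d: "defect \<alpha> (idx \<alpha> l) (P \<alpha> ?s) = 0"
    by (simp add: U'_apply ax defect_def)
  show a: "a \<alpha> l i ?s = (if i = idx \<alpha> l then 1 else 0)" for i
    using dual[OF path.P_in[OF s]] by (simp add: a_def ax)
  show "E \<alpha> l ?s = 0"
    using d idx_in[OF assms(1)] by (simp add: E_def a ax defect_def if_distrib cong: if_cong)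
qed

context
  fixes \<alpha> l k t
  assumes k: "k < p \<alpha>" and l: "l < k" and t: "t \<in> \<Theta> \<alpha>"
begin

lemma seg_in: "\<sigma> \<in> {0..1} \<Longrightarrow> path_pt (p \<alpha>) k \<sigma> t \<in> \<Theta> \<alpha>"
  using path.path_in[OF t k] .

lemma seg_deriv:
  fixes q :: "(real^'n::_) \<Rightarrow> 'b::real_normed_vector"
  assumes \<sigma>: "\<sigma> \<in> {0..1}" and q: "(q has_derivative q') (at (P \<alpha> (path_pt (p \<alpha>) k \<sigma> t)))"
  shows "((\<lambda>\<sigma>. q (P \<alpha> (path_pt (p \<alpha>) k \<sigma> t))) has_vector_derivative
    t $ coord k *\<^sub>R q' (r (idx \<alpha> k) (P \<alpha> (path_pt (p \<alpha>) k \<sigma> t)))) (at \<sigma> within {0..1})"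
proof -
  have "bounded_linear q'" using q by (rule has_derivative_bounded_linear)
  then have "blinfun_apply (Blinfun q') = q'" by (rule bounded_linear_Blinfun_apply)
  then show ?thesis
    using path.path_velocity[OF k t \<sigma>, of q "Blinfun q'"] q by simp
qed

text \<open>The linear variational equation of the flow on leg \<open>k\<close>, for the earlier
  direction \<open>l\<close>.\<close>

lemma V_deriv:
  assumes \<sigma>: "\<sigma> \<in> {0..1}"
  shows "((\<lambda>\<sigma>. P' \<alpha> (path_pt (p \<alpha>) k \<sigma> t) (axis (coord l) 1)) has_vector_derivative
    t $ coord k *\<^sub>R r' (idx \<alpha> k) (P \<alpha> (path_pt (p \<alpha>) k \<sigma> t)) (P' \<alpha> (path_pt (p \<alpha>) k \<sigma> t) (axis (coord l) 1)))
    (at \<sigma> within {0..1})"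
  by (rule path.transport_less[OF k path.P_deriv path.P_step[OF k] r_deriv r'_cont t l \<sigma>])

text \<open>The derivative of the coframe and the variational equation together form the Lie
  derivative of \<open>coframe_transport\<close>, so the coefficients solve a linear equation that
  involves only the structure coefficients.\<close>

lemma a_deriv:
  assumes \<sigma>: "\<sigma> \<in> {0..1}"
  shows "((\<lambda>\<sigma>. a \<alpha> l i (path_pt (p \<alpha>) k \<sigma> t)) has_real_derivative
    t $ coord k * (\<Sum>q\<in>UNIV. a \<alpha> l q (path_pt (p \<alpha>) k \<sigma> t) * c q (idx \<alpha> k) i (P \<alpha> (path_pt (p \<alpha>) k \<sigma> t))))
    (at \<sigma> within {0..1})"
proof -
  let ?x = "P \<alpha> (path_pt (p \<alpha>) k \<sigma> t)" and ?V = "P' \<alpha> (path_pt (p \<alpha>) k \<sigma> t) (axis (coord l) 1)"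
  have x: "?x \<in> N" using path.P_in seg_in \<sigma> by auto
  have "((\<lambda>\<sigma>. a \<alpha> l i (path_pt (p \<alpha>) k \<sigma> t)) has_vector_derivative
    \<theta> i ?x \<bullet> (t $ coord k *\<^sub>R r' (idx \<alpha> k) ?x ?V) + (t $ coord k *\<^sub>R \<theta>' i ?x (r (idx \<alpha> k) ?x)) \<bullet> ?V) (at \<sigma> within {0..1})"
    unfolding a_def
    using has_derivative_inner[OF seg_deriv[OF \<sigma> \<theta>_deriv[OF x], unfolded has_vector_derivative_def] V_deriv[OF \<sigma>, unfolded has_vector_derivative_def]]
    by (simp add: has_vector_derivative_def algebra_simps)
  then show ?thesis
    using coframe_transport[OF x, of i "idx \<alpha> k" ?V]
    unfolding has_real_derivative_iff_has_vector_derivative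
    by (simp add: a_def algebra_simps flip: distrib_left)
qed

text \<open>The components of \<open>a\<close> outside \<open>I \<alpha>\<close> satisfy a closed
  homogeneous linear equation: by involutivity the components inside do not feed into it.
  \<open>A\<close> is the vector of the outer components, with zeros elsewhere.\<close>

lemma a_zero_step:
  assumes start: "\<And>i. i \<notin> I \<alpha> \<Longrightarrow> a \<alpha> l i (vertex (p \<alpha>) k t) = 0" and i: "i \<notin> I \<alpha>"
  shows "a \<alpha> l i (vertex (p \<alpha>) (Suc k) t) = 0"
proof -
  define A where "A \<sigma> = (\<chi> i. if i \<in> I \<alpha> then 0 else a \<alpha> l i (path_pt (p \<alpha>) k \<sigma> t))" for \<sigma>
  define A' where "A' \<sigma> = (\<chi> i. if i \<in> I \<alpha> then 0 else t $ coord k *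
    (\<Sum>q\<in>UNIV. a \<alpha> l q (path_pt (p \<alpha>) k \<sigma> t) * c q (idx \<alpha> k) i (P \<alpha> (path_pt (p \<alpha>) k \<sigma> t))))" for \<sigma>
  have "A 1 = 0"
  proof (rule vanishing[where a = 0 and b = 1 and \<phi> = A and \<phi>' = A' and \<kappa> = "real CARD('n) * (real CARD('n) * (\<delta> * CC))"])
    fix \<sigma> :: real assume "\<sigma> \<in> closed_segment 0 1"
    then have \<sigma>: "\<sigma> \<in> {0..1}" by (simp add: closed_segment_eq_real_ivl)
    let ?s = "path_pt (p \<alpha>) k \<sigma> t"
    have x: "P \<alpha> ?s \<in> N" using path.P_in seg_in \<sigma> by auto
    show "(A has_vector_derivative A' \<sigma>) (at \<sigma> within closed_segment 0 1)"
      unfolding has_vector_derivative_def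
    proof (rule has_derivative_componentwise_within[THEN iffD2], rule ballI)
      fix b :: "real^'n::_" assume "b \<in> Basis"
      then obtain j where b: "b = axis j 1" by (auto simp: Basis_vec_def)
      show "((\<lambda>x. A x \<bullet> b) has_derivative (\<lambda>x. (x *\<^sub>R A' \<sigma>) \<bullet> b)) (at \<sigma> within closed_segment 0 1)"
      proof (cases "j \<in> I \<alpha>")
        case False
        then show ?thesis
          using a_deriv[OF \<sigma>, of j]
          by (simp add: b A_def A'_def inner_axis has_field_derivative_def closed_segment_eq_real_ivl mult_commute_abs)
      qed (simp add: b A_def A'_def inner_axis)
    qed
    have "\<bar>A' \<sigma> $ j\<bar> \<le> real CARD('n) * (\<delta> * CC) * norm (A \<sigma>)" for j
    proof (cases "j \<in> I \<alpha>")
      case True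
      then show ?thesis using small_frame nonneg by (simp add: A'_def)
    next
      case False
      \<comment> \<open>For \<open>q\<close> in \<open>I \<alpha>\<close> the structure coefficient
        vanishes since \<open>j\<close> is not in \<open>I \<alpha>\<close>; for the other
        \<open>q\<close> the entries of \<open>a\<close> and \<open>A\<close> agree.\<close>
      have eq: "(\<Sum>q\<in>UNIV. a \<alpha> l q ?s * c q (idx \<alpha> k) j (P \<alpha> ?s)) = (\<Sum>q\<in>UNIV. A \<sigma> $ q * c q (idx \<alpha> k) j (P \<alpha> ?s))"
        using involutive[OF _ idx_in[OF k] False x] by (intro sum.cong) (auto simp: A_def)
      have "\<bar>\<Sum>q\<in>UNIV. A \<sigma> $ q * c q (idx \<alpha> k) j (P \<alpha> ?s)\<bar> \<le> real CARD('n) * (norm (A \<sigma>) * CC)"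
        using c_bound[OF x] component_le_norm_cart[of "A \<sigma>"]
        by (intro order_trans[OF sum_abs] sum_bounded_above) (auto simp: abs_mult intro!: mult_mono)
      then have "\<bar>t $ coord k\<bar> * \<bar>\<Sum>q\<in>UNIV. A \<sigma> $ q * c q (idx \<alpha> k) j (P \<alpha> ?s)\<bar> \<le> \<delta> * (real CARD('n) * (norm (A \<sigma>) * CC))"
        using \<delta>_bound[OF t k] nonneg by (intro mult_mono) auto
      then show ?thesis
        using False by (simp add: A'_def eq abs_mult algebra_simps)
    qed
    then have "norm (A' \<sigma>) \<le> real CARD('n) * (real CARD('n) * (\<delta> * CC) * norm (A \<sigma>))"
      by (rule norm_vec_le)
    then show "norm (A' \<sigma>) \<le> real CARD('n) * (real CARD('n) * (\<delta> * CC)) * norm (A \<sigma>)"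
      by (simp add: algebra_simps)
  next
    show "A 0 = 0" using start by (simp add: A_def vec_eq_iff)
  qed (use small_frame nonneg in auto)
  from arg_cong[OF this, of "\<lambda>v. v $ i"] i show ?thesis by (simp add: A_def)
qed

end

text \<open>Induction over the legs after the \<open>l\<close>-th; at the end of leg
  \<open>l\<close> itself the vector is the one frame field with index in \<open>I \<alpha>\<close>.
  For \<open>k = p \<alpha>\<close> the vertex is \<open>t\<close>.\<close>

lemma a_zero:
  assumes "l < k" "k \<le> p \<alpha>" "t \<in> \<Theta> \<alpha>" "i \<notin> I \<alpha>"
  shows "a \<alpha> l i (vertex (p \<alpha>) k t) = 0"
  using assms
proof (induction k arbitrary: i)
  case (Suc k)
  show ?case
  proof (cases "l = k")
    case True
    with Suc.prems show ?thesis using defect_start(2)[of l \<alpha> t i] idx_in[of l \<alpha>] by auto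
  next
    case False
    with Suc show ?thesis by (intro a_zero_step[of k]) auto
  qed
qed simp

lemma V_expand:
  assumes "l < p \<alpha>" "t \<in> \<Theta> \<alpha>" "\<And>i. i \<notin> I \<alpha> \<Longrightarrow> a \<alpha> l i t = 0"
  shows "P' \<alpha> t (axis (coord l) 1) = (\<Sum>i\<in>I \<alpha>. a \<alpha> l i t *\<^sub>R r i (P \<alpha> t))"
proof -
  have "P' \<alpha> t (axis (coord l) 1) = (\<Sum>i\<in>UNIV. a \<alpha> l i t *\<^sub>R r i (P \<alpha> t))"
    using expand[OF path.P_in[OF assms(2)]] by (simp add: a_def)
  also have "\<dots> = (\<Sum>i\<in>I \<alpha>. a \<alpha> l i t *\<^sub>R r i (P \<alpha> t))"
    using assms(3) by (intro sum.mono_neutral_right) auto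
  finally show ?thesis .
qed

lemma h'_split: "h' \<alpha> j x v = f' \<alpha> j (x, u x) (v, 0) + (\<Sum>\<beta>\<in>UNIV. w x v $ \<beta> * f' \<alpha> j (x, u x) (0, axis \<beta> 1))"
proof -
  have "(v, w x v) = (v, 0) + (\<Sum>\<beta>\<in>UNIV. w x v $ \<beta> *\<^sub>R (0, axis \<beta> 1))"
    using basis_expansion[of "w x v"] by (simp add: sum_prod scalar_mult_eq_scaleR)
  then have "h' \<alpha> j x v = f' \<alpha> j (x, u x) ((v, 0) + (\<Sum>\<beta>\<in>UNIV. w x v $ \<beta> *\<^sub>R (0, axis \<beta> 1)))"
    by (simp add: h'_def)
  also have "\<dots> = f' \<alpha> j (x, u x) (v, 0) + (\<Sum>\<beta>\<in>UNIV. w x v $ \<beta> * f' \<alpha> j (x, u x) (0, axis \<beta> 1))"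
    by (simp only: blinfun.add_right blinfun.sum_right blinfun.scaleR_right) simp
  finally show ?thesis .
qed

text \<open>If the derivatives of \<open>u\<close> along the frame were the prescribed
  \<open>f\<close>, the integrability condition would make this expression 0. What remains are two
  sums over components, each of at most \<open>CARD('m)\<close> products of a defect with a partial
  derivative of \<open>f\<close>.\<close>

lemma commutator_bound:
  assumes S: "\<And>\<beta> i x. i \<in> I \<beta> \<Longrightarrow> x \<in> N \<Longrightarrow> \<bar>defect \<beta> i x\<bar> \<le> S" and ij: "i \<in> I \<alpha>" "j \<in> I \<alpha>" and x: "x \<in> N"
  shows "\<bar>h' \<alpha> j x (r i x) - h' \<alpha> i x (r j x) - (\<Sum>q\<in>I \<alpha>. c i j q x * h \<alpha> q x)\<bar> \<le> 2 * real CARD('m) * F1 * S"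
proof (cases "i = j")
  case True
  have "0 \<le> S" using S[OF ij(1) x] abs_ge_zero order_trans by blast
  then show ?thesis
    using True x nonneg by (simp add: c_refl)
next
  case False
  have z: "(x, u x) \<in> N \<times> cball gb \<rho>" using goodD[OF u x] x by auto
  have split: "h' \<alpha> j x (r i x) = f' \<alpha> j (x, u x) (r i x, 0) + (\<Sum>\<beta> | i \<in> I \<beta>. f' \<alpha> j (x, u x) (0, axis \<beta> 1) * f \<beta> i (x, u x))
      + (\<Sum>\<beta> | i \<in> I \<beta>. defect \<beta> i x * f' \<alpha> j (x, u x) (0, axis \<beta> 1))"
    if "i \<in> I \<alpha>" "j \<in> I \<alpha>" "i \<noteq> j" for i j
  proof -
    \<comment> \<open>For \<beta> with \<open>i\<close> not in \<open>I \<beta>\<close> no equation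
      prescribes the derivative of that component along \<open>r i\<close>; \<open>f_indep\<close>
      removes these terms. In the others the derivative is \<open>f\<close> plus a defect.\<close>
    have "(\<Sum>\<beta>\<in>UNIV. w x (r i x) $ \<beta> * f' \<alpha> j (x, u x) (0, axis \<beta> 1)) = (\<Sum>\<beta> | i \<in> I \<beta>. w x (r i x) $ \<beta> * f' \<alpha> j (x, u x) (0, axis \<beta> 1))"
      using f_indep[OF that _ z] by (intro sum.mono_neutral_right) auto
    also have "\<dots> = (\<Sum>\<beta> | i \<in> I \<beta>. f' \<alpha> j (x, u x) (0, axis \<beta> 1) * f \<beta> i (x, u x)) + (\<Sum>\<beta> | i \<in> I \<beta>. defect \<beta> i x * f' \<alpha> j (x, u x) (0, axis \<beta> 1))"
      by (simp add: defect_def h_def algebra_simps flip: sum.distrib)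
    finally show ?thesis by (simp add: h'_split)
  qed
  have bound: "\<bar>\<Sum>\<beta> | i \<in> I \<beta>. defect \<beta> i x * f' \<alpha> j (x, u x) (0, axis \<beta> 1)\<bar> \<le> real CARD('m) * (S * F1)"
    if "i \<in> I \<alpha>" "j \<in> I \<alpha>" for i j
  proof -
    have S0: "0 \<le> S" using S[OF ij(1) x] abs_ge_zero order_trans by blast
    have f1: "norm (f' \<alpha> j (x, u x)) \<le> F1"
      using idx_surj[OF that(2)] F'_bound[OF _ goodD[OF u x]] by blast
    have "\<bar>f' \<alpha> j (x, u x) (0, axis \<beta> 1)\<bar> \<le> F1" for \<beta>
      using norm_blinfun[of "f' \<alpha> j (x, u x)" "(0, axis \<beta> 1)"] f1 by (simp add: norm_Pair norm_axis_1)
    then have "\<bar>\<Sum>\<beta> | i \<in> I \<beta>. defect \<beta> i x * f' \<alpha> j (x, u x) (0, axis \<beta> 1)\<bar> \<le> real (card {\<beta>. i \<in> I \<beta>}) * (S * F1)"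
      using S x S0 by (intro order_trans[OF sum_abs] sum_bounded_above) (auto simp: abs_mult intro!: mult_mono)
    also have "\<dots> \<le> real CARD('m) * (S * F1)"
      using S0 nonneg by (intro mult_right_mono) (auto intro: card_mono)
    finally show ?thesis .
  qed
  have "h' \<alpha> j x (r i x) - h' \<alpha> i x (r j x) - (\<Sum>q\<in>I \<alpha>. c i j q x * h \<alpha> q x)
    = (\<Sum>\<beta> | i \<in> I \<beta>. defect \<beta> i x * f' \<alpha> j (x, u x) (0, axis \<beta> 1)) - (\<Sum>\<beta> | j \<in> I \<beta>. defect \<beta> j x * f' \<alpha> i (x, u x) (0, axis \<beta> 1))"
    using split[OF ij False] split[OF ij(2,1) False[symmetric]] integrability[OF ij False z] by (simp add: h_def)
  also have "\<bar>\<dots>\<bar> \<le> 2 * real CARD('m) * F1 * S"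
    using bound[OF ij] bound[OF ij(2,1)] by (simp add: algebra_simps)
  finally show ?thesis .
qed

lemma a_le: "t \<in> \<Theta> \<alpha> \<Longrightarrow> l < p \<alpha> \<Longrightarrow> \<bar>a \<alpha> l i t\<bar> \<le> 2"
proof -
  assume "t \<in> \<Theta> \<alpha>" "l < p \<alpha>"
  from near_identity[OF this, of i] have "\<bar>a \<alpha> l i t - (if i = idx \<alpha> l then 1 else 0)\<bar> \<le> 1 / (2 * real CARD('n))"
    by (simp add: a_def)
  also have "\<dots> \<le> 1"
  proof -
    have "1 \<le> real CARD('n)" by (simp add: Suc_le_eq)
    then have "1 \<le> 2 * real CARD('n)" by linarith
    then show ?thesis by (simp only: divide_le_eq_1) simp
  qed
  finally show ?thesis by (auto split: if_splits)
qed

text \<open>Along leg \<open>k\<close> three contributions meet: the derivative of the leg's own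
  right-hand side in the direction of the \<open>l\<close>-th partial of \<open>P\<close>, the
  derivatives of the other right-hand sides along the leg, and the transport of \<open>a\<close>.
  Expanding the partial of \<open>P\<close> in the fields of \<open>I \<alpha>\<close> collects them
  into \<open>a\<close> times the expressions of \<open>commutator_bound\<close>.\<close>

lemma E_step:
  assumes S: "\<And>\<beta> i x. i \<in> I \<beta> \<Longrightarrow> x \<in> N \<Longrightarrow> \<bar>defect \<beta> i x\<bar> \<le> S"
    and k: "k < p \<alpha>" and l: "l < k" and t: "t \<in> \<Theta> \<alpha>"
  shows "\<bar>E \<alpha> l (vertex (p \<alpha>) (Suc k) t) - E \<alpha> l (vertex (p \<alpha>) k t)\<bar> \<le>
    \<delta> * (real CARD('n) * (2 * (2 * real CARD('m) * F1 * S)))"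
proof -
  have iI: "\<exists>i. i \<in> I \<alpha>" using idx_in k by blast
  let ?s = "\<lambda>\<sigma>. path_pt (p \<alpha>) k \<sigma> t" and ?j = "idx \<alpha> k"
  define E' where "E' \<sigma> = t $ coord k * (\<Sum>i\<in>I \<alpha>. a \<alpha> l i (?s \<sigma>) *
    (h' \<alpha> ?j (P \<alpha> (?s \<sigma>)) (r i (P \<alpha> (?s \<sigma>))) - h' \<alpha> i (P \<alpha> (?s \<sigma>)) (r ?j (P \<alpha> (?s \<sigma>)))
      - (\<Sum>q\<in>I \<alpha>. c i ?j q (P \<alpha> (?s \<sigma>)) * h \<alpha> q (P \<alpha> (?s \<sigma>)))))" for \<sigma>
  \<comment> \<open>\<open>a_zero\<close> is stated at vertices, but an intermediate point of leg
    \<open>k\<close> is its own vertex \<open>k + 1\<close>.\<close>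
  have az: "a \<alpha> l i (?s \<sigma>) = 0" if "i \<notin> I \<alpha>" "\<sigma> \<in> {0..1}" for i \<sigma>
    using a_zero[of l "Suc k" \<alpha> "?s \<sigma>" i] seg_in[OF k l t that(2)] that k l path.p_le[of \<alpha>] by simp
  have "norm (E \<alpha> l (?s 1) - E \<alpha> l (?s 0)) \<le> (\<delta> * (real CARD('n) * (2 * (2 * real CARD('m) * F1 * S)))) * \<bar>1 - 0\<bar>"
  proof (rule vector_deriv_bound[where a = 0 and b = 1 and \<phi> = "\<lambda>\<sigma>. E \<alpha> l (?s \<sigma>)" and \<phi>' = E'])
    fix \<sigma> :: real assume "\<sigma> \<in> closed_segment 0 1"
    then have \<sigma>: "\<sigma> \<in> {0..1}" by (simp add: closed_segment_eq_real_ivl)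
    have s: "?s \<sigma> \<in> \<Theta> \<alpha>" using seg_in[OF k l t \<sigma>] .
    let ?x = "P \<alpha> (?s \<sigma>)"
    have x: "?x \<in> N" using path.P_in s by auto
    let ?V = "P' \<alpha> (?s \<sigma>) (axis (coord l) 1)"
    have V: "?V = (\<Sum>i\<in>I \<alpha>. a \<alpha> l i (?s \<sigma>) *\<^sub>R r i ?x)"
      using az k l s \<sigma> by (intro V_expand) auto
    have Y: "((\<lambda>\<sigma>. U' \<alpha> (?s \<sigma>) (axis (coord l) 1)) has_real_derivative t $ coord k * h' \<alpha> ?j ?x ?V) (at \<sigma> within {0..1})"
      using path.transport_less[OF k U_deriv U_step[OF k] h_deriv h'_cont t l \<sigma>] idx_in[OF k]
      by (simp add: has_real_derivative_iff_has_vector_derivative)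
    have "((\<lambda>\<sigma>. h \<alpha> i (P \<alpha> (?s \<sigma>)) * a \<alpha> l i (?s \<sigma>)) has_real_derivative
        h \<alpha> i ?x * (t $ coord k * (\<Sum>q\<in>UNIV. a \<alpha> l q (?s \<sigma>) * c q ?j i ?x)) + t $ coord k * h' \<alpha> i ?x (r ?j ?x) * a \<alpha> l i (?s \<sigma>))
        (at \<sigma> within {0..1})" if "i \<in> I \<alpha>" for i
      using DERIV_mult[OF seg_deriv[OF k l t \<sigma> h_deriv[OF x that], folded has_real_derivative_iff_has_vector_derivative] a_deriv[OF k l t \<sigma>, of i]]
      by (simp add: algebra_simps)
    then have "((\<lambda>\<sigma>. U' \<alpha> (?s \<sigma>) (axis (coord l) 1) - (\<Sum>i\<in>I \<alpha>. h \<alpha> i (P \<alpha> (?s \<sigma>)) * a \<alpha> l i (?s \<sigma>))) has_real_derivative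
        t $ coord k * h' \<alpha> ?j ?x ?V - (\<Sum>i\<in>I \<alpha>. h \<alpha> i ?x * (t $ coord k * (\<Sum>q\<in>UNIV. a \<alpha> l q (?s \<sigma>) * c q ?j i ?x))
          + t $ coord k * h' \<alpha> i ?x (r ?j ?x) * a \<alpha> l i (?s \<sigma>))) (at \<sigma> within {0..1})"
      by (intro DERIV_diff Y DERIV_sum)
    also have "t $ coord k * h' \<alpha> ?j ?x ?V - (\<Sum>i\<in>I \<alpha>. h \<alpha> i ?x * (t $ coord k * (\<Sum>q\<in>UNIV. a \<alpha> l q (?s \<sigma>) * c q ?j i ?x))
          + t $ coord k * h' \<alpha> i ?x (r ?j ?x) * a \<alpha> l i (?s \<sigma>)) = E' \<sigma>"
    proof -
      \<comment> \<open>The sum shrinks to \<open>I \<alpha>\<close>, and exchanging the two sums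
        brings the structure coefficients into the form of the integrability condition.\<close>
      have "(\<Sum>q\<in>UNIV. a \<alpha> l q (?s \<sigma>) * c q ?j i ?x) = (\<Sum>q\<in>I \<alpha>. a \<alpha> l q (?s \<sigma>) * c q ?j i ?x)" for i
        using az \<sigma> by (intro sum.mono_neutral_right) auto
      then have "(\<Sum>i\<in>I \<alpha>. h \<alpha> i ?x * (\<Sum>q\<in>UNIV. a \<alpha> l q (?s \<sigma>) * c q ?j i ?x)) =
          (\<Sum>i\<in>I \<alpha>. \<Sum>q\<in>I \<alpha>. a \<alpha> l q (?s \<sigma>) * (c q ?j i ?x * h \<alpha> i ?x))"
        by (simp add: sum_distrib_left algebra_simps)
      also have "\<dots> = (\<Sum>q\<in>I \<alpha>. a \<alpha> l q (?s \<sigma>) * (\<Sum>i\<in>I \<alpha>. c q ?j i ?x * h \<alpha> i ?x))"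
        by (subst sum.swap) (simp add: sum_distrib_left)
      finally have 1: "(\<Sum>i\<in>I \<alpha>. h \<alpha> i ?x * (\<Sum>q\<in>UNIV. a \<alpha> l q (?s \<sigma>) * c q ?j i ?x)) =
        (\<Sum>q\<in>I \<alpha>. a \<alpha> l q (?s \<sigma>) * (\<Sum>i\<in>I \<alpha>. c q ?j i ?x * h \<alpha> i ?x))" .
      have 2: "h' \<alpha> ?j ?x ?V = (\<Sum>i\<in>I \<alpha>. a \<alpha> l i (?s \<sigma>) * h' \<alpha> ?j ?x (r i ?x))"
        by (simp only: V blinfun.sum_right blinfun.scaleR_right) simp
      have "(\<Sum>i\<in>I \<alpha>. h \<alpha> i ?x * (t $ coord k * (\<Sum>q\<in>UNIV. a \<alpha> l q (?s \<sigma>) * c q ?j i ?x))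
          + t $ coord k * h' \<alpha> i ?x (r ?j ?x) * a \<alpha> l i (?s \<sigma>)) =
        t $ coord k * ((\<Sum>i\<in>I \<alpha>. h \<alpha> i ?x * (\<Sum>q\<in>UNIV. a \<alpha> l q (?s \<sigma>) * c q ?j i ?x)) + (\<Sum>i\<in>I \<alpha>. a \<alpha> l i (?s \<sigma>) * h' \<alpha> i ?x (r ?j ?x)))"
        by (simp only: sum_distrib_left sum.distrib distrib_left) (simp add: algebra_simps)
      then show ?thesis
        unfolding 1 2 E'_def by (simp only: right_diff_distrib sum_subtractf distrib_left diff_diff_eq) (simp add: algebra_simps sum.distrib)
    qed
    finally show "((\<lambda>\<sigma>. E \<alpha> l (?s \<sigma>)) has_vector_derivative E' \<sigma>) (at \<sigma> within closed_segment 0 1)"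
      by (simp add: E_def U'_apply has_real_derivative_iff_has_vector_derivative closed_segment_eq_real_ivl)
    have S0: "0 \<le> S" using iI S[OF _ x] abs_ge_zero order_trans by blast
    have "\<bar>\<Sum>i\<in>I \<alpha>. a \<alpha> l i (?s \<sigma>) *
      (h' \<alpha> ?j ?x (r i ?x) - h' \<alpha> i ?x (r ?j ?x) - (\<Sum>q\<in>I \<alpha>. c i ?j q ?x * h \<alpha> q ?x))\<bar>
      \<le> real (card (I \<alpha>)) * (2 * (2 * real CARD('m) * F1 * S))"
      unfolding abs_mult[of "a \<alpha> l _ _"]
      using a_le[OF s, of l] k l commutator_bound[OF S _ idx_in[OF k] x] nonneg S0
      by (intro order_trans[OF sum_abs] sum_bounded_above, unfold abs_mult[of "a \<alpha> l _ _"], intro mult_mono) auto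
    also have "\<dots> \<le> real CARD('n) * (2 * (2 * real CARD('m) * F1 * S))"
      using nonneg S0 by (intro mult_right_mono) (auto intro: card_mono)
    finally show "norm (E' \<sigma>) \<le> \<delta> * (real CARD('n) * (2 * (2 * real CARD('m) * F1 * S)))"
      unfolding E'_def real_norm_def abs_mult
      using \<delta>_bound[OF t k] nonneg by (intro mult_mono) auto
  qed (simp add: closed_segment_eq_real_ivl)
  then show ?thesis by simp
qed

lemma E_bound:
  assumes S: "\<And>\<beta> i x. i \<in> I \<beta> \<Longrightarrow> x \<in> N \<Longrightarrow> \<bar>defect \<beta> i x\<bar> \<le> S"
    and "l < k" "k \<le> p \<alpha>" "t \<in> \<Theta> \<alpha>"
  shows "\<bar>E \<alpha> l (vertex (p \<alpha>) k t)\<bar> \<le> real k * (\<delta> * (real CARD('n) * (2 * (2 * real CARD('m) * F1 * S))))"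
  using assms(2-)
proof (induction k)
  case (Suc k)
  have x: "P \<alpha> t \<in> N" using path.P_in Suc by auto
  have "0 \<le> S" using S[OF idx_in[of k \<alpha>] x] Suc abs_ge_zero[of "defect \<alpha> (idx \<alpha> k) (P \<alpha> t)"] by auto
  then have e: "0 \<le> \<delta> * (real CARD('n) * (2 * (2 * real CARD('m) * F1 * S)))"
    using nonneg by auto
  show ?case
  proof (cases "l = k")
    case True
    then show ?thesis
      using defect_start(3)[of l \<alpha> t] Suc e by simp
  next
    case False
    then have "\<bar>E \<alpha> l (vertex (p \<alpha>) (Suc k) t) - E \<alpha> l (vertex (p \<alpha>) k t)\<bar> \<le>
        \<delta> * (real CARD('n) * (2 * (2 * real CARD('m) * F1 * S)))"
      using Suc by (intro E_step[OF S]) auto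
    moreover have "\<bar>E \<alpha> l (vertex (p \<alpha>) k t)\<bar> \<le> real k * (\<delta> * (real CARD('n) * (2 * (2 * real CARD('m) * F1 * S))))"
      using Suc False by auto
    ultimately show ?thesis unfolding of_nat_Suc distrib_right mult_1 by linarith
  qed
qed simp

text \<open>Since \<open>a\<close> is close to the identity, its row for the index \<open>i\<close>
  expresses the defect for \<open>i\<close> by \<open>E\<close> and a small multiple of the other
  defects: \<open>1 / 4\<close> from the accumulated legs, \<open>1 / 2\<close> from the deviation
  of \<open>a\<close>.\<close>

lemma defect_contraction:
  assumes S: "\<And>\<beta> i x. i \<in> I \<beta> \<Longrightarrow> x \<in> N \<Longrightarrow> \<bar>defect \<beta> i x\<bar> \<le> S" and i: "i \<in> I \<alpha>" and x: "x \<in> N"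
  shows "\<bar>defect \<alpha> i x\<bar> \<le> 3 / 4 * S"
proof -
  obtain l where l: "l < p \<alpha>" "idx \<alpha> l = i" using idx_surj[OF i] by blast
  let ?t = "Q \<alpha> x"
  have t: "?t \<in> \<Theta> \<alpha>" and Px: "P \<alpha> ?t = x" using x by (auto simp: path.Q_in path.PQ)
  have S0: "0 \<le> S" using S[OF i x] by linarith
  have az: "a \<alpha> l q ?t = 0" if "q \<notin> I \<alpha>" for q
    using a_zero[of l "p \<alpha>" \<alpha> ?t q] that l t by simp
  let ?e = "\<lambda>q. if q = i then 1 else 0 :: real"
  have near: "\<bar>a \<alpha> l q ?t - ?e q\<bar> \<le> 1 / (2 * real CARD('n))" for q
    using near_identity[OF t l(1), of q] l(2) by (simp add: a_def)
  have "E \<alpha> l ?t = (\<Sum>q\<in>I \<alpha>. a \<alpha> l q ?t * defect \<alpha> q x)"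
    using V_expand[OF l(1) t az] unfolding E_def
    by (simp add: Px defect_def blinfun.sum_right blinfun.scaleR_right algebra_simps sum_subtractf)
  also have "\<dots> = (\<Sum>q\<in>I \<alpha>. (a \<alpha> l q ?t - ?e q) * defect \<alpha> q x) + (\<Sum>q\<in>I \<alpha>. ?e q * defect \<alpha> q x)"
    by (simp add: left_diff_distrib sum_subtractf)
  also have "(\<Sum>q\<in>I \<alpha>. ?e q * defect \<alpha> q x) = defect \<alpha> i x"
    using i by (simp add: if_distrib[of "\<lambda>e. e * _"] cong: if_cong)
  finally have "defect \<alpha> i x = E \<alpha> l ?t - (\<Sum>q\<in>I \<alpha>. (a \<alpha> l q ?t - ?e q) * defect \<alpha> q x)" by simp
  moreover have "\<bar>E \<alpha> l ?t\<bar> \<le> 1 / 4 * S"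
  proof -
    have "\<bar>E \<alpha> l ?t\<bar> \<le> real (p \<alpha>) * (\<delta> * (real CARD('n) * (2 * (2 * real CARD('m) * F1 * S))))"
      using E_bound[OF S l(1) order_refl t] by simp
    also have "\<dots> \<le> real CARD('n) * (\<delta> * (real CARD('n) * (2 * (2 * real CARD('m) * F1 * S))))"
      using path.p_le[of \<alpha>] nonneg S0 by (intro mult_right_mono) auto
    also have "\<dots> = (real CARD('n) * (\<delta> * (real CARD('n) * (2 * (2 * real CARD('m) * F1))))) * S" by simp
    also have "\<dots> \<le> 1 / 4 * S" using small_defect S0 by (rule mult_right_mono)
    finally show ?thesis .
  qed
  moreover have "\<bar>\<Sum>q\<in>I \<alpha>. (a \<alpha> l q ?t - ?e q) * defect \<alpha> q x\<bar> \<le> 1 / 2 * S"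
  proof -
    have "\<bar>\<Sum>q\<in>I \<alpha>. (a \<alpha> l q ?t - ?e q) * defect \<alpha> q x\<bar> \<le> real (card (I \<alpha>)) * (1 / (2 * real CARD('n)) * S)"
      using near S[OF _ x] S0
      by (intro order_trans[OF sum_abs] sum_bounded_above, unfold abs_mult, intro mult_mono) auto
    also have "\<dots> \<le> real CARD('n) * (1 / (2 * real CARD('n)) * S)"
      using S0 by (intro mult_right_mono) (auto intro: card_mono)
    finally show ?thesis by simp
  qed
  ultimately show ?thesis by linarith
qed

text \<open>The contraction is iterated from the a priori bound \<open>W0 * CR + F0\<close>, which
  uses the bound on the derivative of the fixed point.\<close>

lemma defect_zero:
  assumes "i \<in> I \<alpha>" "x \<in> N"
  shows "w x (r i x) $ \<alpha> = f \<alpha> i (x, u x)"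
proof -
  let ?S = "W0 * CR + F0"
  have *: "\<bar>defect \<beta> i x\<bar> \<le> (3 / 4) ^ j * ?S" if "i \<in> I \<beta>" "x \<in> N" for j \<beta> i x
    using that
  proof (induction j arbitrary: \<beta> i x)
    case 0
    have "\<bar>w x (r i x) $ \<beta>\<bar> \<le> norm (w x (r i x))" by (rule component_le_norm_cart)
    also have "\<dots> \<le> norm (w x) * norm (r i x)" by (rule norm_blinfun)
    also have "\<dots> \<le> W0 * CR" using wb 0 r_bound W0_ge by (intro mult_mono) auto
    finally have "\<bar>w x (r i x) $ \<beta>\<bar> \<le> W0 * CR" .
    moreover have "\<bar>h \<beta> i x\<bar> \<le> F0"
      using F_bound[OF _ goodD[OF u 0(2)]] idx_surj[OF 0(1)] unfolding h_def by blast
    ultimately show ?case by (simp add: defect_def)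
  next
    case (Suc j)
    from defect_contraction[OF Suc.IH Suc.prems] show ?case by simp
  qed
  have "(\<lambda>j. (3 / 4) ^ j * ?S) \<longlonglongrightarrow> 0"
    by (intro tendsto_mult_left_zero LIMSEQ_realpow_zero) auto
  then have "\<bar>defect \<alpha> i x\<bar> \<le> 0"
    by (rule tendsto_lowerbound) (use * assms in auto)
  then show ?thesis by (simp add: defect_def h_def)
qed

end

theorem solution_exists:
  obtains u w where "good u" "\<And>x. x \<in> N \<Longrightarrow> (u has_derivative blinfun_apply (w x)) (at x)" "continuous_on N w"
    "\<And>\<alpha> i x. i \<in> I \<alpha> \<Longrightarrow> x \<in> N \<Longrightarrow> w x (r i x) $ \<alpha> = f \<alpha> i (x, u x)"
    "\<And>\<alpha> t. t \<in> \<Theta> \<alpha> \<Longrightarrow> u (P \<alpha> (vertex (p \<alpha>) 0 t)) $ \<alpha> = G \<alpha> t"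
proof -
  obtain u w where u: "good u" "\<And>x. x \<in> N \<Longrightarrow> (u has_derivative blinfun_apply (w x)) (at x)"
    "continuous_on N w" "\<And>x. x \<in> N \<Longrightarrow> norm (w x) \<le> W0" "\<And>x. x \<in> N \<Longrightarrow> phi u x = u x"
    using fixed_point by blast
  have "u (P \<alpha> (vertex (p \<alpha>) 0 t)) $ \<alpha> = G \<alpha> t" if t: "t \<in> \<Theta> \<alpha>" for \<alpha> t
  proof -
    \<comment> \<open>At vertex 0 all flow times vanish, so the integrals drop out and the fixed
      point equation leaves only the data.\<close>
    have "(\<Sum>k<p \<alpha>. path.step \<alpha> k (h u \<alpha> (idx \<alpha> k)) (vertex (p \<alpha>) 0 t)) = 0"
      by (intro sum.neutral) (auto simp: step_vertex)
    then show ?thesis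
      using U_eq[OF u path.vertex_in[OF t], of 0] t by (simp add: U_def[OF u] G_vertex)
  qed
  then show thesis
    using that[OF u(1-3) defect_zero[OF u]] by blast
qed

end

section \<open>Flows and the parametrization psi\<close>

lemma C1_locally_Lipschitz:
  fixes X :: "'a::real_normed_vector \<Rightarrow> 'b::real_normed_vector"
  assumes "C1_on \<Omega> X" "open \<Omega>" "z \<in> \<Omega>"
  obtains L r where "L \<ge> 0" "r > 0" "ball z r \<subseteq> \<Omega>"
    "\<And>x y. x \<in> ball z r \<Longrightarrow> y \<in> ball z r \<Longrightarrow> norm (X x - X y) \<le> L * norm (x - y)"
proof -
  obtain X' :: "'a \<Rightarrow> 'a \<Rightarrow>\<^sub>L 'b" where X': "\<And>x. x \<in> \<Omega> \<Longrightarrow> (X has_derivative X' x) (at x)" "continuous_on \<Omega> X'"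
    using assms(1) C1_on_open_iff[OF assms(2), of X] by blast
  have "isCont X' z" using X'(2) assms continuous_on_eq_continuous_at by blast
  then have "\<forall>\<^sub>F x in nhds z. dist (X' x) (X' z) < 1"
    unfolding isCont_def tendsto_at_iff_tendsto_nhds by (rule tendstoD) simp
  moreover have "\<forall>\<^sub>F x in nhds z. x \<in> \<Omega>" using assms by (simp add: eventually_nhds_in_open)
  ultimately have "\<forall>\<^sub>F x in nhds z. x \<in> \<Omega> \<and> dist (X' x) (X' z) < 1" by eventually_elim simp
  then obtain r where r: "r > 0" "\<And>x. dist x z < r \<Longrightarrow> x \<in> \<Omega> \<and> dist (X' x) (X' z) < 1"
    unfolding eventually_nhds_metric by blast
  have "norm (X x - X y) \<le> (norm (X' z) + 1) * norm (x - y)" if "x \<in> ball z r" "y \<in> ball z r" for x y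
  proof (rule differentiable_bound[OF convex_ball[of z r] _ _ that])
    fix x assume x: "x \<in> ball z r"
    then have *: "x \<in> \<Omega>" "dist (X' x) (X' z) < 1" using r(2)[of x] by (auto simp: dist_commute)
    show "(X has_derivative X' x) (at x within ball z r)"
      by (rule has_derivative_at_withinI[OF X'(1)[OF *(1)]])
    show "onorm (X' x) \<le> norm (X' z) + 1"
      using *(2) norm_triangle_ineq2[of "X' x" "X' z"] unfolding norm_blinfun.rep_eq[symmetric] dist_norm by linarith
  qed
  with r show thesis
    by (intro that[of "norm (X' z) + 1" r]) (auto simp: dist_commute)
qed

definition integral_curve :: "(real ^ 'n::finite) set \<Rightarrow> (real ^ 'n \<Rightarrow> real ^ 'n) \<Rightarrow> real \<Rightarrow> (real \<Rightarrow> real ^ 'n) \<Rightarrow> bool" where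
  "integral_curve \<Omega> X t \<gamma> \<longleftrightarrow> (\<forall>s\<in>closed_segment 0 t. \<gamma> s \<in> \<Omega> \<and>
     (\<gamma> has_vector_derivative X (\<gamma> s)) (at s within closed_segment 0 t))"

text \<open>The set where the curves agree is closed, contains 0, and is open because the local
  Lipschitz bound and \<open>vanishing\<close> apply near each of its points; the segment is
  connected.\<close>

lemma integral_curve_unique:
  assumes X: "C1_on \<Omega> X" "open \<Omega>" and \<gamma>: "integral_curve \<Omega> X t \<gamma>1" "integral_curve \<Omega> X t \<gamma>2" "\<gamma>1 0 = \<gamma>2 0"
    and s: "s \<in> closed_segment 0 t"
  shows "\<gamma>1 s = \<gamma>2 s"
proof -
  let ?S = "closed_segment 0 t"
  have cont: "continuous_on ?S \<gamma>1" "continuous_on ?S \<gamma>2"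
    using \<gamma>(1,2) unfolding integral_curve_def
    by (meson continuous_on_eq_continuous_within has_vector_derivative_continuous)+
  let ?Z = "{s \<in> ?S. \<gamma>1 s - \<gamma>2 s = 0}"
  have "closedin (top_of_set ?S) ?Z"
    by (rule continuous_closedin_preimage_constant) (intro continuous_intros cont)
  moreover have "openin (top_of_set ?S) ?Z"
    unfolding openin_contains_ball
  proof (intro conjI ballI)
    fix s0 assume s0: "s0 \<in> ?Z"
    then have "\<gamma>1 s0 \<in> \<Omega>" and eq: "\<gamma>2 s0 = \<gamma>1 s0" using \<gamma>(1) by (auto simp: integral_curve_def)
    then obtain L r where L: "L \<ge> 0" "r > 0" "ball (\<gamma>1 s0) r \<subseteq> \<Omega>"
      "\<And>x y. x \<in> ball (\<gamma>1 s0) r \<Longrightarrow> y \<in> ball (\<gamma>1 s0) r \<Longrightarrow> norm (X x - X y) \<le> L * norm (x - y)"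
      using C1_locally_Lipschitz[OF X] by metis
    obtain d1 where d1: "d1 > 0" "\<And>s. s \<in> ?S \<Longrightarrow> dist s s0 < d1 \<Longrightarrow> dist (\<gamma>1 s) (\<gamma>1 s0) < r"
      using cont(1) s0 L(2) unfolding continuous_on_iff by blast
    obtain d2 where d2: "d2 > 0" "\<And>s. s \<in> ?S \<Longrightarrow> dist s s0 < d2 \<Longrightarrow> dist (\<gamma>2 s) (\<gamma>2 s0) < r"
      using cont(2) s0 L(2) unfolding continuous_on_iff by blast
    \<comment> \<open>\<open>1 / (L + 1)\<close> makes \<open>L\<close> times the length of the
      segment less than 1; \<open>d1\<close> and \<open>d2\<close> keep both curves in the ball with
      Lipschitz constant \<open>L\<close>.\<close>
    define d where "d = Min {d1, d2, 1 / (L + 1)}"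
    have d: "d > 0" "d \<le> d1" "d \<le> d2" "d \<le> 1 / (L + 1)" using d1 d2 L(1) by (auto simp: d_def)
    have "\<gamma>1 s - \<gamma>2 s = 0" if s: "s \<in> ?S" "dist s s0 < d" for s
    proof -
      have sub: "closed_segment s0 s \<subseteq> ?S"
        using s s0 by (simp add: closed_segment_subset)
      have near: "dist z s0 < d" if "z \<in> closed_segment s0 s" for z
        using that s(2) by (auto simp: closed_segment_eq_real_ivl dist_real_def split: if_splits)
      show ?thesis
      proof (rule vanishing[where a = s0 and b = s and \<phi> = "\<lambda>s. \<gamma>1 s - \<gamma>2 s" and \<phi>' = "\<lambda>s. X (\<gamma>1 s) - X (\<gamma>2 s)" and \<kappa> = L])
        fix z assume z: "z \<in> closed_segment s0 s"
        then have zS: "z \<in> ?S" using sub by auto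
        show "((\<lambda>s. \<gamma>1 s - \<gamma>2 s) has_vector_derivative X (\<gamma>1 z) - X (\<gamma>2 z)) (at z within closed_segment s0 s)"
          using \<gamma> zS by (intro has_vector_derivative_diff; auto simp: integral_curve_def intro: has_vector_derivative_within_subset[OF _ sub])
        show "norm (X (\<gamma>1 z) - X (\<gamma>2 z)) \<le> L * norm (\<gamma>1 z - \<gamma>2 z)"
          using d1(2)[OF zS] d2(2)[OF zS] near[OF z] d eq by (intro L(4)) (auto simp: dist_commute)
      next
        have "L * \<bar>s - s0\<bar> \<le> L * (1 / (L + 1))"
          using s(2) d L(1) by (intro mult_left_mono) (auto simp: dist_real_def)
        also have "\<dots> < 1" using L(1) by (simp add: field_simps)
        finally show "L * \<bar>s - s0\<bar> < 1" .
      qed (use L s0 in auto)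
    qed
    with d(1) show "\<exists>e>0. ball s0 e \<inter> ?S \<subseteq> ?Z"
      by (intro exI[of _ d]) (auto simp: dist_commute)
  qed auto
  moreover have "0 \<in> ?Z" using \<gamma>(3) by auto
  ultimately have "?Z = ?S"
    using connected_segment(1)[of 0 t] unfolding connected_clopen by blast
  with s show ?thesis by (metis (mono_tags, lifting) eq_iff_diff_eq_0 mem_Collect_eq)
qed

lemma integral_curve_sub:
  "integral_curve \<Omega> X T \<gamma> \<Longrightarrow> s \<in> closed_segment 0 T \<Longrightarrow> integral_curve \<Omega> X s \<gamma>"
proof -
  assume \<gamma>: "integral_curve \<Omega> X T \<gamma>" and s: "s \<in> closed_segment 0 T"
  have sub: "closed_segment 0 s \<subseteq> closed_segment 0 T"
    using s by (simp add: closed_segment_subset)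
  show ?thesis
    unfolding integral_curve_def
  proof (intro ballI conjI)
    fix z assume "z \<in> closed_segment 0 s"
    then have "z \<in> closed_segment 0 T" using sub by blast
    with \<gamma> have "\<gamma> z \<in> \<Omega>" "(\<gamma> has_vector_derivative X (\<gamma> z)) (at z within closed_segment 0 T)"
      by (auto simp: integral_curve_def)
    then show "\<gamma> z \<in> \<Omega>" "(\<gamma> has_vector_derivative X (\<gamma> z)) (at z within closed_segment 0 s)"
      using has_vector_derivative_within_subset[OF _ sub] by blast+
  qed
qed

lemma flows_to_iff: "flows_to \<Omega> X t x y \<longleftrightarrow> (\<exists>\<gamma>. \<gamma> 0 = x \<and> \<gamma> t = y \<and> integral_curve \<Omega> X t \<gamma>)"
  by (simp add: flows_to_def integral_curve_def)

lemma flow_eq: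
  assumes X: "C1_on \<Omega> X" "open \<Omega>" and \<gamma>: "integral_curve \<Omega> X T \<gamma>" "s \<in> closed_segment 0 T"
  shows "flow \<Omega> X s (\<gamma> 0) = \<gamma> s"
  unfolding flow_def
proof (rule the_equality)
  have \<gamma>': "integral_curve \<Omega> X s \<gamma>" using integral_curve_sub[OF \<gamma>] .
  then show "flows_to \<Omega> X s (\<gamma> 0) (\<gamma> s)" unfolding flows_to_iff by blast
  fix y assume "flows_to \<Omega> X s (\<gamma> 0) y"
  then obtain \<gamma>2 where "\<gamma>2 0 = \<gamma> 0" "\<gamma>2 s = y" "integral_curve \<Omega> X s \<gamma>2" unfolding flows_to_iff by blast
  then show "y = \<gamma> s" using integral_curve_unique[OF X _ \<gamma>', of \<gamma>2 s] by auto
qed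

lemma flow_chain_cong:
  "(\<And>j. j < k \<Longrightarrow> t $ coord j = t' $ coord j) \<Longrightarrow> flow_chain \<Omega> r J t x k = flow_chain \<Omega> r J t' x k"
  by (induction k) auto

section \<open>The partial derivatives of psi\<close>

context
  fixes \<Omega> :: "(real^'n::{finite,linorder}) set" and r :: "'n \<Rightarrow> real^'n::_ \<Rightarrow> real^'n::_" and J :: "'n set"
    and U \<xi> \<Theta>
  assumes \<Omega>: "open \<Omega>" and r: "\<And>i. C1_on \<Omega> (r i)" and dom: "psi_domain \<Omega> r J U \<xi> \<Theta>"
begin

text \<open>Flowing for time 0 is the identity only where the flow exists, as \<open>flow\<close> is
  a definite description. The curves guaranteed by \<open>psi_domain\<close> are therefore used
  before each trailing flow is dropped.\<close>

lemma psi_tail: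
  assumes t: "t \<in> \<Theta>" and m: "m \<le> card J" "\<And>j. m \<le> j \<Longrightarrow> j < card J \<Longrightarrow> t $ coord j = 0"
  shows "psi \<Omega> r J \<xi> t = flow_chain \<Omega> r J t (\<xi> (vertex (card J) 0 t)) m"
proof -
  let ?x = "\<xi> (vertex (card J) 0 t)"
  have "flow_chain \<Omega> r J t ?x j = flow_chain \<Omega> r J t ?x m" if "m \<le> j" "j \<le> card J" for j
    using that
  proof (induction j rule: dec_induct)
    case (step j)
    obtain y where "flows_to \<Omega> (r (sorted_list_of_set J ! j)) (t $ coord j) (flow_chain \<Omega> r J t ?x j) y"
      using dom t step unfolding psi_domain_def psi_defined_def by (meson Suc_le_lessD)
    then obtain \<gamma> where \<gamma>: "\<gamma> 0 = flow_chain \<Omega> r J t ?x j"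
      "integral_curve \<Omega> (r (sorted_list_of_set J ! j)) (t $ coord j) \<gamma>"
      unfolding flows_to_iff by blast
    have "flow \<Omega> (r (sorted_list_of_set J ! j)) 0 (\<gamma> 0) = \<gamma> 0"
      by (rule flow_eq[OF r \<Omega> \<gamma>(2)]) simp
    then show ?case using step \<gamma>(1) m(2)[of j] by simp
  qed simp
  from this[OF m(1) order_refl] show ?thesis by (simp add: psi_def)
qed

lemma psi_slice: "vertex (card J) 0 t \<in> \<Theta> \<Longrightarrow> psi \<Omega> r J \<xi> (vertex (card J) 0 t) = \<xi> (vertex (card J) 0 t)"
proof -
  assume "vertex (card J) 0 t \<in> \<Theta>"
  moreover have "vertex (card J) 0 (vertex (card J) 0 t) = vertex (card J) 0 t"
    by (simp add: vec_eq_iff)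
  ultimately show ?thesis
    using psi_tail[of "vertex (card J) 0 t" 0] by simp
qed

text \<open>By \<open>v\<close> the times after the \<open>k\<close>-th are 0, so psi is the
  \<open>k\<close>-th flow applied to a point that does not depend on the \<open>k\<close>-th time;
  varying that time moves along an integral curve.\<close>

lemma psi_axis:
  assumes k: "k < card J" and t: "t \<in> \<Theta>" and v: "vertex (card J) (Suc k) t = t"
    and D: "(psi \<Omega> r J \<xi> has_derivative blinfun_apply P') (at t)"
  shows "P' (axis (coord k) 1) = r (sorted_list_of_set J ! k) (psi \<Omega> r J \<xi> t)"
proof -
  have pn: "card J \<le> CARD('n)" by (rule card_mono) auto
  let ?X = "r (sorted_list_of_set J ! k)" and ?c = "flow_chain \<Omega> r J t (\<xi> (vertex (card J) 0 t)) k"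
  let ?t = "\<lambda>s. t + (s - t $ coord k) *\<^sub>R axis (coord k) 1"
  have zero: "t $ coord j = 0" if "Suc k \<le> j" "j < card J" for j
    using arg_cong[OF v, of "\<lambda>t. t $ coord j"] that by (auto split: if_splits)
  have nth: "?t s $ coord j = (if j = k then s else t $ coord j)" if "j < card J" for s j
    using that k pn by (auto simp: axis_def coord_eq_iff)
  have v0: "vertex (card J) 0 (?t s) = vertex (card J) 0 t" for s
    using k by (auto simp: vec_eq_iff axis_def)
  have chain: "flow_chain \<Omega> r J (?t s) (\<xi> (vertex (card J) 0 (?t s))) k = ?c" for s
    unfolding v0 using k by (intro flow_chain_cong) (simp add: nth del: vector_add_component vector_scaleR_component)
  have psi: "psi \<Omega> r J \<xi> (?t s) = flow \<Omega> ?X s ?c" if "?t s \<in> \<Theta>" for s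
  proof -
    have "psi \<Omega> r J \<xi> (?t s) = flow_chain \<Omega> r J (?t s) (\<xi> (vertex (card J) 0 (?t s))) (Suc k)"
      using k zero by (intro psi_tail that) (auto simp: nth simp del: vector_add_component vector_scaleR_component)
    then show ?thesis using chain[of s] nth[OF k, of s] by (simp del: vector_add_component vector_scaleR_component)
  qed
  obtain d where d: "d > 0" "ball t d \<subseteq> \<Theta>"
    using dom t open_contains_ball unfolding psi_domain_def by blast
  have in': "?t s \<in> \<Theta>" if "dist s (t $ coord k) < d" for s
    using that d(2) by (intro subsetD[OF d(2)]) (auto simp: dist_norm norm_axis_1)
  \<comment> \<open>\<open>T\<close> lies beyond \<open>t $ coord k\<close> as seen from 0. One
    integral curve up to \<open>T\<close> then covers this time, and the segment is nondegenerate
    even if it is 0, so that derivatives within it are unique.\<close>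
  define T where "T = (if t $ coord k \<ge> 0 then t $ coord k + d / 2 else t $ coord k - d / 2)"
  let ?S = "closed_segment 0 T"
  have "?t T \<in> \<Theta>" using d(1) by (intro in') (auto simp: T_def dist_real_def)
  then obtain y where "flows_to \<Omega> ?X (?t T $ coord k) (flow_chain \<Omega> r J (?t T) (\<xi> (vertex (card J) 0 (?t T))) k) y"
    using dom k unfolding psi_domain_def psi_defined_def by metis
  then obtain \<gamma> where \<gamma>: "\<gamma> 0 = ?c" "integral_curve \<Omega> ?X T \<gamma>"
    unfolding flows_to_iff chain nth[OF k] by auto
  have tk: "t $ coord k \<in> ?S" and T0: "T \<noteq> 0"
    using d(1) by (auto simp: T_def closed_segment_eq_real_ivl)
  have \<gamma>_eq: "\<gamma> s = psi \<Omega> r J \<xi> (?t s)" if "s \<in> ?S" "dist s (t $ coord k) < d" for s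
    using flow_eq[OF r \<Omega> \<gamma>(2) that(1)] psi[OF in'[OF that(2)]] \<gamma>(1) by simp
  have "((\<lambda>s. ?t s) has_derivative (\<lambda>s. s *\<^sub>R axis (coord k) 1)) (at (t $ coord k) within ?S)"
    by (auto intro!: derivative_eq_intros)
  from has_derivative_compose[OF this, of "psi \<Omega> r J \<xi>" P'] D
  have "((\<lambda>s. psi \<Omega> r J \<xi> (?t s)) has_vector_derivative P' (axis (coord k) 1)) (at (t $ coord k) within ?S)"
    by (simp add: has_vector_derivative_def blinfun.scaleR_right)
  then have "(\<gamma> has_vector_derivative P' (axis (coord k) 1)) (at (t $ coord k) within ?S)"
    by (rule has_vector_derivative_transform_within[OF _ d(1) tk]) (simp add: \<gamma>_eq)
  moreover have "(\<gamma> has_vector_derivative ?X (\<gamma> (t $ coord k))) (at (t $ coord k) within ?S)"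
    using \<gamma>(2) tk by (simp add: integral_curve_def)
  moreover have "at (t $ coord k) within ?S \<noteq> bot"
    unfolding trivial_limit_within not_not
    using T0 by (intro connected_imp_perfect tk connected_segment) (auto simp: closed_segment_eq_real_ivl)
  ultimately have "P' (axis (coord k) 1) = ?X (\<gamma> (t $ coord k))"
    using vector_derivative_unique_within by blast
  then show ?thesis
    using \<gamma>_eq[OF tk] d(1) by simp
qed

end

section \<open>The dual coframe\<close>

lemma differentiable_prod:
  fixes h :: "'i \<Rightarrow> 'a::real_normed_vector \<Rightarrow> real"
  shows "(\<And>i. i \<in> S \<Longrightarrow> h i differentiable (at x within X)) \<Longrightarrow> (\<lambda>x. \<Prod>i\<in>S. h i x) differentiable (at x within X)"
  by (induction S rule: infinite_finite_induct) auto

lemma differentiable_det: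
  fixes A :: "'a::real_normed_vector \<Rightarrow> real^'n^'n"
  assumes "\<And>i j. (\<lambda>x. A x $ i $ j) differentiable (at x within X)"
  shows "(\<lambda>x. det (A x)) differentiable (at x within X)"
  unfolding det_def
proof (rule differentiable_sum[OF finite_permutations[OF finite]], rule ballI)
  fix q
  show "(\<lambda>x. of_int (sign q) * (\<Prod>i\<in>UNIV. A x $ i $ q i)) differentiable (at x within X)"
    by (rule differentiable_mult[OF differentiable_const differentiable_prod[OF assms]])
qed

lemma
  fixes A :: "real^'n^'n"
  assumes "invertible A"
  shows matrix_inv_right: "A ** matrix_inv A = mat 1" and matrix_inv_left: "matrix_inv A ** A = mat 1"
  using someI_ex[OF assms[unfolded invertible_def]] by (auto simp: matrix_inv_def)

text \<open>Cramer's rule turns the entries of the inverse into quotients of polynomials in the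
  entries of \<open>A\<close>, from which the differentiability of the coframe follows.\<close>

lemma matrix_inv_entry:
  fixes A :: "real^'n^'n"
  assumes "det A \<noteq> 0"
  shows "matrix_inv A $ i $ j = det (\<chi> a b. if b = i then axis j 1 $ a else A $ a $ b) / det A"
proof -
  have "invertible A" using assms invertible_det_nz by blast
  then have "A *v (matrix_inv A *v axis j 1) = axis j 1"
    by (simp add: matrix_vector_mul_assoc matrix_inv_right)
  then have "matrix_inv A *v axis j 1 = (\<chi> k. det (\<chi> a b. if b = k then axis j 1 $ a else A $ a $ b) / det A)"
    using cramer[OF assms] by blast
  from arg_cong[OF this, of "\<lambda>v. v $ i"] show ?thesis
    by (simp add: matrix_vector_mult_basis column_def)
qed

definition coframe :: "('n \<Rightarrow> real^'n \<Rightarrow> real^'n) \<Rightarrow> 'n \<Rightarrow> real^'n \<Rightarrow> real^'n::finite" where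
  "coframe r i x = matrix_inv (\<chi> a b. r b x $ a) $ i"

context
  fixes \<Omega> :: "(real^'n::finite) set" and r :: "'n \<Rightarrow> real^'n \<Rightarrow> real^'n"
  assumes frame: "C1_frame \<Omega> r" and \<Omega>: "open \<Omega>"
begin

lemma frame_invertible:
  assumes x: "x \<in> \<Omega>"
  shows "invertible (\<chi> a b. r b x $ a)"
proof -
  let ?A = "\<chi> a b. r b x $ a"
  have col: "column b ?A = r b x" for b by (simp add: column_def vec_eq_iff)
  have inj: "inj (\<lambda>i. r i x)" and ind: "independent (range (\<lambda>i. r i x))"
    using frame x by (auto simp: C1_frame_def)
  have "k i = 0" if k: "(\<Sum>i\<in>UNIV. k i *s column i ?A) = 0" for k i
  proof -
    have "(\<Sum>v\<in>range (\<lambda>i. r i x). k (inv (\<lambda>i. r i x) v) *\<^sub>R v) = 0"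
      using k inv_f_f[OF inj] by (subst sum.reindex[OF inj]) (simp add: col scalar_mult_eq_scaleR)
    from independentD[OF ind _ _ this, of "r i x"] show ?thesis by (simp add: inv_f_f[OF inj])
  qed
  then have "\<exists>B. B ** ?A = mat 1"
    unfolding matrix_left_invertible_independent_columns by blast
  then show ?thesis
    using matrix_left_right_inverse unfolding invertible_def by blast
qed

lemma coframe_dual:
  assumes "x \<in> \<Omega>" shows "coframe r i x \<bullet> r j x = (if i = j then 1 else 0)"
proof -
  let ?A = "\<chi> a b. r b x $ a"
  have "(matrix_inv ?A ** ?A) $ i $ j = (mat 1 :: real^'n^'n) $ i $ j"
    using frame_invertible[OF assms] by (simp add: matrix_inv_left)
  then show ?thesis
    by (simp add: coframe_def matrix_matrix_mult_def inner_vec_def mat_def)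
qed

lemma coframe_expand:
  assumes "x \<in> \<Omega>" shows "(\<Sum>i\<in>UNIV. (coframe r i x \<bullet> v) *\<^sub>R r i x) = v"
proof -
  let ?A = "\<chi> a b. r b x $ a"
  have "?A *v (matrix_inv ?A *v v) = v"
    using frame_invertible[OF assms] by (simp add: matrix_vector_mul_assoc matrix_inv_right)
  moreover have "matrix_inv ?A *v v = (\<chi> i. coframe r i x \<bullet> v)"
    by (simp add: coframe_def matrix_vector_mult_def inner_vec_def)
  ultimately show ?thesis
    by (simp add: matrix_vector_mult_def vec_eq_iff mult.commute)
qed

lemma coframe_differentiable:
  assumes x: "x \<in> \<Omega>" shows "coframe r i differentiable (at x)"
proof -
  have comp: "(\<lambda>x. r b x $ a) differentiable (at x)" for a b
  proof -
    obtain r' where "(r b has_derivative r') (at x)"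
      using frame x C1_on_open_iff[OF \<Omega>, of "r b"] unfolding C1_frame_def by blast
    from bounded_linear.has_derivative[OF bounded_linear_vec_nth this] show ?thesis
      unfolding differentiable_def by blast
  qed
  let ?A = "\<lambda>x. \<chi> a b. r b x $ a"
  have det: "det (?A x) \<noteq> 0" if "x \<in> \<Omega>" for x
    using frame_invertible[OF that] invertible_det_nz by blast
  have "(\<lambda>x. coframe r i x $ j) differentiable (at x)" for j
  proof -
    have "(\<lambda>x. (\<chi> a b. if b = i then axis j 1 $ a else ?A x $ a $ b) $ a $ b :: real) differentiable (at x)" for a b
      using comp by (cases "b = i") simp_all
    then have "(\<lambda>x. det (\<chi> a b. if b = i then axis j 1 $ a else ?A x $ a $ b) / det (?A x)) differentiable (at x)"
      using det[OF x] comp by (intro differentiable_divide differentiable_det) simp_all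
    then obtain D where D: "((\<lambda>x. det (\<chi> a b. if b = i then axis j 1 $ a else ?A x $ a $ b) / det (?A x)) has_derivative D) (at x)"
      unfolding differentiable_def by blast
    have "((\<lambda>x. coframe r i x $ j) has_derivative D) (at x)"
      by (rule has_derivative_transform_within_open[OF D \<Omega> x])
        (simp add: coframe_def matrix_inv_entry det)
    then show ?thesis unfolding differentiable_def by blast
  qed
  then show ?thesis
    by (subst differentiable_componentwise_within) (auto simp: Basis_vec_def inner_axis)
qed

end

lemma grad_inner:
  assumes "(h has_derivative h') (at x)"
  shows "grad h x \<bullet> v = h' v" and "grad h x $ j = h' (axis j 1)"
proof -
  show nth: "grad h x $ j = h' (axis j 1)" for j
    using frechet_derivative_at[OF assms] by (simp add: grad_def)
  have lin: "linear h'" using assms by (simp add: has_derivative_bounded_linear bounded_linear.linear)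
  have "h' v = h' (\<Sum>j\<in>UNIV. v $ j *\<^sub>R axis j 1)"
    using basis_expansion[of v] by (simp add: scalar_mult_eq_scaleR)
  also have "\<dots> = (\<Sum>j\<in>UNIV. v $ j * h' (axis j 1))"
    by (simp add: linear_sum[OF lin] linear_scale[OF lin])
  finally show "grad h x \<bullet> v = h' v"
    by (simp add: inner_vec_def nth mult.commute)
qed

text \<open>Turns a condition on points near \<open>a\<close> into one on a radius, so that it can
  be imposed together with smallness conditions on \<delta>.\<close>

lemma eventually_ball_at_right:
  assumes "\<forall>\<^sub>F x in nhds a. \<Phi> x"
  shows "\<forall>\<^sub>F \<delta> in at_right 0. \<forall>x\<in>ball a \<delta>. \<Phi> x"
proof -
  obtain d where d: "d > 0" "\<And>x. dist x a < d \<Longrightarrow> \<Phi> x"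
    using assms unfolding eventually_nhds_metric by blast
  have "\<forall>\<^sub>F \<delta> in at_right 0. \<delta> < d" using d(1) by (auto simp: eventually_at_right_field)
  then show ?thesis
    by eventually_elim (auto intro!: d(2) simp: dist_commute)
qed

lemma eventually_mult_le_at_right:
  fixes A B :: real
  assumes "B > 0" shows "\<forall>\<^sub>F \<delta> in at_right 0. A * \<delta> < B"
proof -
  have "((\<lambda>\<delta>. A * \<delta>) \<longlongrightarrow> A * 0) (at_right 0)" by (intro tendsto_intros)
  from order_tendstoD(2)[OF this] assms show ?thesis by simp
qed

lemma isCont_eventually: "isCont h a \<Longrightarrow> open S \<Longrightarrow> h a \<in> S \<Longrightarrow> \<forall>\<^sub>F x in nhds a. h x \<in> S"
  unfolding isCont_def tendsto_at_iff_tendsto_nhds by (rule topological_tendstoD)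

lemma family_bound:
  fixes h :: "'i::finite \<Rightarrow> 'a::t2_space \<Rightarrow> 'b::real_normed_vector"
  assumes "\<And>i. isCont (h i) a"
  obtains C where "C \<ge> 0" "\<forall>\<^sub>F x in nhds a. \<forall>i. norm (h i x) \<le> C"
proof -
  let ?C = "1 + (\<Sum>i\<in>UNIV. norm (h i a))"
  have "\<forall>\<^sub>F x in nhds a. norm (h i x) \<le> ?C" for i
  proof -
    have "norm (h i a) \<le> (\<Sum>i\<in>UNIV. norm (h i a))" by (rule member_le_sum) auto
    then have "\<forall>\<^sub>F x in nhds a. norm (h i x) \<in> {..<?C}"
      by (intro isCont_eventually continuous_intros assms) auto
    then show ?thesis by eventually_elim auto
  qed
  then show thesis
    by (intro that[of ?C] eventually_all_finite) (auto intro!: add_nonneg_nonneg sum_nonneg)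
qed

section \<open>Existence and uniqueness near the base point\<close>

theorem theorem1:
  fixes \<Omega> :: "(real ^ 'n::{finite,linorder}) set"
    and \<Upsilon> :: "(real ^ 'm::finite) set"
    and xb :: "real ^ 'n::_"
    and I :: "'m \<Rightarrow> 'n set"
    and r :: "'n \<Rightarrow> real ^ 'n::_ \<Rightarrow> real ^ 'n::_"
    and \<Xi>0 \<Xi> :: "'m \<Rightarrow> (real ^ 'n::_) set"
    and U \<Theta> :: "'m \<Rightarrow> (real ^ 'n::_) set"
    and \<xi> :: "'m \<Rightarrow> real ^ 'n::_ \<Rightarrow> real ^ 'n::_"
    and g :: "'m \<Rightarrow> real ^ 'n::_ \<Rightarrow> real"
    and f :: "'m \<Rightarrow> 'n \<Rightarrow> real ^ 'n::_ \<Rightarrow> real ^ 'm \<Rightarrow> real"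
    and c :: "'n \<Rightarrow> 'n \<Rightarrow> 'n \<Rightarrow> real ^ 'n::_ \<Rightarrow> real"
  assumes "open \<Omega>" and "open \<Upsilon>" and "xb \<in> \<Omega>"
    and "\<And>\<alpha>. I \<alpha> \<noteq> {}"
    and frame: "C1_frame \<Omega> r"
    and manifold: "\<And>\<alpha>. C1_submanifold (card (I \<alpha>)) (\<Xi>0 \<alpha>) \<and> \<Xi>0 \<alpha> \<subseteq> \<Omega> \<and> xb \<in> \<Xi>0 \<alpha>"
    and transverse: "\<And>\<alpha> y. y \<in> \<Xi>0 \<alpha> \<Longrightarrow> transverse_at (\<Xi>0 \<alpha>) (span ((\<lambda>i. r i y) ` I \<alpha>)) y"
    and chart: "\<And>\<alpha>. chart_centered_at (card (I \<alpha>)) xb (\<Xi>0 \<alpha>) (U \<alpha>) (\<xi> \<alpha>)"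
    and domain: "\<And>\<alpha>. psi_domain \<Omega> r (I \<alpha>) (U \<alpha>) (\<xi> \<alpha>) (\<Theta> \<alpha>)"
    and shrunk: "\<And>\<alpha>. \<Xi> \<alpha> = \<Xi>0 \<alpha> \<inter> psi \<Omega> r (I \<alpha>) (\<xi> \<alpha>) ` \<Theta> \<alpha>"
    and stable: "stable_configuration \<Omega> r I \<xi> \<Theta> xb"
    and data: "\<And>\<alpha>. C1_on (\<Xi> \<alpha>) (g \<alpha>) \<and> bounded (g \<alpha> ` \<Xi> \<alpha>)"
    and data_at: "(\<chi> \<alpha>. g \<alpha> xb) \<in> \<Upsilon>"
    and f_bounded: "\<And>\<alpha> i. i \<in> I \<alpha> \<Longrightarrow> bounded ((\<lambda>(x, u). f \<alpha> i x u) ` (\<Omega> \<times> \<Upsilon>))"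
    and f_continuous: "\<And>\<alpha> i. i \<in> I \<alpha> \<Longrightarrow> continuous_on (\<Omega> \<times> \<Upsilon>) (\<lambda>(x, u). f \<alpha> i x u)"
    and f_lipschitz: "\<And>\<alpha> i. i \<in> I \<alpha> \<Longrightarrow>
      \<exists>L. \<forall>x\<in>\<Omega>. \<forall>u\<in>\<Upsilon>. \<forall>v\<in>\<Upsilon>. \<bar>f \<alpha> i x u - f \<alpha> i x v\<bar> \<le> L * infnorm (u - v)"
    and f_C1: "\<And>\<alpha> i. i \<in> I \<alpha> \<Longrightarrow> C1_on (\<Omega> \<times> \<Upsilon>) (\<lambda>(x, u). f \<alpha> i x u)"
    and f_indep: "\<And>\<alpha> i j \<beta> x u. i \<in> I \<alpha> \<Longrightarrow> j \<in> I \<alpha> \<Longrightarrow> i \<noteq> j \<Longrightarrow> i \<notin> I \<beta> \<Longrightarrow> x \<in> \<Omega> \<Longrightarrow> u \<in> \<Upsilon> \<Longrightarrow>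
      grad (f \<alpha> j x) u $ \<beta> = 0"
    and involutive: "\<And>\<alpha> j k x. j \<in> I \<alpha> \<Longrightarrow> k \<in> I \<alpha> \<Longrightarrow> x \<in> \<Omega> \<Longrightarrow>
      lie_bracket (r j) (r k) x \<in> span ((\<lambda>i. r i x) ` I \<alpha>)"
    and structure_coeffs: "\<And>i j x. x \<in> \<Omega> \<Longrightarrow>
      lie_bracket (r i) (r j) x = (\<Sum>k\<in>UNIV. c i j k x *\<^sub>R r k x)"
    and integrability: "\<And>\<alpha> i j x u. i \<in> I \<alpha> \<Longrightarrow> j \<in> I \<alpha> \<Longrightarrow> i \<noteq> j \<Longrightarrow> x \<in> \<Omega> \<Longrightarrow> u \<in> \<Upsilon> \<Longrightarrow>
      grad (\<lambda>y. f \<alpha> j y u) x \<bullet> r i x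
        + (\<Sum>\<beta> | i \<in> I \<beta>. grad (f \<alpha> j x) u $ \<beta> * f \<beta> i x u)
        - grad (\<lambda>y. f \<alpha> i y u) x \<bullet> r j x
        - (\<Sum>\<beta> | j \<in> I \<beta>. grad (f \<alpha> i x) u $ \<beta> * f \<beta> j x u)
      = (\<Sum>k\<in>I \<alpha>. c i j k x * f \<alpha> k x u)"
    and coeffs_bounded: "\<And>\<alpha> i j k. i \<in> I \<alpha> \<Longrightarrow> j \<in> I \<alpha> \<Longrightarrow> k \<in> I \<alpha> \<Longrightarrow> bounded (c i j k ` \<Omega>)"
  shows "\<exists>N. open N \<and> xb \<in> N \<and> N \<subseteq> \<Omega> \<and>
    (\<exists>u. is_solution \<Upsilon> r I f \<Xi> g N u) \<and>
    (\<forall>u v. is_solution \<Upsilon> r I f \<Xi> g N u \<and> is_solution \<Upsilon> r I f \<Xi> g N v \<longrightarrow> (\<forall>x\<in>N. u x = v x))"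
proof -
  define p where "p \<alpha> = card (I \<alpha>)" for \<alpha>
  define idx where "idx \<alpha> k = sorted_list_of_set (I \<alpha>) ! k" for \<alpha> k
  define P where "P \<alpha> = psi \<Omega> r (I \<alpha>) (\<xi> \<alpha>)" for \<alpha>
  define Q where "Q \<alpha> = inv_into (\<Theta> \<alpha>) (P \<alpha>)" for \<alpha>
  define gb where "gb = (\<chi> \<alpha>. g \<alpha> xb)"
  define n where "n = real CARD('n)"
  define M where "M = real CARD('m)"
  have nM: "n > 0" "M > 0" by (auto simp: n_def M_def)

  have p_le: "p \<alpha> \<le> CARD('n)" for \<alpha> unfolding p_def by (rule card_mono) auto
  have idx: "bij_betw (idx \<alpha>) {..<p \<alpha>} (I \<alpha>)" for \<alpha>
    unfolding p_def idx_def by (rule bij_betw_nth) auto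
  then have idx_in: "k < p \<alpha> \<Longrightarrow> idx \<alpha> k \<in> I \<alpha>" for \<alpha> k by (auto simp: bij_betw_def)

  have r_C1: "C1_on \<Omega> (r i)" for i using frame by (simp add: C1_frame_def)
  then have "\<forall>i. \<exists>r' :: (real^'n::_) \<Rightarrow> (real^'n::_) \<Rightarrow>\<^sub>L (real^'n::_).
      (\<forall>x\<in>\<Omega>. (r i has_derivative blinfun_apply (r' x)) (at x)) \<and> continuous_on \<Omega> r'"
    using C1_on_open_iff[OF \<open>open \<Omega>\<close>] by blast
  then obtain r' :: "'n \<Rightarrow> (real^'n::_) \<Rightarrow> (real^'n::_) \<Rightarrow>\<^sub>L (real^'n::_)" where
    r'_all: "\<forall>i. (\<forall>x\<in>\<Omega>. (r i has_derivative blinfun_apply (r' i x)) (at x)) \<and> continuous_on \<Omega> (r' i)"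
    unfolding choice_iff by blast
  then have r_deriv: "(r i has_derivative r' i x) (at x)" if "x \<in> \<Omega>" for i x using that by blast
  have r'_cont: "continuous_on \<Omega> (r' i)" for i using r'_all by blast
  have r_cont: "continuous_on \<Omega> (r i)" for i
    using r_deriv by (meson continuous_at_imp_continuous_on has_derivative_continuous)

  have \<Theta>: "open (\<Theta> \<alpha>)" "0 \<in> \<Theta> \<alpha>" "open (P \<alpha> ` \<Theta> \<alpha>)" "C1_diffeo (\<Theta> \<alpha>) (P \<alpha> ` \<Theta> \<alpha>) (P \<alpha>)"
    and in_U: "\<And>t. t \<in> \<Theta> \<alpha> \<Longrightarrow> vertex (p \<alpha>) 0 t \<in> U \<alpha>" for \<alpha>
    using domain[of \<alpha>] by (auto simp: psi_domain_def P_def p_def psi_defined_def)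
  have inj: "inj_on (P \<alpha>) (\<Theta> \<alpha>)" for \<alpha> using \<Theta>(4) by (auto simp: C1_diffeo_def bij_betw_def)
  have QP: "Q \<alpha> (P \<alpha> t) = t" if "t \<in> \<Theta> \<alpha>" for \<alpha> t using that inj by (simp add: Q_def)
  have "\<forall>\<alpha>. \<exists>P' :: (real^'n::_) \<Rightarrow> (real^'n::_) \<Rightarrow>\<^sub>L (real^'n::_).
      (\<forall>x\<in>\<Theta> \<alpha>. (P \<alpha> has_derivative blinfun_apply (P' x)) (at x)) \<and> continuous_on (\<Theta> \<alpha>) P'"
    using C1_on_open_iff[OF \<Theta>(1)] \<Theta>(4) unfolding C1_diffeo_def by blast
  then obtain P' :: "'m \<Rightarrow> (real^'n::_) \<Rightarrow> (real^'n::_) \<Rightarrow>\<^sub>L (real^'n::_)" where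
    P'_all: "\<forall>\<alpha>. (\<forall>x\<in>\<Theta> \<alpha>. (P \<alpha> has_derivative blinfun_apply (P' \<alpha> x)) (at x)) \<and> continuous_on (\<Theta> \<alpha>) (P' \<alpha>)"
    unfolding choice_iff by blast
  then have P_deriv: "(P \<alpha> has_derivative P' \<alpha> x) (at x)" if "x \<in> \<Theta> \<alpha>" for \<alpha> x using that by blast
  have P'_cont: "continuous_on (\<Theta> \<alpha>) (P' \<alpha>)" for \<alpha> using P'_all by blast
  have "\<forall>\<alpha>. \<exists>Q' :: (real^'n::_) \<Rightarrow> (real^'n::_) \<Rightarrow>\<^sub>L (real^'n::_).
      (\<forall>x\<in>P \<alpha> ` \<Theta> \<alpha>. (Q \<alpha> has_derivative blinfun_apply (Q' x)) (at x)) \<and> continuous_on (P \<alpha> ` \<Theta> \<alpha>) Q'"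
    using C1_on_open_iff[OF \<Theta>(3)] \<Theta>(4) unfolding C1_diffeo_def Q_def by blast
  then obtain Q' :: "'m \<Rightarrow> (real^'n::_) \<Rightarrow> (real^'n::_) \<Rightarrow>\<^sub>L (real^'n::_)" where
    Q'_all: "\<forall>\<alpha>. (\<forall>x\<in>P \<alpha> ` \<Theta> \<alpha>. (Q \<alpha> has_derivative blinfun_apply (Q' \<alpha> x)) (at x)) \<and> continuous_on (P \<alpha> ` \<Theta> \<alpha>) (Q' \<alpha>)"
    unfolding choice_iff by blast
  then have Q_deriv: "(Q \<alpha> has_derivative Q' \<alpha> x) (at x)" if "x \<in> P \<alpha> ` \<Theta> \<alpha>" for \<alpha> x using that by blast
  have Q'_cont: "continuous_on (P \<alpha> ` \<Theta> \<alpha>) (Q' \<alpha>)" for \<alpha> using Q'_all by blast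

  note psi = psi_slice[OF \<open>open \<Omega>\<close> r_C1 domain, folded P_def p_def]
  have \<xi>0: "\<xi> \<alpha> 0 = xb" and \<xi>: "bij_betw (\<xi> \<alpha>) (U \<alpha>) (\<Xi>0 \<alpha>)" "U \<alpha> \<subseteq> last_coords (p \<alpha>)" "0 \<in> U \<alpha>"
    and C1_inv: "C1_on (\<Xi>0 \<alpha>) (inv_into (U \<alpha>) (\<xi> \<alpha>))" for \<alpha>
    using chart[of \<alpha>] openin_imp_subset by (auto simp: chart_centered_at_def C1_diffeo_def p_def)
  have P0: "P \<alpha> 0 = xb" for \<alpha> using psi[of \<alpha> 0] \<Theta>(2) \<xi>0 by simp
  have xbP: "xb \<in> P \<alpha> ` \<Theta> \<alpha>" for \<alpha> using P0 \<Theta>(2) by (metis imageI)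
  have Q0: "Q \<alpha> xb = 0" for \<alpha> using QP[OF \<Theta>(2)] P0 by simp
  have P'_axis: "P' \<alpha> t (axis (coord k) 1) = r (idx \<alpha> k) (P \<alpha> t)"
    if "t \<in> \<Theta> \<alpha>" "k < p \<alpha>" "vertex (p \<alpha>) (Suc k) t = t" for \<alpha> t k
    using psi_axis[OF \<open>open \<Omega>\<close> r_C1 domain, of k \<alpha> t "P' \<alpha> t"] that P_deriv[OF that(1)]
    unfolding P_def p_def idx_def by blast
  have iso: "isCont h x" if "continuous_on S h" "open S" "x \<in> S"
    for h :: "(real^'n::_) \<Rightarrow> 'z::topological_space" and S x
    using that continuous_on_eq_continuous_at by blast

  define ff where "ff \<alpha> i = (\<lambda>(x, u). f \<alpha> i x u)" for \<alpha> i
  have oU: "open (\<Omega> \<times> \<Upsilon>)" using \<open>open \<Omega>\<close> \<open>open \<Upsilon>\<close> by (rule open_Times)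
  have "\<forall>\<alpha> i. \<exists>f' :: (real^'n::_) \<times> (real^'m) \<Rightarrow> ((real^'n::_) \<times> (real^'m)) \<Rightarrow>\<^sub>L real. i \<in> I \<alpha> \<longrightarrow>
      (\<forall>z\<in>\<Omega> \<times> \<Upsilon>. (ff \<alpha> i has_derivative blinfun_apply (f' z)) (at z)) \<and> continuous_on (\<Omega> \<times> \<Upsilon>) f'"
    using f_C1 C1_on_open_iff[OF oU] unfolding ff_def by blast
  then obtain f' :: "'m \<Rightarrow> 'n \<Rightarrow> (real^'n::_) \<times> (real^'m) \<Rightarrow> ((real^'n::_) \<times> (real^'m)) \<Rightarrow>\<^sub>L real" where
    f'_all: "\<forall>\<alpha> i. i \<in> I \<alpha> \<longrightarrow> (\<forall>z\<in>\<Omega> \<times> \<Upsilon>. (ff \<alpha> i has_derivative blinfun_apply (f' \<alpha> i z)) (at z)) \<and> continuous_on (\<Omega> \<times> \<Upsilon>) (f' \<alpha> i)"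
    unfolding choice_iff by blast
  then have f_deriv: "(ff \<alpha> i has_derivative f' \<alpha> i z) (at z)" if "i \<in> I \<alpha>" "z \<in> \<Omega> \<times> \<Upsilon>" for \<alpha> i z using that by blast
  have f'_cont: "continuous_on (\<Omega> \<times> \<Upsilon>) (f' \<alpha> i)" if "i \<in> I \<alpha>" for \<alpha> i using f'_all that by blast
  have grad_x: "grad (\<lambda>y. f \<alpha> j y u) x \<bullet> v = f' \<alpha> j (x, u) (v, 0)" if "j \<in> I \<alpha>" "x \<in> \<Omega>" "u \<in> \<Upsilon>" for \<alpha> j x u v
  proof (rule grad_inner)
    have "(ff \<alpha> j has_derivative f' \<alpha> j (x, u)) (at (x, u))" using f_deriv that by auto
    from has_derivative_compose[OF has_derivative_Pair[OF has_derivative_ident has_derivative_const] this]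
    show "((\<lambda>y. f \<alpha> j y u) has_derivative (\<lambda>v. f' \<alpha> j (x, u) (v, 0))) (at x)"
      by (simp add: ff_def)
  qed
  have grad_u: "grad (f \<alpha> j x) u $ \<beta> = f' \<alpha> j (x, u) (0, axis \<beta> 1)" if "j \<in> I \<alpha>" "x \<in> \<Omega>" "u \<in> \<Upsilon>" for \<alpha> j x u \<beta>
  proof (rule grad_inner)
    have "(ff \<alpha> j has_derivative f' \<alpha> j (x, u)) (at (x, u))" using f_deriv that by auto
    from has_derivative_compose[OF has_derivative_Pair[OF has_derivative_const has_derivative_ident] this]
    show "(f \<alpha> j x has_derivative (\<lambda>v. f' \<alpha> j (x, u) (0, v))) (at u)"
      by (simp add: ff_def)
  qed

  define \<theta> where "\<theta> = coframe r"
  note dual = coframe_dual[OF frame \<open>open \<Omega>\<close>, folded \<theta>_def]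
  note expand = coframe_expand[OF frame \<open>open \<Omega>\<close>, folded \<theta>_def]
  define \<theta>' where "\<theta>' i x = frechet_derivative (\<theta> i) (at x)" for i x
  have \<theta>_deriv: "(\<theta> i has_derivative \<theta>' i x) (at x)" if "x \<in> \<Omega>" for i x
    using coframe_differentiable[OF frame \<open>open \<Omega>\<close> that, of i] unfolding \<theta>'_def \<theta>_def
    by (simp add: frechet_derivative_works)
  have \<theta>_cont: "continuous_on \<Omega> (\<theta> i)" for i
    using \<theta>_deriv by (meson continuous_at_imp_continuous_on has_derivative_continuous)
  have bracket: "lie_bracket (r i) (r j) x = r' j x (r i x) - r' i x (r j x)" if "x \<in> \<Omega>" for i j x
    using frechet_derivative_at[OF r_deriv[OF that]] by (simp add: lie_bracket_def)
  \<comment> \<open>Duality determines the structure coefficients. The right-hand side is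
    continuous, which supplies the constant \<open>CC\<close> near \<open>xb\<close>.\<close>
  have c_eq: "c i j k x = \<theta> k x \<bullet> (r' j x (r i x) - r' i x (r j x))" if x: "x \<in> \<Omega>" for i j k x
    unfolding bracket[OF x, symmetric] structure_coeffs[OF x]
    by (simp add: inner_sum_right dual[OF x] if_distrib cong: if_cong)
  have c_zero: "c i j k x = 0" if "i \<in> I \<alpha>" "j \<in> I \<alpha>" "k \<notin> I \<alpha>" and x: "x \<in> \<Omega>" for i j k \<alpha> x
  proof -
    have "\<theta> k x \<bullet> v = 0" if "v \<in> span ((\<lambda>i. r i x) ` I \<alpha>)" for v
      using that
    proof (induction v rule: span_induct_alt)
      case (step c y z)
      then show ?case using dual[OF x, of k] \<open>k \<notin> I \<alpha>\<close> by (auto simp: inner_add_right split: if_splits)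
    qed simp
    then show ?thesis
      using involutive[OF that(1,2) x] c_eq[OF x] bracket[OF x] by simp
  qed

  have "xb \<in> \<Xi> \<alpha>" for \<alpha>
    using manifold[of \<alpha>] shrunk[of \<alpha>] xbP[of \<alpha>] by (auto simp: P_def)
  \<comment> \<open>An ambient C^1 extension of the data near \<open>xb\<close> is fixed here;
    \<open>N\<close> is later chosen inside its domain.\<close>
  then have "\<forall>\<alpha>. \<exists>V F (F' :: (real^'n::_) \<Rightarrow> (real^'n::_) \<Rightarrow>\<^sub>L real). open V \<and> xb \<in> V \<and>
      (\<forall>y\<in>V. (F has_derivative blinfun_apply (F' y)) (at y)) \<and> continuous_on V F' \<and> (\<forall>y\<in>\<Xi> \<alpha> \<inter> V. F y = g \<alpha> y)"
    using data unfolding C1_on_def by blast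
  then obtain V Fg and Fg' :: "'m \<Rightarrow> (real^'n::_) \<Rightarrow> (real^'n::_) \<Rightarrow>\<^sub>L real" where
    Fg_all: "\<forall>\<alpha>. open (V \<alpha>) \<and> xb \<in> V \<alpha> \<and> (\<forall>y\<in>V \<alpha>. (Fg \<alpha> has_derivative blinfun_apply (Fg' \<alpha> y)) (at y)) \<and>
      continuous_on (V \<alpha>) (Fg' \<alpha>) \<and> (\<forall>y\<in>\<Xi> \<alpha> \<inter> V \<alpha>. Fg \<alpha> y = g \<alpha> y)"
    unfolding choice_iff by blast
  then have V: "open (V \<alpha>)" "xb \<in> V \<alpha>" and Fg_deriv: "\<And>y. y \<in> V \<alpha> \<Longrightarrow> (Fg \<alpha> has_derivative Fg' \<alpha> y) (at y)"
    and Fg'_cont: "continuous_on (V \<alpha>) (Fg' \<alpha>)" and Fg_eq: "\<And>y. y \<in> \<Xi> \<alpha> \<Longrightarrow> y \<in> V \<alpha> \<Longrightarrow> Fg \<alpha> y = g \<alpha> y" for \<alpha>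
    by blast+
  have Fg_xb: "Fg \<alpha> xb = gb $ \<alpha>" for \<alpha>
    using Fg_eq[OF \<open>xb \<in> \<Xi> \<alpha>\<close> V(2)] by (simp add: gb_def)
  have Fg_cont: "isCont (Fg \<alpha>) xb" for \<alpha>
    using Fg_deriv[OF V(2)] by (rule has_derivative_continuous)

  obtain \<rho>1 where \<rho>1: "\<rho>1 > 0" "cball xb \<rho>1 \<subseteq> \<Omega>" using \<open>open \<Omega>\<close> \<open>xb \<in> \<Omega>\<close> open_contains_cball by blast
  obtain \<rho>2 where \<rho>2: "\<rho>2 > 0" "cball gb \<rho>2 \<subseteq> \<Upsilon>"
    using \<open>open \<Upsilon>\<close> data_at open_contains_cball unfolding gb_def by blast
  define \<rho> where "\<rho> = min \<rho>1 \<rho>2"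
  have \<rho>: "\<rho> > 0" "cball xb \<rho> \<subseteq> \<Omega>" "cball gb \<rho> \<subseteq> \<Upsilon>" using \<rho>1 \<rho>2 by (auto simp: \<rho>_def)
  have sub: "cball xb \<rho> \<times> cball gb \<rho> \<subseteq> \<Omega> \<times> \<Upsilon>" using \<rho> by auto
  let ?A = "SIGMA \<alpha>:UNIV. I \<alpha>"
  \<comment> \<open>\<open>F0\<close> is valid on the whole domain of \<open>f\<close>, as it must
    also apply to solutions with arbitrary values in \<Upsilon>. The bound \<open>F1\<close> on the
    derivatives comes from compactness of the product of balls.\<close>
  have "bounded (\<Union>(\<alpha>, i)\<in>?A. ff \<alpha> i ` (\<Omega> \<times> \<Upsilon>))"
    using f_bounded by (intro bounded_UN) (auto simp: ff_def)
  then obtain F0 where F0: "F0 > 0" "\<And>\<alpha> i z. i \<in> I \<alpha> \<Longrightarrow> z \<in> \<Omega> \<times> \<Upsilon> \<Longrightarrow> \<bar>ff \<alpha> i z\<bar> \<le> F0"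
    unfolding bounded_pos by fastforce
  have "bounded (\<Union>(\<alpha>, i)\<in>?A. f' \<alpha> i ` (cball xb \<rho> \<times> cball gb \<rho>))"
  proof (intro bounded_UN ballI)
    fix a assume "a \<in> ?A"
    then show "bounded (case a of (\<alpha>, i) \<Rightarrow> f' \<alpha> i ` (cball xb \<rho> \<times> cball gb \<rho>))"
      using continuous_on_subset[OF f'_cont sub]
      by (auto intro!: compact_imp_bounded compact_continuous_image compact_Times)
  qed auto
  then obtain F1 where F1: "F1 > 0" "\<And>\<alpha> i z. i \<in> I \<alpha> \<Longrightarrow> z \<in> cball xb \<rho> \<times> cball gb \<rho> \<Longrightarrow> norm (f' \<alpha> i z) \<le> F1"
    unfolding bounded_pos by fastforce

  obtain CP where CP: "CP \<ge> 0" "\<forall>\<^sub>F t in nhds 0. \<forall>\<alpha>. norm (P' \<alpha> t) \<le> CP"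
    using family_bound[where h = P' and a = 0] iso[OF P'_cont \<Theta>(1) \<Theta>(2)] by blast
  obtain CQ where CQ: "CQ \<ge> 0" "\<forall>\<^sub>F x in nhds xb. \<forall>\<alpha>. norm (Q' \<alpha> x) \<le> CQ"
    using family_bound[where h = Q' and a = xb] iso[OF Q'_cont \<Theta>(3) xbP] by blast
  obtain CR where CR: "CR \<ge> 0" "\<forall>\<^sub>F x in nhds xb. \<forall>i. norm (r i x) \<le> CR"
    using family_bound[where h = r and a = xb] iso[OF r_cont \<open>open \<Omega>\<close> \<open>xb \<in> \<Omega>\<close>] by blast
  obtain CG where CG: "CG \<ge> 0" "\<forall>\<^sub>F x in nhds xb. \<forall>\<alpha>. norm (Fg' \<alpha> x) \<le> CG"
    using family_bound[where h = Fg' and a = xb] iso[OF Fg'_cont V] by blast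
  have "isCont (\<lambda>x. (\<lambda>(i, j, k). \<theta> k x \<bullet> (r' j x (r i x) - r' i x (r j x))) a) xb" for a
    by (cases a, rule iso[OF _ \<open>open \<Omega>\<close> \<open>xb \<in> \<Omega>\<close>])
      (auto intro!: continuous_intros \<theta>_cont r'_cont r_cont)
  then obtain CC where CC: "CC \<ge> 0" "\<forall>\<^sub>F x in nhds xb. \<forall>a. norm ((\<lambda>(i, j, k). \<theta> k x \<bullet> (r' j x (r i x) - r' i x (r j x))) a) \<le> CC"
    using family_bound[where h = "\<lambda>a x. (\<lambda>(i, j, k). \<theta> k x \<bullet> (r' j x (r i x) - r' i x (r j x))) a" and a = xb] by blast

  have near: "\<forall>\<^sub>F t in nhds 0. \<forall>\<alpha>. \<forall>l\<in>{..<p \<alpha>}. \<forall>i.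
      \<bar>\<theta> i (P \<alpha> t) \<bullet> P' \<alpha> t (axis (coord l) 1) - (if i = idx \<alpha> l then 1 else 0)\<bar> < 1 / (2 * n)"
  proof (intro eventually_all_finite eventually_ball_finite ballI)
    fix \<alpha> l i assume "l \<in> {..<p \<alpha>}"
    then have l: "l < p \<alpha>" by simp
    let ?h = "\<lambda>t. \<theta> i (P \<alpha> t) \<bullet> P' \<alpha> t (axis (coord l) 1) - (if i = idx \<alpha> l then 1 else 0)"
    have "isCont (P \<alpha>) 0" using P_deriv[OF \<Theta>(2)] by (rule has_derivative_continuous)
    moreover have "isCont (\<theta> i) (P \<alpha> 0)" using iso[OF \<theta>_cont \<open>open \<Omega>\<close>] P0 \<open>xb \<in> \<Omega>\<close> by simp
    ultimately have "isCont ?h 0"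
      using iso[OF P'_cont \<Theta>(1,2)] by (intro continuous_intros) (auto intro: isCont_o2)
    \<comment> \<open>All vertices of 0 are 0, so \<open>P'_axis\<close> holds at 0 for every
      \<open>l\<close> at once: there the partial derivatives of \<open>P\<close> are the frame
      fields and \<open>a\<close> is exactly the identity.\<close>
    moreover have "?h 0 = 0"
      using P'_axis[OF \<Theta>(2) l] dual[OF \<open>xb \<in> \<Omega>\<close>, of i "idx \<alpha> l"] by (simp add: P0)
    ultimately have "\<forall>\<^sub>F t in nhds 0. ?h t \<in> {-(1 / (2 * n))<..<1 / (2 * n)}"
      using nM by (intro isCont_eventually) auto
    then show "\<forall>\<^sub>F t in nhds 0. \<bar>?h t\<bar> < 1 / (2 * n)"
      by eventually_elim auto
  qed auto

  \<comment> \<open>All smallness conditions of the two locales, with the constants fixed before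
    \<delta>. The neighbourhood comes afterwards and only has to keep the flow times in the
    \<delta>-ball.\<close>
  let ?\<Phi> = "\<lambda>\<delta>. (\<forall>t\<in>ball 0 \<delta>. \<forall>\<alpha>. norm (P' \<alpha> t) \<le> CP) \<and>
      (\<forall>t\<in>ball 0 \<delta>. \<forall>\<alpha>. \<forall>l\<in>{..<p \<alpha>}. \<forall>i.
        \<bar>\<theta> i (P \<alpha> t) \<bullet> P' \<alpha> t (axis (coord l) 1) - (if i = idx \<alpha> l then 1 else 0)\<bar> < 1 / (2 * n)) \<and>
      (n * F0) * \<delta> < \<rho> / (2 * M) \<and> (M * (n * F1)) * \<delta> < 1 / 2 \<and> (M * (n * (F1 * CP)) * CQ) * \<delta> < 1 / 2 \<and>
      (n * (n * CC)) * \<delta> < 1 \<and> (n * (n * (2 * (2 * M * F1)))) * \<delta> < 1 / 4 \<and> 0 < \<delta>"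
  have "\<forall>\<^sub>F \<delta> in at_right 0. ?\<Phi> \<delta>"
    using \<rho>(1) nM
    by (intro eventually_conj eventually_ball_at_right CP(2) near eventually_mult_le_at_right eventually_at_right_less) auto
  from eventually_happens'[OF trivial_limit_at_right_real this] obtain \<delta> where "?\<Phi> \<delta>" by (rule exE)
  then have \<delta>: "\<And>t \<alpha>. t \<in> ball 0 \<delta> \<Longrightarrow> norm (P' \<alpha> t) \<le> CP"
      "\<And>t \<alpha> l i. t \<in> ball 0 \<delta> \<Longrightarrow> l < p \<alpha> \<Longrightarrow>
        \<bar>\<theta> i (P \<alpha> t) \<bullet> P' \<alpha> t (axis (coord l) 1) - (if i = idx \<alpha> l then 1 else 0)\<bar> < 1 / (2 * n)"
      "(n * F0) * \<delta> < \<rho> / (2 * M)" "(M * (n * F1)) * \<delta> < 1 / 2" "(M * (n * (F1 * CP)) * CQ) * \<delta> < 1 / 2"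
      "(n * (n * CC)) * \<delta> < 1" "(n * (n * (2 * (2 * M * F1)))) * \<delta> < 1 / 4" "0 < \<delta>"
    by blast+

  \<comment> \<open>The last conjunct excludes that a point of the manifold in \<open>N\<close> is
    reached by psi only with nonzero flow times: its chart coordinate has to lie in \<Theta>, where
    psi is injective.\<close>
  have ev_small: "\<forall>\<^sub>F x in nhds xb. \<forall>\<alpha>. x \<in> P \<alpha> ` \<Theta> \<alpha> \<and> Q \<alpha> x \<in> ball 0 \<delta> \<and> x \<in> V \<alpha> \<and>
      Fg \<alpha> x \<in> ball (gb $ \<alpha>) (\<rho> / (2 * M)) \<and> (x \<in> \<Xi>0 \<alpha> \<longrightarrow> inv_into (U \<alpha>) (\<xi> \<alpha>) x \<in> \<Theta> \<alpha>)"
  proof (intro eventually_all_finite eventually_conj)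
    fix \<alpha>
    show "\<forall>\<^sub>F x in nhds xb. x \<in> P \<alpha> ` \<Theta> \<alpha>" "\<forall>\<^sub>F x in nhds xb. x \<in> V \<alpha>"
      using \<Theta>(3) xbP V by (auto intro: eventually_nhds_in_open)
    show "\<forall>\<^sub>F x in nhds xb. Q \<alpha> x \<in> ball 0 \<delta>"
      using has_derivative_continuous[OF Q_deriv[OF xbP]] \<delta>(8) Q0 by (intro isCont_eventually) auto
    show "\<forall>\<^sub>F x in nhds xb. Fg \<alpha> x \<in> ball (gb $ \<alpha>) (\<rho> / (2 * M))"
      using Fg_cont Fg_xb nM \<rho>(1) by (intro isCont_eventually) auto
    have "xb \<in> \<Xi>0 \<alpha>" using manifold by blast
    with C1_inv obtain W H and H' :: "(real^'n::_) \<Rightarrow> (real^'n::_) \<Rightarrow>\<^sub>L (real^'n::_)" where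
      W: "open W" "xb \<in> W" "(H has_derivative H' xb) (at xb)" "\<And>y. y \<in> \<Xi>0 \<alpha> \<Longrightarrow> y \<in> W \<Longrightarrow> H y = inv_into (U \<alpha>) (\<xi> \<alpha>) y"
      unfolding C1_on_def by (metis IntI)
    have "inv_into (U \<alpha>) (\<xi> \<alpha>) xb = 0"
      using inv_into_f_f[of "\<xi> \<alpha>" "U \<alpha>" 0] \<xi> \<xi>0 by (simp add: bij_betw_def)
    then have "H xb \<in> \<Theta> \<alpha>" using W(4)[OF \<open>xb \<in> \<Xi>0 \<alpha>\<close> W(2)] \<Theta>(2) by simp
    then have "\<forall>\<^sub>F x in nhds xb. H x \<in> \<Theta> \<alpha>"
      using has_derivative_continuous[OF W(3)] \<Theta>(1) by (intro isCont_eventually) auto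
    moreover have "\<forall>\<^sub>F x in nhds xb. x \<in> W" using W by (intro eventually_nhds_in_open)
    ultimately show "\<forall>\<^sub>F x in nhds xb. x \<in> \<Xi>0 \<alpha> \<longrightarrow> inv_into (U \<alpha>) (\<xi> \<alpha>) x \<in> \<Theta> \<alpha>"
      by eventually_elim (use W(4) in auto)
  qed
  have "\<forall>\<^sub>F x in nhds xb. x \<in> ball xb \<rho>" using \<rho>(1) by (intro eventually_nhds_in_open) auto
  with ev_small CQ(2) CR(2) CG(2) CC(2)
  have "\<forall>\<^sub>F x in nhds xb. (\<forall>\<alpha>. x \<in> P \<alpha> ` \<Theta> \<alpha> \<and> Q \<alpha> x \<in> ball 0 \<delta> \<and> x \<in> V \<alpha> \<and>
      Fg \<alpha> x \<in> ball (gb $ \<alpha>) (\<rho> / (2 * M)) \<and> (x \<in> \<Xi>0 \<alpha> \<longrightarrow> inv_into (U \<alpha>) (\<xi> \<alpha>) x \<in> \<Theta> \<alpha>)) \<and>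
      (\<forall>\<alpha>. norm (Q' \<alpha> x) \<le> CQ) \<and> (\<forall>i. norm (r i x) \<le> CR) \<and> (\<forall>\<alpha>. norm (Fg' \<alpha> x) \<le> CG) \<and>
      (\<forall>a. norm ((\<lambda>(i, j, k). \<theta> k x \<bullet> (r' j x (r i x) - r' i x (r j x))) a) \<le> CC) \<and> x \<in> ball xb \<rho>"
    by (intro eventually_conj)
  then obtain \<epsilon> where \<epsilon>: "\<epsilon> > 0" and near_xb: "\<And>x. dist x xb < \<epsilon> \<Longrightarrow> (\<forall>\<alpha>. x \<in> P \<alpha> ` \<Theta> \<alpha> \<and> Q \<alpha> x \<in> ball 0 \<delta> \<and> x \<in> V \<alpha> \<and>
      Fg \<alpha> x \<in> ball (gb $ \<alpha>) (\<rho> / (2 * M)) \<and> (x \<in> \<Xi>0 \<alpha> \<longrightarrow> inv_into (U \<alpha>) (\<xi> \<alpha>) x \<in> \<Theta> \<alpha>)) \<and>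
      (\<forall>\<alpha>. norm (Q' \<alpha> x) \<le> CQ) \<and> (\<forall>i. norm (r i x) \<le> CR) \<and> (\<forall>\<alpha>. norm (Fg' \<alpha> x) \<le> CG) \<and>
      (\<forall>a. norm ((\<lambda>(i, j, k). \<theta> k x \<bullet> (r' j x (r i x) - r' i x (r j x))) a) \<le> CC) \<and> x \<in> ball xb \<rho>"
    unfolding eventually_nhds_metric by blast

  \<comment> \<open>Stability is formulated in the max norm; the square root of the dimension bounds
    the Euclidean norm by it.\<close>
  define e where "e = \<epsilon> / sqrt (real DIM((real^'n::_)))"
  have "e > 0" using \<epsilon> by (simp add: e_def)
  then obtain N where N: "open N" "xb \<in> N" "N \<subseteq> {x. infnorm (x - xb) < e}"
    and "\<forall>\<alpha>. \<exists>T. accessible (card (I \<alpha>)) T \<and> T \<subseteq> \<Theta> \<alpha> \<and> C1_diffeo T N (psi \<Omega> r (I \<alpha>) (\<xi> \<alpha>))"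
    using stable unfolding stable_configuration_def by meson
  then obtain T where T_all: "\<forall>\<alpha>. accessible (p \<alpha>) (T \<alpha>) \<and> T \<alpha> \<subseteq> \<Theta> \<alpha> \<and> C1_diffeo (T \<alpha>) N (P \<alpha>)"
    unfolding choice_iff P_def p_def by blast
  then have T: "accessible (p \<alpha>) (T \<alpha>)" "T \<alpha> \<subseteq> \<Theta> \<alpha>" "P \<alpha> ` T \<alpha> = N" for \<alpha>
    by (auto simp: C1_diffeo_def bij_betw_def)
  have N_near: "dist x xb < \<epsilon>" if "x \<in> N" for x
  proof -
    have "norm (x - xb) \<le> sqrt (real DIM((real^'n::_))) * infnorm (x - xb)" by (rule norm_le_infnorm)
    also have "\<dots> < sqrt (real DIM((real^'n::_))) * e"
      using N(3) that by (intro mult_strict_left_mono) auto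
    also have "\<dots> = \<epsilon>" by (simp add: e_def)
    finally show ?thesis by (simp add: dist_norm)
  qed
  note near_N = near_xb[OF N_near]
  have N_\<Omega>: "N \<subseteq> \<Omega>" using near_N \<rho>(2) by force
  have N_\<rho>: "N \<subseteq> cball xb \<rho>" using near_N by force
  have T_in: "t \<in> T \<alpha> \<Longrightarrow> t \<in> \<Theta> \<alpha>" for t \<alpha> using T(2) by blast
  have P_in: "t \<in> T \<alpha> \<Longrightarrow> P \<alpha> t \<in> N" for t \<alpha> using T(3) by blast
  have N_img: "x \<in> N \<Longrightarrow> x \<in> P \<alpha> ` \<Theta> \<alpha>" for x \<alpha> using T by blast
  \<comment> \<open>\<open>Q\<close> inverts \<open>P\<close> on the larger set \<Theta>; by
    injectivity there it maps \<open>N\<close> into \<open>T\<close>.\<close>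
  have Q_in: "x \<in> N \<Longrightarrow> Q \<alpha> x \<in> T \<alpha>" for x \<alpha> using T(3)[of \<alpha>] QP T_in by (metis imageE)
  have PQ: "x \<in> N \<Longrightarrow> P \<alpha> (Q \<alpha> x) = x" for x \<alpha> using T(3)[of \<alpha>] QP T_in by (metis imageE)
  have T_ball: "t \<in> T \<alpha> \<Longrightarrow> t \<in> ball 0 \<delta>" for t \<alpha>
    using near_N[OF P_in] QP[OF T_in] by metis

  have path: "broken_path (p \<alpha>) (\<lambda>k. r (idx \<alpha> k)) (T \<alpha>) N (P \<alpha>) (Q \<alpha>) (P' \<alpha>) (Q' \<alpha>)" for \<alpha>
  proof
    show "P' \<alpha> (vertex (p \<alpha>) (Suc k) t) (axis (coord k) 1) = r (idx \<alpha> k) (P \<alpha> (vertex (p \<alpha>) (Suc k) t))"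
      if "k < p \<alpha>" "t \<in> T \<alpha>" for k t
    proof (rule P'_axis)
      have "closed_segment (vertex (p \<alpha>) k t) (vertex (p \<alpha>) (Suc k) t) \<subseteq> T \<alpha>"
        using T(1)[of \<alpha>] that by (auto simp: accessible_def)
      then show "vertex (p \<alpha>) (Suc k) t \<in> \<Theta> \<alpha>" using T_in by (meson ends_in_segment(2) subsetD)
    qed (use that in \<open>auto simp: vec_eq_iff\<close>)
  qed (use p_le T N(1) P_in Q_in QP T_in PQ P_deriv Q_deriv N_img in
      \<open>auto intro: continuous_on_subset[OF P'_cont] continuous_on_subset[OF Q'_cont]\<close>)
  then have vertex_in: "vertex (p \<alpha>) 0 t \<in> T \<alpha>" if "t \<in> T \<alpha>" for t \<alpha>
    using broken_path.vertex_in[OF path that, of 0] by simp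

  \<comment> \<open>\<open>G\<close> is built from the ambient extension so that the chain rule
    applies on the open set \<open>T\<close>; its values are those of \<open>g\<close>, since the
    path starts on \<Xi>.\<close>
  define G where "G \<alpha> t = Fg \<alpha> (P \<alpha> (vertex (p \<alpha>) 0 t))" for \<alpha> t
  define G' where "G' \<alpha> t = Fg' \<alpha> (P \<alpha> (vertex (p \<alpha>) 0 t)) o\<^sub>L (P' \<alpha> (vertex (p \<alpha>) 0 t) o\<^sub>L Blinfun (vertex (p \<alpha>) 0))" for \<alpha> t
  have base_in: "P \<alpha> (vertex (p \<alpha>) 0 t) \<in> N" if "t \<in> T \<alpha>" for t \<alpha>
    using P_in vertex_in that by blast
  have base_\<Xi>: "P \<alpha> (vertex (p \<alpha>) 0 t) \<in> \<Xi> \<alpha>" if "t \<in> T \<alpha>" for t \<alpha>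
  proof -
    have v: "vertex (p \<alpha>) 0 t \<in> \<Theta> \<alpha>" using vertex_in T_in that by blast
    have "P \<alpha> (vertex (p \<alpha>) 0 t) = \<xi> \<alpha> (vertex (p \<alpha>) 0 t)" by (rule psi[OF v])
    also have "\<dots> \<in> \<Xi>0 \<alpha>" using in_U[OF T_in[OF that]] \<xi>(1) by (auto simp: bij_betw_def)
    finally show ?thesis using shrunk v by (auto simp: P_def)
  qed
  have G_g: "G \<alpha> t = g \<alpha> (P \<alpha> (vertex (p \<alpha>) 0 t))" if "t \<in> T \<alpha>" for t \<alpha>
    unfolding G_def using near_N[OF base_in[OF that]] by (intro Fg_eq base_\<Xi> that) auto

  \<comment> \<open>The bound \<open>CG * CP\<close> on \<open>G'\<close> needs no further factor
    because \<open>vertex\<close> is a coordinate projection of norm at most 1.\<close>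
  interpret stable_frame p idx r r' T N P Q P' Q' ff f' G G' xb gb \<rho> \<delta> CP CQ F0 F1 "CG * CP" I \<theta> \<theta>' c CR CC
  proof (intro stable_frame.intro picard.intro stable_frame_axioms.intro path idx N_\<rho>)
    show "(ff \<alpha> (idx \<alpha> k) has_derivative f' \<alpha> (idx \<alpha> k) z) (at z)"
      if "k < p \<alpha>" "z \<in> cball xb \<rho> \<times> cball gb \<rho>" for \<alpha> k z
      using that sub by (intro f_deriv idx_in) auto
    show "continuous_on (cball xb \<rho> \<times> cball gb \<rho>) (f' \<alpha> (idx \<alpha> k))" if "k < p \<alpha>" for \<alpha> k
      using continuous_on_subset[OF f'_cont sub] idx_in that by blast
    show "\<bar>ff \<alpha> (idx \<alpha> k) z\<bar> \<le> F0" if "k < p \<alpha>" "z \<in> cball xb \<rho> \<times> cball gb \<rho>" for \<alpha> k z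
      using that sub by (intro F0 idx_in) auto
    show "norm (f' \<alpha> (idx \<alpha> k) z) \<le> F1" if "k < p \<alpha>" "z \<in> cball xb \<rho> \<times> cball gb \<rho>" for \<alpha> k z
      using that by (intro F1 idx_in) auto
    show "(G \<alpha> has_derivative G' \<alpha> t) (at t)" if "t \<in> T \<alpha>" for \<alpha> t
    proof -
      have v: "vertex (p \<alpha>) 0 t \<in> \<Theta> \<alpha>" using vertex_in T_in that by blast
      have "P \<alpha> (vertex (p \<alpha>) 0 t) \<in> V \<alpha>" using near_N[OF base_in[OF that]] by blast
      from has_derivative_compose[OF has_derivative_compose[OF vertex_deriv P_deriv[OF v]] Fg_deriv[OF this]]
      show ?thesis
        unfolding G_def[abs_def] G'_def by (rule has_derivative_eq_rhs) (simp add: fun_eq_iff)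
    qed
    show "continuous_on (T \<alpha>) (G' \<alpha>)" for \<alpha>
    proof -
      have P_cont: "continuous_on (\<Theta> \<alpha>) (P \<alpha>)"
        using P_deriv by (meson continuous_at_imp_continuous_on has_derivative_continuous)
      have vc: "continuous_on (T \<alpha>) (vertex (p \<alpha>) 0)"
        by (intro linear_continuous_on linear_conv_bounded_linear[THEN iffD1] linear_vertex)
      have Pv: "continuous_on (T \<alpha>) (\<lambda>t. P \<alpha> (vertex (p \<alpha>) 0 t))"
        by (rule continuous_on_compose2[OF P_cont vc]) (use vertex_in T_in in auto)
      show ?thesis
        unfolding G'_def[abs_def]
        by (intro continuous_intros continuous_on_compose2[OF Fg'_cont Pv] continuous_on_compose2[OF P'_cont vc])
          (use near_N[OF base_in] vertex_in T_in in auto)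
    qed
    show "norm (G' \<alpha> t) \<le> CG * CP" if t: "t \<in> T \<alpha>" for \<alpha> t
    proof -
      have 1: "norm (Fg' \<alpha> (P \<alpha> (vertex (p \<alpha>) 0 t))) \<le> CG" using near_N[OF base_in[OF t]] by blast
      have 2: "norm (P' \<alpha> (vertex (p \<alpha>) 0 t)) \<le> CP" using \<delta>(1) T_ball vertex_in t by blast
      have "norm (vertex (p \<alpha>) 0 v) \<le> 1 * norm v" for v :: "real^'n::_"
        unfolding mult_1 by (rule norm_le_componentwise_cart) auto
      then have 3: "norm (Blinfun (vertex (p \<alpha>) 0) :: (real^'n::_) \<Rightarrow>\<^sub>L (real^'n::_)) \<le> 1"
        by (intro norm_blinfun_bound) auto
      have "norm (G' \<alpha> t) \<le> CG * (CP * 1)"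
        unfolding G'_def using 1 2 3 CG(1) CP(1)
        by (intro order_trans[OF norm_blinfun_compose] mult_mono) auto
      then show ?thesis by simp
    qed
    show "\<bar>G \<alpha> t - gb $ \<alpha>\<bar> \<le> \<rho> / (2 * real CARD('m))" if "t \<in> T \<alpha>" for \<alpha> t
      using near_N[OF base_in[OF that]] by (auto simp: G_def M_def dist_real_def abs_minus_commute intro: less_imp_le)
    show "norm (P' \<alpha> t) \<le> CP" if "t \<in> T \<alpha>" for \<alpha> t using \<delta>(1) T_ball that by blast
    show "norm (Q' \<alpha> x) \<le> CQ" if "x \<in> N" for \<alpha> x using near_N[OF that] by blast
    show "\<bar>t $ coord k\<bar> \<le> \<delta>" if "t \<in> T \<alpha>" for t \<alpha> k
      using T_ball[OF that] component_le_norm_cart[of t "coord k"] by simp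
    show "real CARD('n) * (\<delta> * F0) \<le> \<rho> / (2 * real CARD('m))"
      using \<delta>(3) by (simp add: n_def M_def mult_ac)
    show "real CARD('m) * (real CARD('n) * (\<delta> * F1)) \<le> 1 / 2"
      using \<delta>(4) by (simp add: n_def M_def mult_ac)
    show "real CARD('m) * (real CARD('n) * (\<delta> * (F1 * CP)) * CQ) \<le> 1 / 2"
      using \<delta>(5) by (simp add: n_def M_def mult_ac)
    show "real CARD('n) * (real CARD('n) * (\<delta> * CC)) < 1"
      using \<delta>(6) by (simp add: n_def M_def mult_ac)
    show "real CARD('n) * (\<delta> * (real CARD('n) * (2 * (2 * real CARD('m) * F1)))) \<le> 1 / 4"
      using \<delta>(7) by (simp add: n_def M_def mult_ac)
    show "(r i has_derivative r' i x) (at x)" if "x \<in> N" for i x using r_deriv N_\<Omega> that by blast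
    show "continuous_on N (r' i)" for i by (rule continuous_on_subset[OF r'_cont N_\<Omega>])
    show "norm (r i x) \<le> CR" if "x \<in> N" for i x using near_N[OF that] by blast
    show "\<theta> i x \<bullet> r j x = (if i = j then 1 else 0)" if "x \<in> N" for i j x using dual N_\<Omega> that by blast
    show "(\<Sum>i\<in>UNIV. (\<theta> i x \<bullet> v) *\<^sub>R r i x) = v" if "x \<in> N" for x v using expand N_\<Omega> that by blast
    show "(\<theta> i has_derivative \<theta>' i x) (at x)" if "x \<in> N" for i x using \<theta>_deriv N_\<Omega> that by blast
    show "r' j x (r i x) - r' i x (r j x) = (\<Sum>k\<in>UNIV. c i j k x *\<^sub>R r k x)" if "x \<in> N" for i j x
      using bracket structure_coeffs N_\<Omega> that by (metis subsetD)
    show "c i j k x = 0" if "i \<in> I \<alpha>" "j \<in> I \<alpha>" "k \<notin> I \<alpha>" "x \<in> N" for i j k \<alpha> x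
      using c_zero[OF that(1-3)] N_\<Omega> that(4) by blast
    show "\<bar>c i j k x\<bar> \<le> CC" if "x \<in> N" for i j k x
    proof -
      have "norm ((\<lambda>(i, j, k). \<theta> k x \<bullet> (r' j x (r i x) - r' i x (r j x))) (i, j, k)) \<le> CC"
        using near_N[OF that] by blast
      then show ?thesis using c_eq[of x i j k] N_\<Omega> that by auto
    qed
    show "\<bar>\<theta> i (P \<alpha> t) \<bullet> P' \<alpha> t (axis (coord l) 1) - (if i = idx \<alpha> l then 1 else 0)\<bar> \<le> 1 / (2 * real CARD('n))"
      if "t \<in> T \<alpha>" "l < p \<alpha>" for t \<alpha> l i
      using \<delta>(2)[OF T_ball[OF that(1)] that(2), of i] unfolding n_def by (rule less_imp_le)
    show "f' \<alpha> j z (0, axis \<beta> 1) = 0"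
      if "i \<in> I \<alpha>" "j \<in> I \<alpha>" "i \<noteq> j" "i \<notin> I \<beta>" "z \<in> N \<times> cball gb \<rho>" for \<alpha> i j \<beta> z
    proof -
      have "fst z \<in> \<Omega>" "snd z \<in> \<Upsilon>" using that(5) N_\<Omega> \<rho>(3) by auto
      then show ?thesis
        using f_indep[OF that(1-4), of "fst z" "snd z"] grad_u[OF that(2), of "fst z" "snd z" \<beta>] by simp
    qed
    show "f' \<alpha> j (x, u) (r i x, 0) + (\<Sum>\<beta> | i \<in> I \<beta>. f' \<alpha> j (x, u) (0, axis \<beta> 1) * ff \<beta> i (x, u))
      - f' \<alpha> i (x, u) (r j x, 0) - (\<Sum>\<beta> | j \<in> I \<beta>. f' \<alpha> i (x, u) (0, axis \<beta> 1) * ff \<beta> j (x, u))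
      = (\<Sum>k\<in>I \<alpha>. c i j k x * ff \<alpha> k (x, u))"
      if "i \<in> I \<alpha>" "j \<in> I \<alpha>" "i \<noteq> j" "(x, u) \<in> N \<times> cball gb \<rho>" for \<alpha> i j x u
    proof -
      have xu: "x \<in> \<Omega>" "u \<in> \<Upsilon>" using that(4) N_\<Omega> \<rho>(3) by auto
      from integrability[OF that(1-3) xu] show ?thesis
        unfolding grad_x[OF that(1) xu] grad_x[OF that(2) xu] grad_u[OF that(1) xu] grad_u[OF that(2) xu]
        by (simp add: ff_def)
    qed
    show "G \<alpha> (vertex (p \<alpha>) l t) = G \<alpha> t" for \<alpha> l t
    proof -
      have "vertex (p \<alpha>) 0 (vertex (p \<alpha>) l t) = vertex (p \<alpha>) 0 t" by (auto simp: vec_eq_iff)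
      then show ?thesis by (simp add: G_def)
    qed
  qed (use \<rho>(1) \<delta>(8) CP(1) CQ(1) CC(1) CG(1) F0(1) F1(1) in auto)

  have comp_grad: "grad (\<lambda>y. u y $ \<alpha>) x \<bullet> v = w v $ \<alpha>" if "(u has_derivative blinfun_apply w) (at x)"
    for u :: "(real^'n::_) \<Rightarrow> (real^'m)" and w \<alpha> x v
    by (rule grad_inner(1)[OF bounded_linear.has_derivative[OF bounded_linear_vec_nth that]])

  have "\<exists>u. is_solution \<Upsilon> r I f \<Xi> g N u"
  proof -
    obtain u w where u: "good u" "\<And>x. x \<in> N \<Longrightarrow> (u has_derivative blinfun_apply (w x)) (at x)" "continuous_on N w"
      "\<And>\<alpha> i x. i \<in> I \<alpha> \<Longrightarrow> x \<in> N \<Longrightarrow> w x (r i x) $ \<alpha> = ff \<alpha> i (x, u x)"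
      "\<And>\<alpha> t. t \<in> T \<alpha> \<Longrightarrow> u (P \<alpha> (vertex (p \<alpha>) 0 t)) $ \<alpha> = G \<alpha> t"
      using solution_exists by blast
    have "u x $ \<alpha> = g \<alpha> x" if x: "x \<in> \<Xi> \<alpha> \<inter> N" for \<alpha> x
    proof -
      \<comment> \<open>The chart coordinate \<open>s\<close> is its own vertex 0 and psi maps it to
        \<open>x\<close>. Hence the path to \<open>x\<close> has only trivial legs and the data are
        attained on all of \<Xi> inside \<open>N\<close>.\<close>
      define s where "s = inv_into (U \<alpha>) (\<xi> \<alpha>) x"
      have x0: "x \<in> \<Xi>0 \<alpha>" "x \<in> N" using x shrunk by auto
      then have s\<Theta>: "s \<in> \<Theta> \<alpha>" using near_N[OF x0(2)] by (auto simp: s_def)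
      have sU: "s \<in> U \<alpha>" and \<xi>s: "\<xi> \<alpha> s = x"
        using x0(1) \<xi>(1)[of \<alpha>] inv_into_into[of x "\<xi> \<alpha>" "U \<alpha>"] f_inv_into_f[of x "\<xi> \<alpha>" "U \<alpha>"]
        by (auto simp: s_def bij_betw_def)
      have vs: "vertex (p \<alpha>) 0 s = s"
        using sU \<xi>(2)[of \<alpha>] by (auto simp: last_coords_def vec_eq_iff)
      have "P \<alpha> s = x" using psi[of \<alpha> s] vs s\<Theta> \<xi>s by simp
      then have "Q \<alpha> x = s" using QP[OF s\<Theta>] by simp
      then have "s \<in> T \<alpha>" using Q_in[OF x0(2), of \<alpha>] by simp
      then show ?thesis
        using u(5)[of s \<alpha>] G_g[of s \<alpha>] vs \<open>P \<alpha> s = x\<close> by simp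
    qed
    moreover have "C1_on N u" unfolding C1_on_open_iff[OF N(1)] using u(2,3) by blast
    moreover have "u ` N \<subseteq> \<Upsilon>" using u(1) \<rho>(3) by (auto simp: good_def)
    moreover have "grad (\<lambda>y. u y $ \<alpha>) x \<bullet> r i x = f \<alpha> i x (u x)" if "i \<in> I \<alpha>" "x \<in> N" for \<alpha> i x
      using comp_grad[OF u(2)[OF that(2)]] u(4)[OF that] by (simp add: ff_def)
    ultimately show ?thesis unfolding is_solution_def by blast
  qed
  \<comment> \<open>A solution only has values in \<Upsilon>. Membership in the ball around
    \<open>gb\<close> is derived here, so that any two solutions on \<open>N\<close> can be
    compared.\<close>
  moreover have fixed: "good u \<and> (\<forall>x\<in>N. phi u x = u x)" if sol: "is_solution \<Upsilon> r I f \<Xi> g N u" for u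
  proof -
    have "C1_on N u" using sol by (simp add: is_solution_def)
    then obtain w :: "(real^'n::_) \<Rightarrow> (real^'n::_) \<Rightarrow>\<^sub>L (real^'m)" where
      w: "\<And>x. x \<in> N \<Longrightarrow> (u has_derivative blinfun_apply (w x)) (at x)"
      unfolding C1_on_open_iff[OF N(1)] by blast
    have u\<Upsilon>: "(x, u x) \<in> \<Omega> \<times> \<Upsilon>" if "x \<in> N" for x
      using sol that N_\<Omega> by (auto simp: is_solution_def)
    have uc: "continuous_on N u"
      using w by (meson continuous_at_imp_continuous_on has_derivative_continuous)
    have h1: "continuous_on N (\<lambda>y. ff \<alpha> (idx \<alpha> k) (y, u y))" if "k < p \<alpha>" for \<alpha> k
      by (rule continuous_on_compose2[OF f_continuous[OF idx_in[OF that], folded ff_def]])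
        (use u\<Upsilon> uc in \<open>auto intro!: continuous_intros\<close>)
    have h2: "\<bar>ff \<alpha> (idx \<alpha> k) (y, u y)\<bar> \<le> F0" if "k < p \<alpha>" "y \<in> N" for \<alpha> k y
      using F0(2)[OF idx_in[OF that(1)] u\<Upsilon>[OF that(2)]] .
    have h3: "w x (r (idx \<alpha> k) x) $ \<alpha> = ff \<alpha> (idx \<alpha> k) (x, u x)" if "k < p \<alpha>" "x \<in> N" for \<alpha> k x
      using sol comp_grad[OF w[OF that(2)], of \<alpha> "r (idx \<alpha> k) x"] idx_in[OF that(1)] that(2)
      by (simp add: is_solution_def ff_def)
    have h4: "u (P \<alpha> (vertex (p \<alpha>) 0 t)) $ \<alpha> = G \<alpha> t" if "t \<in> T \<alpha>" for \<alpha> t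
      using sol base_in[OF that] base_\<Xi>[OF that] G_g[OF that] by (simp add: is_solution_def)
    show ?thesis
    proof (intro conjI ballI)
      show "good u"
        by (rule solution_fixed_point(1)[where w = w]) (use w h1 h2 h3 h4 in blast)+
      show "phi u x = u x" if "x \<in> N" for x
        by (rule solution_fixed_point(2)[where w = w]) (use w h1 h2 h3 h4 that in blast)+
    qed
  qed
  moreover have "u x = v x"
    if "is_solution \<Upsilon> r I f \<Xi> g N u" "is_solution \<Upsilon> r I f \<Xi> g N v" "x \<in> N" for u v x
    using fixed_point_unique[of u v x] fixed[OF that(1)] fixed[OF that(2)] that(3) by blast
  ultimately show ?thesis
    using N(1,2) N_\<Omega> by blast
qed

end
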